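(* Let $X$ be an at most countable set, let $F(X)$ be the free abelian semigroup generated by $X$, and let $\lambda=\pm1$. Then there is a set $\Omega$ of variables such that $$\mathrm{Sha}_{\mathbb{Z},\lambda}(\mathbb{Z}[X])\cong\mathbb{Z}[\Omega]\oplus N$$ (a direct sum of abelian groups, with $\mathbb{Z}[\Omega]$ a polynomial subalgebra), where $N$ is the subgroup of $\mathrm{Sha}_{\mathbb{Z},\lambda}(\mathbb{Z}[X])$ spanned by the pure tensors of the form $$w_0\otimes w_1\otimes\cdots\otimes w_r,\quad w_i\in\{1\}\cup F(X)\ (0\le i\le r),\quad w_i=1\text{ for some }1\le i\le r,\quad r\ge1.$$ When $X$ is finite, $\Omega=X\cup Y$, where $Y$ is a graded set in bijection with the graded set $\mathrm{Lyn}(F(X))$ of Lyndon words.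
   Context: Mixable shuffle algebra: let $\mathbf{k}$ be a commutative ring, $\lambda\in\mathbf{k}$, and $A$ a commutative $\mathbf{k}$-algebra. Then $\mathrm{MS}_{\mathbf{k},\lambda}(A)=\bigoplus_{n\ge0}A^{\otimes n}$ ($A^{\otimes0}=\mathbf{k}$) with the bilinear product $\diamond$ whose identity is $1\in\mathbf{k}$ and, for pure tensors $\mathfrak{a}=a_1\otimes\mathfrak{a}'$, $\mathfrak{b}=b_1\otimes\mathfrak{b}'$ of length $\ge1$ (with $a\otimes1_{\mathbf{k}}$ read as $a$), $\mathfrak{a}\diamond\mathfrak{b}=a_1\otimes(\mathfrak{a}'\diamond\mathfrak{b})+b_1\otimes(\mathfrak{a}\diamond\mathfrak{b}')+\lambda(a_1b_1)\otimes(\mathfrak{a}'\diamond\mathfrak{b}')$. For unital commutative $A$, the free commutative Rota-Baxter algebra of weight $\lambda$ on $A$ is the tensor product algebra $\mathrm{Sha}_{\mathbf{k},\lambda}(A)=A\otimes\mathrm{MS}_{\mathbf{k},\lambda}(A)=\bigoplus_{r\ge0}A^{\otimes(r+1)}$. $F(X)$ has no identity; $\{1\}\cup F(X)$ is the free abelian monoid on $X$, a $\mathbb{Z}$-basis of $\mathbb{Z}[X]$, and the $1$ among the $w_i$ is its identity. For $X$ finite and ordered, $F(X)$ is totally ordered first by total degree, then lexicographically as induced by the order on $X$; the degree of a word $w_1\otimes\cdots\otimes w_r$ with letters in $F(X)$ is $\sum\deg(w_i)$. Lexicographic order on words: $u<v$ iff either $v=u\otimes x$ with $x$ non-empty, or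 $u=x\otimes a\otimes u'$, $v=x\otimes b\otimes v'$ with letters $a<b$. A Lyndon word is a non-empty word $w$ such that $w=u\otimes v$ with $u,v$ non-empty implies $w<v$; $\mathrm{Lyn}(F(X))$, the set of Lyndon words, is graded by degree. *)

theory Defs
  imports
    "HOL-Algebra.QuotRing"
    "HOL-Algebra.Generated_Groups"
    "HOL-Library.Poly_Mapping"
    "HOL-Library.Multiset"
    "HOL-Library.Countable_Set"
begin

section \<open>The free commutative Rota-Baxter algebra\<close>

text \<open>
  Everything is over the base ring of integers, so that \<open>A\<close> is an arbitrary commutative ring.
  A word \<open>[a\<^sub>1, \<dots>, a\<^sub>n]\<close> of elements of \<open>A\<close> stands for the pure tensor
  \<open>a\<^sub>1 \<otimes> \<dots> \<otimes> a\<^sub>n\<close>. The direct sum of the tensor powers of \<open>A\<close> is realised as the free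
  abelian group on words modulo additivity in each letter (additivity implies the
  compatibility with integer scalars).

  The following is the product of mixable shuffles on words; the empty word is the
  identity of \<open>\<int>\<close>, the zeroth tensor power.
\<close>

definition prefix_letter :: "'a \<Rightarrow> ('a list \<Rightarrow>\<^sub>0 int) \<Rightarrow> ('a list \<Rightarrow>\<^sub>0 int)" where
  "prefix_letter a = frag_extend (\<lambda>w. frag_of (a # w))"

fun mixable_shuffle ::
  "int \<Rightarrow> ('a, 'b) ring_scheme \<Rightarrow> 'a list \<Rightarrow> 'a list \<Rightarrow> ('a list \<Rightarrow>\<^sub>0 int)" where
  "mixable_shuffle l A [] v = frag_of v"
| "mixable_shuffle l A (a # u) [] = frag_of (a # u)"
| "mixable_shuffle l A (a # u) (b # v) =
     prefix_letter a (mixable_shuffle l A u (b # v))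
   + prefix_letter b (mixable_shuffle l A (a # u) v)
   + frag_cmul l (prefix_letter (a \<otimes>\<^bsub>A\<^esub> b) (mixable_shuffle l A u v))"

text \<open>
  The summand \<open>A \<otimes> A\<^sup>r\<close> (the \<open>r\<close>-th tensor power) of the tensor product algebra of \<open>A\<close> with the
  mixable shuffle algebra is spanned by the words of length \<open>r + 1\<close>: heads are multiplied
  in \<open>A\<close>, tails by mixable shuffles.
\<close>

definition sha_word_mult ::
  "int \<Rightarrow> ('a, 'b) ring_scheme \<Rightarrow> 'a list \<Rightarrow> 'a list \<Rightarrow> ('a list \<Rightarrow>\<^sub>0 int)" where
  "sha_word_mult l A u v =
     prefix_letter (hd u \<otimes>\<^bsub>A\<^esub> hd v) (mixable_shuffle l A (tl u) (tl v))"

definition sha_words :: "('a, 'b) ring_scheme \<Rightarrow> 'a list set" where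
  "sha_words A = {w. w \<noteq> [] \<and> set w \<subseteq> carrier A}"

definition sha_free :: "int \<Rightarrow> ('a, 'b) ring_scheme \<Rightarrow> ('a list \<Rightarrow>\<^sub>0 int) ring" where
  "sha_free l A =
     \<lparr>carrier = {p. Poly_Mapping.keys p \<subseteq> sha_words A},
      monoid.mult = (\<lambda>p q. frag_extend (\<lambda>u. frag_extend (\<lambda>v. sha_word_mult l A u v) q) p),
      one = frag_of [\<one>\<^bsub>A\<^esub>],
      zero = 0,
      add = (+)\<rparr>"

definition tensor_relations ::
  "int \<Rightarrow> ('a, 'b) ring_scheme \<Rightarrow> ('a list \<Rightarrow>\<^sub>0 int) set" where
  "tensor_relations l A = generate (add_monoid (sha_free l A))
     {frag_of (u @ [a \<oplus>\<^bsub>A\<^esub> b] @ v) - frag_of (u @ [a] @ v) - frag_of (u @ [b] @ v) | u v a b.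
        set u \<subseteq> carrier A \<and> set v \<subseteq> carrier A \<and> a \<in> carrier A \<and> b \<in> carrier A}"

definition sha :: "int \<Rightarrow> ('a, 'b) ring_scheme \<Rightarrow> ('a list \<Rightarrow>\<^sub>0 int) set ring" where
  "sha l A = sha_free l A Quot tensor_relations l A"

definition pure_tensor ::
  "int \<Rightarrow> ('a, 'b) ring_scheme \<Rightarrow> 'a list \<Rightarrow> ('a list \<Rightarrow>\<^sub>0 int) set" where
  "pure_tensor l A w = tensor_relations l A +>\<^bsub>sha_free l A\<^esub> frag_of w"


section \<open>Polynomial rings over the integers\<close>

text \<open>
  Monomials are finite multisets of variables, so that \<open>frag_of m\<close> is the monomial \<open>m\<close> and
  \<open>frag_of {#x#}\<close> is the variable \<open>x\<close>; the product is the convolution product of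
  \<^theory>\<open>HOL-Library.Poly_Mapping\<close>.
\<close>

definition int_poly_ring :: "'v set \<Rightarrow> ('v multiset \<Rightarrow>\<^sub>0 int) ring" where
  "int_poly_ring V =
     \<lparr>carrier = {p. \<forall>m \<in> Poly_Mapping.keys p. set_mset m \<subseteq> V},
      monoid.mult = (*), one = 1, zero = 0, add = (+)\<rparr>"

text \<open>
  The elements of \<open>V\<close> are algebraically independent in \<open>R\<close>, and \<open>R\<close> is, as an abelian group, the
  internal direct sum of the polynomial subalgebra \<open>\<int>[V]\<close> and the subgroup \<open>N\<close>.
\<close>

definition poly_direct_sum :: "('a, 'b) ring_scheme \<Rightarrow> 'a set \<Rightarrow> 'a set \<Rightarrow> bool" where
  "poly_direct_sum R V N \<longleftrightarrow>
     (\<exists>\<phi> \<in> ring_hom (int_poly_ring V) R.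
        inj_on \<phi> (carrier (int_poly_ring V)) \<and>
        (\<forall>x \<in> V. \<phi> (frag_of {#x#}) = x) \<and>
        \<phi> ` carrier (int_poly_ring V) \<inter> N = {\<zero>\<^bsub>R\<^esub>} \<and>
        \<phi> ` carrier (int_poly_ring V) <+>\<^bsub>R\<^esub> N = carrier R)"


section \<open>The algebra on a polynomial ring\<close>

abbreviation sha_poly ::
  "int \<Rightarrow> 'x set \<Rightarrow> (('x multiset \<Rightarrow>\<^sub>0 int) list \<Rightarrow>\<^sub>0 int) set ring" where
  "sha_poly l X \<equiv> sha l (int_poly_ring X)"

text \<open>The pure tensor of a list of monomials; the monomial \<open>1\<close> is \<open>{#}\<close>.\<close>

definition monomial_tensor ::
  "int \<Rightarrow> 'x set \<Rightarrow> 'x multiset list \<Rightarrow> (('x multiset \<Rightarrow>\<^sub>0 int) list \<Rightarrow>\<^sub>0 int) set" where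
  "monomial_tensor l X ws = pure_tensor l (int_poly_ring X) (map frag_of ws)"

definition free_abelian_semigroup :: "'x set \<Rightarrow> 'x multiset set" where
  "free_abelian_semigroup X = {m. m \<noteq> {#} \<and> set_mset m \<subseteq> X}"

definition sha_unit_part ::
  "int \<Rightarrow> 'x set \<Rightarrow> (('x multiset \<Rightarrow>\<^sub>0 int) list \<Rightarrow>\<^sub>0 int) set set" where
  "sha_unit_part l X = generate (add_monoid (sha_poly l X))
     {monomial_tensor l X ws | ws r.
        r \<ge> 1 \<and> length ws = r + 1 \<and> set ws \<subseteq> {{#}} \<union> free_abelian_semigroup X \<and>
        (\<exists>i \<in> {1..r}. ws ! i = {#})}"

definition word_degree :: "'x multiset list \<Rightarrow> nat" where
  "word_degree ws = (\<Sum>w\<leftarrow>ws. size w)"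

definition sha_homogeneous ::
  "int \<Rightarrow> 'x set \<Rightarrow> nat \<Rightarrow> (('x multiset \<Rightarrow>\<^sub>0 int) list \<Rightarrow>\<^sub>0 int) set set" where
  "sha_homogeneous l X d = generate (add_monoid (sha_poly l X))
     {monomial_tensor l X ws | ws.
        ws \<noteq> [] \<and> set ws \<subseteq> {{#}} \<union> free_abelian_semigroup X \<and> word_degree ws = d}"

definition sha_variable ::
  "int \<Rightarrow> 'x set \<Rightarrow> 'x \<Rightarrow> (('x multiset \<Rightarrow>\<^sub>0 int) list \<Rightarrow>\<^sub>0 int) set" where
  "sha_variable l X x = monomial_tensor l X [{#x#}]"


section \<open>Lyndon words\<close>

text \<open>
  For a strict order \<open>r\<close> on the variables, a monomial is written as the word of its variables in
  non-decreasing order. Monomials are compared first by total degree, which is the length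
  of this word, and then lexicographically; this is what \<^const>\<open>lenlex\<close> does.
\<close>

definition monomial_less :: "('x \<times> 'x) set \<Rightarrow> ('x multiset \<times> 'x multiset) set" where
  "monomial_less r = {(mset xs, mset ys) | xs ys.
     sorted_wrt (\<lambda>x y. (x, y) \<in> r\<^sup>=) xs \<and> sorted_wrt (\<lambda>x y. (x, y) \<in> r\<^sup>=) ys \<and>
     (xs, ys) \<in> lenlex r}"

definition lyndon_words :: "'x set \<Rightarrow> ('x \<times> 'x) set \<Rightarrow> 'x multiset list set" where
  "lyndon_words X r = {w. w \<noteq> [] \<and> set w \<subseteq> free_abelian_semigroup X \<and>
     (\<forall>u v. u \<noteq> [] \<and> v \<noteq> [] \<and> w = u @ v \<longrightarrow> (w, v) \<in> lexord (monomial_less r))}"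

end

theory Submission
  imports Defs "HOL-Computational_Algebra.Formal_Power_Series"
begin

text \<open>
  A pure tensor of monomials either has a factor \<open>1\<close> behind the first place, and then belongs to \<open>N\<close>, or it
  is a monomial followed by a word over the semigroup \<open>F(X)\<close>. The tensors of the second kind span a
  subalgebra, the tensor product of \<open>\<int>[X]\<close> with the mixable shuffle algebra of the non-unital ring \<open>\<int>F(X)\<close>,
  and the point is that the latter is a polynomial ring. For a single variable it is the ring of
  quasi-symmetric functions, and the statement is the former conjecture of Ditters proved by Hazewinkel; his
  generators work in general.

  Evaluation turns algebra into arithmetic. For a finite sequence of integer points \<open>c\<^sub>1, c\<^sub>2, \<dots>\<close> a word
  \<open>a\<^sub>1 \<dots> a\<^sub>k\<close> of monomials has the value \<open>\<Sum> l\<^sup>k a\<^sub>1(c\<^sub>i\<^sub>1) \<dots> a\<^sub>k(c\<^sub>i\<^sub>k)\<close>, summed over \<open>i\<^sub>1 < \<dots> < i\<^sub>k\<close>. Values are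
  multiplicative (\<open>quasi_eval_mixable_shuffle\<close>) and determine the element (\<open>quasi_eval_injective\<close>), so
  the mixable shuffle algebra is a ring of integer-valued functions.

  The elementary symmetric functions \<open>e\<^sub>n(w)\<close> of the terms of this sum again come from integral combinations
  of words (\<open>quasi_elem\<close>, \<open>ev_quasi_elem\<close>). For a Lyndon word \<open>v\<close> the leading word of \<open>e\<^sub>n(v)\<close> is the power \<open>v\<^sup>n\<close>, with
  coefficient one (\<open>leads_quasi_elem\<close>), and leading words of products are concatenations if the Lyndon factors are
  in decreasing order (\<open>leads_product\<close>). As every word is a non-increasing concatenation of Lyndon words,
  triangularity shows that the \<open>e\<^sub>n(v)\<close> generate. The key fact about leading words is that the largest
  shuffle of two words is the sorted concatenation of their Lyndon factors (\<open>shuffle_le_sort\<close>).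

  There are too many \<open>e\<^sub>n(v)\<close>. Write \<open>v = u\<^sup>(\<^sup>g\<^sup>)\<close>, where the exponents in \<open>u\<close> have greatest common divisor one and
  are multiplied by \<open>g\<close>. The terms for \<open>v\<close> are up to sign the \<open>g\<close>-th powers of those for \<open>u\<close>, because \<open>l = \<plusminus>1\<close>.
  Elementary symmetric functions of \<open>g\<close>-th powers are integer polynomials in the elementary symmetric
  functions (\<open>elem_sym_powers_symmetric\<close>), so the \<open>e\<^sub>n(u)\<close> with \<open>u\<close> of content one suffice. They correspond to all
  Lyndon words \<open>u\<^sup>(\<^sup>n\<^sup>)\<close>, of the same multidegree as \<open>e\<^sub>n(u)\<close>.

  Algebraic independence is a matter of counting: by the unique factorization into Lyndon words, there are at
  most as many monomials in the generators of a given multidegree as words of this multidegree, and a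
  spanning family of \<open>\<int>\<^sup>n\<close> with at most \<open>n\<close> elements is independent (\<open>spanning_independent\<close>, \<open>gens_independent\<close>).

  Finally the algebra itself, a quotient of a free abelian group on words of polynomials, embeds into a
  ring of functions in the same way: the relations are exactly the elements with zero values
  (\<open>kernel_relations\<close>), and the tensors of monomials are a basis (\<open>carrier_sha\<close>, \<open>tensor_class_eq_iff\<close>).
\<close>

abbreviation supp :: "('k \<Rightarrow>\<^sub>0 'b::zero) \<Rightarrow> 'k set"
  where "supp \<equiv> Poly_Mapping.keys"

abbreviation coeff :: "('k \<Rightarrow>\<^sub>0 'b::zero) \<Rightarrow> 'k \<Rightarrow> 'b"
  where "coeff \<equiv> Poly_Mapping.lookup"

section \<open>Lyndon words and shuffles\<close>

locale strict_total =
  fixes R :: "('a \<times> 'a) set"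
  assumes trans_R: "trans R" and irrefl_R: "irrefl R" and total_R: "total R"
begin

abbreviation word_less :: "'a list \<Rightarrow> 'a list \<Rightarrow> bool"  (infix "\<prec>" 50)
  where "u \<prec> v \<equiv> (u, v) \<in> lexord R"

abbreviation word_le :: "'a list \<Rightarrow> 'a list \<Rightarrow> bool"  (infix "\<preceq>" 50)
  where "u \<preceq> v \<equiv> u = v \<or> u \<prec> v"

lemma not_R [simp]: "(a, a) \<notin> R"
  using irrefl_R by (simp add: irrefl_def)

lemma not_word_less [simp]: "\<not> w \<prec> w"
  by (simp add: lexord_irreflexive)

lemma word_less_trans: "u \<prec> v \<Longrightarrow> v \<prec> w \<Longrightarrow> u \<prec> w"
  using lexord_trans[OF _ _ trans_R] .

lemma word_less_total: "u \<prec> v \<or> u = v \<or> v \<prec> u"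
  using total_lexord[OF total_R] by (auto simp: total_on_def)

text \<open>
  The library sorts into ascending order; ordering words downwards makes it sort them into
  the non-increasing order in which Lyndon factors occur.
\<close>

definition word_ge :: "'a list \<Rightarrow> 'a list \<Rightarrow> bool"
  where "word_ge u v \<longleftrightarrow> v \<preceq> u"

definition word_greater :: "'a list \<Rightarrow> 'a list \<Rightarrow> bool"
  where "word_greater u v \<longleftrightarrow> v \<prec> u"

sublocale words: linorder word_ge word_greater
  by (unfold_locales; unfold word_ge_def word_greater_def)
    (use word_less_trans word_less_total not_word_less in blast)+

lemma word_le_trans: "u \<preceq> v \<Longrightarrow> v \<preceq> w \<Longrightarrow> u \<preceq> w"
  using word_less_trans by blast

lemma word_lessE:
  assumes "u \<prec> v"
  obtains (prefix) c w where "v = u @ c # w"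
  | (differ) x c d p q where "(c, d) \<in> R" "u = x @ c # p" "v = x @ d # q"
  using assms unfolding lexord_def by blast

lemma word_less_append_mono:
  assumes "u \<prec> v" "length v \<le> length u"
  shows "u @ p \<prec> v @ q"
  using assms by (rule lexord_sufI)

definition lyndon :: "'a list \<Rightarrow> bool" where
  "lyndon w \<longleftrightarrow> w \<noteq> [] \<and> (\<forall>u v. u \<noteq> [] \<and> v \<noteq> [] \<and> w = u @ v \<longrightarrow> w \<prec> v)"

lemma lyndon_suffix: "lyndon (u @ v) \<Longrightarrow> u \<noteq> [] \<Longrightarrow> v \<noteq> [] \<Longrightarrow> u @ v \<prec> v"
  by (auto simp: lyndon_def)

lemma lyndon_suffix_append:
  assumes "lyndon (u @ v)" "u \<noteq> []" "v \<noteq> []"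
  shows "(u @ v) @ p \<prec> v @ q"
  by (rule word_less_append_mono[OF lyndon_suffix]) (use assms in auto)

text \<open>
  If \<open>u\<close> is not a prefix of \<open>v\<close>, then \<open>u\<close> and \<open>v\<close> already differ inside \<open>u\<close>. If \<open>v = u v'\<close>, then
  \<open>v < v'\<close> because \<open>v\<close> is Lyndon, hence \<open>u v < u v' = v\<close>. A proper suffix of \<open>u v\<close> is compared with
  \<open>u v\<close> inside \<open>u\<close>, or it is a suffix of \<open>v\<close>.
\<close>

lemma lyndon_append:
  assumes u: "lyndon u" and v: "lyndon v" and uv: "u \<prec> v"
  shows "lyndon (u @ v)"
proof -
  have ne: "u \<noteq> []" "v \<noteq> []" using u v by (auto simp: lyndon_def)
  have *: "u @ v \<prec> v"
  proof (cases "\<exists>v'. v = u @ v'")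
    case True
    then obtain v' where v': "v = u @ v'" by blast
    with uv have "v' \<noteq> []" by auto
    with v v' ne have "v \<prec> v'" using lyndon_suffix by blast
    then have "u @ v \<prec> u @ v'" by (rule lexord_append_leftI)
    then show ?thesis using v' by simp
  next
    case False
    with uv show ?thesis
      by (cases rule: word_lessE) (auto simp: lexord_append_left_rightI)
  qed
  have "u @ v \<prec> q" if "p \<noteq> []" "q \<noteq> []" "u @ v = p @ q" for p q
  proof -
    from that(3) consider s where "u = p @ s" "q = s @ v" | s where "p = u @ s" "v = s @ q"
      by (auto simp: append_eq_append_conv2)
    then show ?thesis
    proof cases
      case 1
      show ?thesis
      proof (cases "s = []")
        case False
        then show ?thesis using lyndon_suffix_append[of p s v v] u 1 that by simp
      qed (use 1 * in simp)
    next
      case 2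
      then show ?thesis
      proof (cases "s = []")
        case False
        then have "v \<prec> q" using 2 v that lyndon_suffix by blast
        with * show ?thesis using word_less_trans by blast
      qed (use 2 * in simp)
    qed
  qed
  with ne show ?thesis by (auto simp: lyndon_def)
qed

text \<open>
  The shape of a Chen-Fox-Lyndon factorization.
\<close>

definition lyndon_factors :: "'a list list \<Rightarrow> bool" where
  "lyndon_factors ws \<longleftrightarrow> words.sorted ws \<and> (\<forall>w\<in>set ws. lyndon w)"

lemma lyndon_factors_Nil [simp]: "lyndon_factors []"
  by (simp add: lyndon_factors_def)

lemma lyndon_factors_Cons:
  "lyndon_factors (w # ws) \<longleftrightarrow> lyndon w \<and> (\<forall>v\<in>set ws. v \<preceq> w) \<and> lyndon_factors ws"
  by (auto simp: lyndon_factors_def word_ge_def)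

lemma lyndon_factors_concat_Nil:
  assumes "lyndon_factors ws" "concat ws = []"
  shows "ws = []"
proof (cases ws)
  case (Cons w us)
  with assms(1) have "w \<noteq> []" by (simp add: lyndon_factors_def lyndon_def)
  with assms(2) Cons show ?thesis by simp
qed simp

lemma lyndon_factors_append:
  "lyndon_factors (us @ vs) \<longleftrightarrow>
     lyndon_factors us \<and> lyndon_factors vs \<and> (\<forall>u\<in>set us. \<forall>v\<in>set vs. v \<preceq> u)"
  by (auto simp: lyndon_factors_def words.sorted_append word_ge_def)

lemma lyndon_factors_filter: "lyndon_factors ws \<Longrightarrow> lyndon_factors (filter P ws)"
  by (auto simp: lyndon_factors_def sorted_wrt_filter)

lemma lyndon_factors_sort: "(\<forall>w\<in>set ws. lyndon w) \<Longrightarrow> lyndon_factors (words.sort ws)"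
  by (auto simp: lyndon_factors_def)

lemma sort_eqI: "mset ws = mset vs \<Longrightarrow> lyndon_factors ws \<Longrightarrow> words.sort vs = ws"
  using words.properties_for_sort by (auto simp: lyndon_factors_def)

lemma sort_lyndon_factors: "lyndon_factors ws \<Longrightarrow> words.sort ws = ws"
  by (rule sort_eqI) auto

text \<open>
  As long as the new factor is smaller than the next one, the two merge into a Lyndon word.
\<close>

lemma lyndon_factors_join:
  "lyndon u \<Longrightarrow> lyndon_factors ws \<Longrightarrow> \<exists>vs. lyndon_factors vs \<and> concat vs = u @ concat ws"
proof (induction ws arbitrary: u)
  case Nil
  then show ?case by (intro exI[of _ "[u]"]) (simp add: lyndon_factors_Cons)
next
  case (Cons w ws)
  show ?case
  proof (cases "u \<prec> w")
    case True
    then show ?thesis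
      using Cons.IH[of "u @ w"] Cons.prems lyndon_append by (auto simp: lyndon_factors_Cons)
  next
    case False
    then have wu: "w \<preceq> u" using word_less_total[of w u] by blast
    have "v \<preceq> u" if "v \<in> set ws" for v
      by (rule word_le_trans[OF _ wu]) (use that Cons.prems in \<open>auto simp: lyndon_factors_Cons\<close>)
    with Cons.prems wu have "lyndon_factors (u # w # ws)"
      by (auto simp: lyndon_factors_Cons)
    then show ?thesis by (intro exI[of _ "u # w # ws"]) simp
  qed
qed

lemma lyndon_factorization: "\<exists>ws. lyndon_factors ws \<and> concat ws = w"
proof (induction w)
  case (Cons a w)
  have "lyndon [a]" by (auto simp: lyndon_def Cons_eq_append_conv)
  with Cons show ?case using lyndon_factors_join[of "[a]"] by auto
qed (auto intro: exI[of _ "[]"])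

text \<open>
  If the first factors had different lengths, the longer one, \<open>v\<close>, would have a proper suffix \<open>y\<close>
  that is a prefix of a factor \<open>p\<close> of the other factorization. Then \<open>v < y \<le> p \<le> u < v\<close>, where \<open>u\<close> is the
  shorter first factor.
\<close>

lemma lyndon_factors_unique:
  "lyndon_factors us \<Longrightarrow> lyndon_factors vs \<Longrightarrow> concat us = concat vs \<Longrightarrow> us = vs"
proof -
  have shorter: False
    if "lyndon_factors (u # us)" "lyndon v" "concat (u # us) = v @ q" "length u < length v"
    for u us v q
  proof -
    from that(3,4) obtain s where s: "v = u @ s" "concat us = s @ q" "s \<noteq> []"
      by (auto simp: append_eq_append_conv2)
    have ne: "\<exists>p \<in> set us. p \<noteq> [] \<and> (\<exists>x y. s = x @ y \<and> y \<noteq> [] \<and> (\<exists>z. p = y @ z))"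
      if "concat us = s @ q" "s \<noteq> []" for us s
      using that
    proof (induction us arbitrary: s)
      case (Cons u us)
      show ?case
      proof (cases "length s \<le> length u")
        case True
        with Cons.prems obtain z where "u = s @ z" by (auto simp: append_eq_append_conv2)
        then show ?thesis using Cons.prems by (intro bexI[of _ u]) (auto intro: exI[of _ "[]"])
      next
        case False
        with Cons.prems obtain s' where s': "s = u @ s'" "s' \<noteq> []" "concat us = s' @ q"
          by (auto simp: append_eq_append_conv2)
        from Cons.IH[OF s'(3,2)] obtain p x y z where
          "p \<in> set us" "p \<noteq> []" "s' = x @ y" "y \<noteq> []" "p = y @ z" by blast
        then show ?thesis
          using s'(1) by (intro bexI[of _ p] conjI exI[of _ "u @ x"] exI[of _ y] exI[of _ z]) auto
      qed
    qed simp
    from ne[OF s(2,3)] obtain p x y z where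
      p: "p \<in> set us" "p \<noteq> []" "s = x @ y" "y \<noteq> []" "p = y @ z" by blast
    have "lyndon u" and "p \<preceq> u" using that(1) p(1) by (auto simp: lyndon_factors_Cons)
    then have une: "u \<noteq> []" by (auto simp: lyndon_def)
    have "v \<prec> y" using lyndon_suffix[of "u @ x" y] that(2) s(1) p une by simp
    moreover have "y \<preceq> p" using p(5) by (cases z) (auto intro: lexord_append_rightI)
    moreover have "u \<prec> v" using s by (cases s) (auto intro: lexord_append_rightI)
    ultimately show False using \<open>p \<preceq> u\<close> word_less_trans not_word_less by metis
  qed
  show "lyndon_factors us \<Longrightarrow> lyndon_factors vs \<Longrightarrow> concat us = concat vs \<Longrightarrow> us = vs"
  proof (induction us arbitrary: vs)
    case Nil
    then show ?case by (cases vs) (auto simp: lyndon_factors_Cons lyndon_def)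
  next
    case (Cons u us)
    then have "vs \<noteq> []" by (auto simp: lyndon_factors_Cons lyndon_def)
    then obtain v vs' where vs: "vs = v # vs'" by (cases vs) auto
    have "\<not> length u < length v"
      using shorter[of u us v "concat vs'"] Cons.prems vs by (auto simp: lyndon_factors_Cons)
    moreover have "\<not> length v < length u"
      using shorter[of v vs' u "concat us"] Cons.prems vs by (auto simp: lyndon_factors_Cons)
    ultimately have "u = v \<and> concat us = concat vs'" using Cons.prems(3) vs by auto
    then show ?case using Cons vs by (auto simp: lyndon_factors_Cons)
  qed
qed

text \<open>
  The smallest factor of the tail is a proper suffix of the Lyndon word.
\<close>

lemma tail_factors_greater:
  assumes "lyndon (a # concat ws)" "lyndon_factors ws" "w \<in> set ws"
  shows "a # concat ws \<prec> w"
proof -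
  from assms(3) have ne: "ws \<noteq> []" by auto
  have l: "lyndon (last ws)" using assms(2) ne by (auto simp: lyndon_factors_def)
  have "a # concat ws = (a # concat (butlast ws)) @ last ws"
    using ne by (metis append_Cons append_Nil2 append_butlast_last_id concat.simps concat_append)
  then have "a # concat ws \<prec> last ws"
    using assms(1) l lyndon_suffix[of "a # concat (butlast ws)" "last ws"]
    by (auto simp: lyndon_def)
  moreover have "last ws \<preceq> w"
    using assms(2,3) ne
    by (metis append_butlast_last_id lyndon_factors_append list.set_intros(1) set_ConsD
        rotate1.simps(2) set_rotate1)
  ultimately show ?thesis using word_less_trans by auto
qed

text \<open>
  The comparison behind the maximality of sorted concatenations. Let \<open>f = a g\<close> be a Lyndon word
  and \<open>y\<close> the largest of some Lyndon words that exceed \<open>f\<close>. Starting a shuffle with the letter \<open>a\<close> of \<open>f\<close>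
  and continuing as well as possible is worse than placing the larger words first. The only
  critical case is \<open>y = a h\<close>, where \<open>g < h\<close>: let \<open>p\<close> be the part of \<open>g\<close> made of factors \<open>\<ge> y\<close>. If \<open>h\<close> does not
  start with \<open>p\<close>, it is larger than \<open>p\<close> at some letter; if \<open>h = p h'\<close>, then \<open>y\<close> follows \<open>p\<close> on one side
  and \<open>h'\<close> follows it on the other, and \<open>y < h'\<close> because \<open>h'\<close> is a proper suffix of the Lyndon word \<open>y\<close>.
\<close>

lemma exchange:
  assumes f: "lyndon (a # concat ks)" and ks: "lyndon_factors ks"
    and ys: "lyndon_factors (y # ys)" and gt: "\<forall>v\<in>set (y # ys). a # concat ks \<prec> v"
  shows "a # concat (words.sort (ks @ y # ys)) \<prec> concat (y # ys) @ a # concat ks"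
proof -
  have y: "lyndon y" "a # concat ks \<prec> y" using ys gt by (auto simp: lyndon_factors_Cons)
  then obtain b h where bh: "y = b # h" by (cases y) (auto simp: lyndon_def)
  show ?thesis
  proof (cases "a = b")
    case False
    then have "(a, b) \<in> R" using y bh by auto
    then show ?thesis using bh by simp
  next
    case True
    \<comment> \<open>factors that compare equal to y are equal to it, so their place among them does not matter\<close>
    define K1 where "K1 = filter (\<lambda>k. y \<preceq> k) ks"
    define K2 where "K2 = filter (\<lambda>k. \<not> y \<preceq> k) ks"
    have K2: "k \<prec> y" if "k \<in> set K2" for k
      using that word_less_total[of k y] by (auto simp: K2_def)
    have "lyndon_factors (K1 @ K2)"
      unfolding lyndon_factors_append
    proof (intro conjI ballI)
      show "v \<preceq> k" if "k \<in> set K1" "v \<in> set K2" for k v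
        by (rule word_le_trans[of _ y]) (use that K2 in \<open>auto simp: K1_def\<close>)
    qed (simp_all add: K1_def K2_def lyndon_factors_filter ks)
    moreover have "mset (K1 @ K2) = mset ks" by (simp add: K1_def K2_def)
    ultimately have ks_eq: "ks = K1 @ K2"
      using sort_eqI[of "K1 @ K2" ks] sort_lyndon_factors[OF ks] by simp
    have "lyndon_factors (K1 @ [y] @ words.sort (K2 @ ys))"
      unfolding lyndon_factors_append
    proof (intro conjI lyndon_factors_sort)
      show "lyndon_factors K1" using ks by (simp add: K1_def lyndon_factors_filter)
      show "lyndon_factors [y]" using y by (simp add: lyndon_factors_Cons)
      show "\<forall>w\<in>set (K2 @ ys). lyndon w"
        using ks ys by (auto simp: K2_def lyndon_factors_def)
      show "\<forall>u\<in>set [y]. \<forall>v\<in>set (words.sort (K2 @ ys)). v \<preceq> u"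
        using K2 ys by (auto simp: lyndon_factors_Cons)
      show "\<forall>u\<in>set K1. \<forall>v\<in>set ([y] @ words.sort (K2 @ ys)). v \<preceq> u"
      proof (intro ballI)
        fix k v assume kv: "k \<in> set K1" "v \<in> set ([y] @ words.sort (K2 @ ys))"
        show "v \<preceq> k"
          by (rule word_le_trans[of _ y]) (use kv K2 ys in \<open>auto simp: K1_def lyndon_factors_Cons\<close>)
      qed
    qed
    then have sort: "words.sort (ks @ y # ys) = K1 @ [y] @ words.sort (K2 @ ys)"
      by (rule sort_eqI[rotated]) (simp add: ks_eq)
    define p where "p = concat K1"
    define q where "q = concat K2"
    have ks': "concat ks = p @ q" by (simp add: ks_eq p_def q_def)
    have h: "p @ q \<prec> h" using y(2) bh True ks' by simp
    have "a # p @ y @ T \<prec> y @ T'" for T T'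
    proof (cases "\<exists>h'. h = p @ h'")
      case True
      then obtain h' where h': "h = p @ h'" by blast
      with h have "q \<prec> h'" using irrefl_R by simp
      then have "h' \<noteq> []" by auto
      then have "((a # p) @ h') @ T \<prec> h' @ T'"
        using lyndon_suffix_append[of "a # p" h'] y(1) bh h' \<open>a = b\<close> by simp
      then have "(a # p) @ y @ T \<prec> (a # p) @ h' @ T'"
        using bh h' \<open>a = b\<close> by (intro lexord_append_leftI) simp
      then show ?thesis using bh h' \<open>a = b\<close> by simp
    next
      case False
      from h obtain x c d r s where cd: "(c, d) \<in> R" "p @ q = x @ c # r" "h = x @ d # s"
        using False by (cases rule: word_lessE) auto
      show ?thesis
      proof (cases "length p \<le> length x")
        case True
        with cd(2) obtain x' where "x = p @ x'"
          using append_eq_append_conv2[of p q x "c # r"] by auto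
        with False cd(3) show ?thesis by simp
      next
        case len: False
        with cd(2) obtain p0 where p0: "p = x @ p0" "p0 @ q = c # r"
          using append_eq_append_conv2[of p q x "c # r"] by auto
        with len obtain p' where "p0 = c # p'" by (cases p0) auto
        with p0 have p': "p = x @ c # p'" by simp
        have "x @ c # p' @ y @ T \<prec> x @ d # s @ T'"
          using cd(1) by (rule lexord_append_left_rightI)
        then show ?thesis using cd(3) bh p' \<open>a = b\<close> by simp
      qed
    qed
    then show ?thesis by (simp add: sort p_def)
  qed
qed

text \<open>
  One letter of the induction for the next lemma. When the first letter \<open>a\<close> of the factor \<open>a g\<close> is used
  up, the factors \<open>ks\<close> of \<open>g\<close> all exceed \<open>a g\<close>, so they interact only with those words of \<open>gs\<close> that exceed
  \<open>a g\<close>. If there are none, nothing changes; otherwise the exchange lemma gives a strict inequality.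
\<close>

lemma shuffle_step:
  assumes fs: "lyndon_factors ((a # g) # fs)" and gs: "lyndon_factors gs"
    and IH: "\<And>ks. lyndon_factors (ks @ fs) \<Longrightarrow> concat ks = g \<Longrightarrow>
              z \<preceq> concat (words.sort ((ks @ fs) @ gs))"
  shows "a # z \<preceq> concat (words.sort (((a # g) # fs) @ gs))"
    and "\<exists>v\<in>set gs. a # g \<prec> v \<Longrightarrow>
         a # z \<prec> concat (words.sort (((a # g) # fs) @ gs))"
proof -
  obtain ks where ks: "lyndon_factors ks" "concat ks = g" using lyndon_factorization by blast
  have f: "lyndon (a # concat ks)" using fs ks by (simp add: lyndon_factors_Cons)
  have gt: "a # g \<prec> k" if "k \<in> set ks" for k
    using tail_factors_greater[OF f ks(1) that] ks by simp
  have ksfs: "lyndon_factors (ks @ fs)"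
    unfolding lyndon_factors_append
  proof (intro conjI ballI)
    show "v \<preceq> k" if "k \<in> set ks" "v \<in> set fs" for k v
      by (rule word_le_trans[of _ "a # g"]) (use that gt fs in \<open>auto simp: lyndon_factors_Cons\<close>)
  qed (use ks fs in \<open>simp_all add: lyndon_factors_Cons\<close>)
  \<comment> \<open>in both sorted lists everything that exceeds a g precedes the common rest T\<close>
  define gs1 where "gs1 = filter (\<lambda>v. a # g \<prec> v) gs"
  define gs2 where "gs2 = filter (\<lambda>v. \<not> a # g \<prec> v) gs"
  have gs1: "lyndon_factors gs1" and gs2: "lyndon_factors gs2"
    using gs by (simp_all add: gs1_def gs2_def lyndon_factors_filter)
  have gt1: "a # g \<prec> v" if "v \<in> set gs1" for v using that by (simp add: gs1_def)
  have le2: "v \<preceq> a # g" if "v \<in> set gs2" for v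
    using that word_less_total[of v "a # g"] by (auto simp: gs2_def)
  define T where "T = words.sort (fs @ gs2)"
  have Tle: "v \<preceq> a # g" if "v \<in> set T" for v
    using that le2 fs by (auto simp: T_def lyndon_factors_Cons)
  have T: "lyndon_factors T"
    unfolding T_def by (rule lyndon_factors_sort)
      (use fs gs2 in \<open>auto simp: lyndon_factors_def\<close>)
  have A: "lyndon_factors (words.sort (ks @ gs1))"
    by (rule lyndon_factors_sort) (use ks gs1 in \<open>auto simp: lyndon_factors_def\<close>)
  have msgs: "mset gs = mset gs1 + mset gs2" by (simp add: gs1_def gs2_def)
  have sort1: "words.sort ((ks @ fs) @ gs) = words.sort (ks @ gs1) @ T"
  proof (rule sort_eqI)
    show "lyndon_factors (words.sort (ks @ gs1) @ T)"
      unfolding lyndon_factors_append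
    proof (intro conjI ballI)
      show "v \<preceq> k" if "k \<in> set (words.sort (ks @ gs1))" "v \<in> set T" for k v
        by (rule word_le_trans[of _ "a # g"]) (use that gt gt1 Tle in auto)
    qed (rule A T)+
  qed (simp add: msgs T_def)
  have sort2: "words.sort (((a # g) # fs) @ gs) = gs1 @ [a # g] @ T"
  proof (rule sort_eqI)
    show "lyndon_factors (gs1 @ [a # g] @ T)"
      unfolding lyndon_factors_append
    proof (intro conjI ballI)
      show "v \<preceq> k" if "k \<in> set gs1" "v \<in> set ([a # g] @ T)" for k v
        by (rule word_le_trans[of _ "a # g"]) (use that gt1 Tle in auto)
      show "v \<preceq> k" if "k \<in> set [a # g]" "v \<in> set T" for k v
        using that Tle by auto
    qed (use gs1 T fs in \<open>simp_all add: lyndon_factors_Cons\<close>)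
  qed (simp add: msgs T_def)
  have z: "z \<preceq> concat (words.sort (ks @ gs1)) @ concat T"
    using IH[OF ksfs ks(2)] sort1 by simp
  have len: "length (concat (words.sort vs)) = length (concat vs)" for vs
  proof -
    have "sum_mset (mset (map length (words.sort vs))) = sum_mset (mset (map length vs))"
      by simp
    then show ?thesis unfolding sum_mset_sum_list length_concat .
  qed
  have strict: "a # concat (words.sort (ks @ gs1)) @ concat T \<prec> concat gs1 @ (a # g) @ concat T"
    if "gs1 \<noteq> []"
  proof -
    from that obtain y ys where gs1_eq: "gs1 = y # ys" by (cases gs1) auto
    have "a # concat (words.sort (ks @ gs1)) \<prec> concat gs1 @ a # concat ks"
      unfolding gs1_eq
      by (rule exchange) (use f ks gs1 gt1 gs1_eq in auto)
    then have "(a # concat (words.sort (ks @ gs1))) @ concat T \<prec> (concat gs1 @ a # concat ks) @ concat T"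
      by (rule word_less_append_mono) (simp add: len)
    then show ?thesis using ks by simp
  qed
  have main: "if gs1 = [] then a # z \<preceq> concat (gs1 @ [a # g] @ T)
        else a # z \<prec> concat (gs1 @ [a # g] @ T)"
  proof (cases "gs1 = []")
    case True
    then show ?thesis using z ks sort_lyndon_factors[OF ks(1)] by auto
  next
    case False
    have "a # z \<preceq> a # concat (words.sort (ks @ gs1)) @ concat T" using z by auto
    then have "a # z \<prec> concat gs1 @ (a # g) @ concat T"
      using strict[OF False] word_less_trans[OF _ strict[OF False]] by metis
    then show ?thesis using False by simp
  qed
  show "a # z \<preceq> concat (words.sort (((a # g) # fs) @ gs))"
    unfolding sort2 using main by (auto split: if_splits)
  show "a # z \<prec> concat (words.sort (((a # g) # fs) @ gs))" if "\<exists>v\<in>set gs. a # g \<prec> v"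
    unfolding sort2 using main that by (auto simp: gs1_def filter_empty_conv split: if_splits)
qed

text \<open>
  Induction on the letters of the shuffle, by the preceding step for the word that supplies the first
  letter. The bound is attained: sorting keeps the order of the factors of each word.
\<close>

lemma shuffle_le_sort:
  "lyndon_factors fs \<Longrightarrow> lyndon_factors gs \<Longrightarrow> z \<in> shuffles (concat fs) (concat gs) \<Longrightarrow>
     z \<preceq> concat (words.sort (fs @ gs))"
proof (induction z arbitrary: fs gs)
  case Nil
  then have "concat fs = []" "concat gs = []" by simp_all
  then have "fs = []" "gs = []"
    using lyndon_factors_concat_Nil Nil.prems(1,2) by blast+
  then show ?case by simp
next
  case (Cons c z)
  have left: "c # z \<preceq> concat (words.sort (fs @ gs))"
    if fs: "lyndon_factors fs" and gs: "lyndon_factors gs" and ne: "concat fs \<noteq> []"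
      and c: "hd (concat fs) = c" and z: "z \<in> shuffles (tl (concat fs)) (concat gs)"
    for fs gs
  proof -
    from ne obtain f fs' where f: "fs = f # fs'" by (cases fs) auto
    with fs have "f \<noteq> []" by (auto simp: lyndon_factors_Cons lyndon_def)
    then obtain a g where ag: "f = a # g" by (cases f) auto
    have "a # z \<preceq> concat (words.sort (((a # g) # fs') @ gs))"
    proof (rule shuffle_step(1))
      fix ks assume ks: "lyndon_factors (ks @ fs')" "concat ks = g"
      have "z \<in> shuffles (concat (ks @ fs')) (concat gs)" using z f ag ks(2) by simp
      then show "z \<preceq> concat (words.sort ((ks @ fs') @ gs))"
        by (rule Cons.IH[OF ks(1) gs])
    next
      show "lyndon_factors ((a # g) # fs')" using fs f ag by simp
    qed (rule gs)
    then show ?thesis using c f ag by simp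
  qed
  have comm: "words.sort (gs @ fs) = words.sort (fs @ gs)"
    by (rule words.properties_for_sort) simp_all
  from Cons.prems(3) consider
    "concat fs \<noteq> []" "hd (concat fs) = c" "z \<in> shuffles (tl (concat fs)) (concat gs)" |
    "concat gs \<noteq> []" "hd (concat gs) = c" "z \<in> shuffles (concat fs) (tl (concat gs))"
    unfolding Cons_in_shuffles_iff by blast
  then show ?case
  proof cases
    case 1
    then show ?thesis by (rule left[OF Cons.prems(1,2)])
  next
    case 2
    have "z \<in> shuffles (tl (concat gs)) (concat fs)" using 2(3) by (simp only: shuffles_commutes)
    then show ?thesis using left[OF Cons.prems(2,1) 2(1,2)] unfolding comm by blast
  qed
qed

lemma sort_append:
  assumes "lyndon_factors fs" "lyndon_factors gs" "\<forall>f\<in>set fs. \<forall>g\<in>set gs. g \<preceq> f"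
  shows "words.sort (fs @ gs) = fs @ gs" "words.sort (gs @ fs) = fs @ gs"
  by (rule sort_eqI; use assms in \<open>auto simp: lyndon_factors_append\<close>)+

text \<open>
  The strict case: a shuffle that starts with the second word, all of whose Lyndon factors are
  smaller than those of the first word, is never the largest one. This makes the multiplicity of
  the largest word equal to one.
\<close>

lemma late_start_less:
  assumes fs: "lyndon_factors fs" "fs \<noteq> []" and gs: "lyndon_factors ((b # g) # gs)"
    and gt: "\<forall>u\<in>set fs. \<forall>v\<in>set ((b # g) # gs). v \<prec> u"
    and z: "z \<in> shuffles (concat fs) (g @ concat gs)"
  shows "b # z \<prec> concat fs @ concat ((b # g) # gs)"
proof -
  have "b # z \<prec> concat (words.sort (((b # g) # gs) @ fs))"
  proof (rule shuffle_step(2))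
    fix ks assume "lyndon_factors (ks @ gs)" "concat ks = g"
    then show "z \<preceq> concat (words.sort ((ks @ gs) @ fs))"
      using shuffle_le_sort[of "ks @ gs" fs z] z fs by (simp add: shuffles_commutes)
  qed (use assms in \<open>auto simp: neq_Nil_conv\<close>)
  then show ?thesis
    using sort_append(2)[OF fs(1) gs] gt by (simp add: ball_Un)
qed

text \<open>
  Keep the positions of the letters of the first word and replace the word by a larger one.
\<close>

lemma shuffles_strict_mono:
  "length x' = length x \<Longrightarrow> x' \<prec> x \<Longrightarrow> z \<in> shuffles x' y \<Longrightarrow> \<exists>z'\<in>shuffles x y. z \<prec> z'"
proof (induction x' y arbitrary: z x rule: shuffles.induct)
  case (3 a' x' b y)
  from "3.prems" obtain a x1 where x: "x = a # x1" "length x1 = length x'" by (cases x) auto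
  from "3.prems"(3) consider z1 where "z = a' # z1" "z1 \<in> shuffles x' (b # y)" |
    z1 where "z = b # z1" "z1 \<in> shuffles (a' # x') y" by auto
  then show ?case
  proof cases
    case 1
    show ?thesis
    proof (cases "(a', a) \<in> R")
      case True
      have "a # splice x1 (b # y) \<in> shuffles x (b # y)"
        using x splice_in_shuffles[of x1 "b # y"] by auto
      then show ?thesis using True 1 by force
    next
      case False
      with "3.prems" x have "a = a'" "x' \<prec> x1" by auto
      with "3.IH"(1)[OF _ this(2) 1(2)] x 1 obtain z' where
        "z' \<in> shuffles x1 (b # y)" "z1 \<prec> z'" by auto
      then show ?thesis using x 1 \<open>a = a'\<close> by (intro bexI[of _ "a # z'"]) auto
    qed
  next
    case 2
    from "3.IH"(2)[OF "3.prems"(1,2) 2(2)] obtain z' where "z' \<in> shuffles x y" "z1 \<prec> z'" by blast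
    then show ?thesis using 2 x by (intro bexI[of _ "b # z'"]) auto
  qed
qed auto

end

section \<open>Linear and bilinear extensions\<close>

definition lin_ext :: "('k \<Rightarrow> int) \<Rightarrow> ('k \<Rightarrow>\<^sub>0 int) \<Rightarrow> int" where
  "lin_ext h p = (\<Sum>k\<in>supp p. coeff p k * h k)"

lemma lin_ext_superset:
  assumes "finite S" "supp p \<subseteq> S"
  shows "lin_ext h p = (\<Sum>k\<in>S. coeff p k * h k)"
  unfolding lin_ext_def by (rule sum.mono_neutral_left) (use assms in \<open>auto simp: in_keys_iff\<close>)

lemma lin_ext_0 [simp]: "lin_ext h 0 = 0"
  by (simp add: lin_ext_def)

lemma lin_ext_frag_of [simp]: "lin_ext h (frag_of k) = h k"
  by (simp add: lin_ext_def)

lemma lin_ext_one [simp]: "lin_ext h 1 = h 0"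
  using lin_ext_frag_of[of h 0] by simp

lemma lin_ext_add: "lin_ext h (p + q) = lin_ext h p + lin_ext h q"
proof -
  let ?S = "supp p \<union> supp q"
  have "supp (p + q) \<subseteq> ?S" by (rule Poly_Mapping.keys_add)
  then have "lin_ext h (p + q) = (\<Sum>k\<in>?S. coeff (p + q) k * h k)"
    by (intro lin_ext_superset) auto
  also have "\<dots> = lin_ext h p + lin_ext h q"
    by (simp add: lin_ext_superset[of ?S p] lin_ext_superset[of ?S q] lookup_add distrib_right sum.distrib)
  finally show ?thesis .
qed

lemma lin_ext_cmul: "lin_ext h (frag_cmul c p) = c * lin_ext h p"
proof -
  have "lin_ext h (frag_cmul c p) = (\<Sum>k\<in>supp p. coeff (frag_cmul c p) k * h k)"
    by (rule lin_ext_superset) auto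
  then show ?thesis by (simp add: lin_ext_def sum_distrib_left mult.assoc)
qed

lemma lin_ext_uminus: "lin_ext h (- p) = - lin_ext h p"
  using lin_ext_cmul[of h "-1" p] by simp

lemma lin_ext_diff: "lin_ext h (p - q) = lin_ext h p - lin_ext h q"
  using lin_ext_add[of h p "- q"] by (simp add: lin_ext_uminus)

lemma lin_ext_sum: "lin_ext h (\<Sum>i\<in>I. f i) = (\<Sum>i\<in>I. lin_ext h (f i))"
  by (induction I rule: infinite_finite_induct) (auto simp: lin_ext_add)

lemma lin_ext_frag_extend: "lin_ext h (frag_extend g p) = lin_ext (\<lambda>k. lin_ext h (g k)) p"
  by (simp add: frag_extend_def lin_ext_sum lin_ext_cmul) (simp add: lin_ext_def)

lemma lin_ext_cong: "(\<And>k. k \<in> supp p \<Longrightarrow> h k = h' k) \<Longrightarrow> lin_ext h p = lin_ext h' p"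
  by (simp add: lin_ext_def)

lemma lin_ext_zero [simp]: "lin_ext (\<lambda>_. 0) p = 0"
  by (simp add: lin_ext_def)

lemma lin_ext_add_fun: "lin_ext (\<lambda>k. h k + h' k) p = lin_ext h p + lin_ext h' p"
  by (simp add: lin_ext_def sum.distrib distrib_left)

lemma lin_ext_mult_left: "lin_ext (\<lambda>k. c * h k) p = c * lin_ext h p"
  by (simp add: lin_ext_def sum_distrib_left mult.left_commute)

lemma lin_ext_mult_right: "lin_ext (\<lambda>k. h k * c) p = lin_ext h p * c"
  by (simp add: lin_ext_def sum_distrib_right mult.assoc)

lemma lookup_eq_lin: "coeff p k = lin_ext (\<lambda>j. if j = k then 1 else 0) p"
  by (simp add: lin_ext_def if_distrib[of "(*) _"] sum.delta in_keys_iff cong: if_cong)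

lemma lookup_frag_extend:
  "coeff (frag_extend g p) k = lin_ext (\<lambda>j. coeff (g j) k) p"
  unfolding lookup_eq_lin[of "frag_extend g p"] lin_ext_frag_extend
  by (simp add: lookup_eq_lin)

lemma lin_ext_times:
  fixes p q :: "'k::comm_monoid_add \<Rightarrow>\<^sub>0 int"
  assumes "\<And>a b. h (a + b) = h a * h b"
  shows "lin_ext h (p * q) = lin_ext h p * lin_ext h q"
proof -
  have *: "lin_ext h (frag_of x * q) = h x * lin_ext h q" for x
    using subset_UNIV[of "supp q"]
    by (induction q rule: frag_induction)
      (simp_all add: mult_single assms right_diff_distrib lin_ext_diff)
  show ?thesis
    using subset_UNIV[of "supp p"]
    by (induction p rule: frag_induction) (simp_all add: * left_diff_distrib lin_ext_diff)
qed

definition frag_bilinear :: "('a \<Rightarrow> 'b \<Rightarrow> ('c \<Rightarrow>\<^sub>0 int)) \<Rightarrow> ('a \<Rightarrow>\<^sub>0 int) \<Rightarrow> ('b \<Rightarrow>\<^sub>0 int) \<Rightarrow> ('c \<Rightarrow>\<^sub>0 int)"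
  where "frag_bilinear m p q = frag_extend (\<lambda>u. frag_extend (\<lambda>v. m u v) q) p"

lemma lin_ext_frag_bilinear:
  assumes "\<And>u v. u \<in> supp p \<Longrightarrow> v \<in> supp q \<Longrightarrow> lin_ext h (m u v) = f u * g v"
  shows "lin_ext h (frag_bilinear m p q) = lin_ext f p * lin_ext g q"
proof -
  have "lin_ext h (frag_bilinear m p q) = lin_ext (\<lambda>u. lin_ext (\<lambda>v. lin_ext h (m u v)) q) p"
    by (simp add: frag_bilinear_def lin_ext_frag_extend)
  also have "\<dots> = lin_ext (\<lambda>u. f u * lin_ext g q) p"
    by (rule lin_ext_cong) (simp add: assms lin_ext_mult_left cong: lin_ext_cong)
  finally show ?thesis by (simp add: lin_ext_mult_right)
qed

lemma keys_frag_extendE: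
  assumes "z \<in> supp (frag_extend g p)"
  obtains u where "u \<in> supp p" "z \<in> supp (g u)"
  using assms keys_frag_extend[of g p] by blast

lemma keys_frag_bilinearE:
  assumes "z \<in> supp (frag_bilinear m p q)"
  obtains u v where "u \<in> supp p" "v \<in> supp q"
    "z \<in> supp (m u v)"
  using assms unfolding frag_bilinear_def by (elim keys_frag_extendE)

lemma lin_ext_prefix_letter: "lin_ext h (prefix_letter a f) = lin_ext (\<lambda>w. h (a # w)) f"
  by (simp add: prefix_letter_def lin_ext_frag_extend)

lemma lookup_prefix_letter:
  "coeff (prefix_letter a f) (b # w) = (if a = b then coeff f w else 0)"
  "coeff (prefix_letter a f) [] = 0"
  by (simp_all add: prefix_letter_def lookup_frag_extend lookup_eq_lin[of f] eq_commute[of w])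

lemma keys_prefix_letter: "supp (prefix_letter a f) = (#) a ` supp f"
proof (rule Set.set_eqI)
  fix w show "w \<in> supp (prefix_letter a f) \<longleftrightarrow> w \<in> (#) a ` supp f"
    by (cases w) (auto simp: in_keys_iff lookup_prefix_letter)
qed

lemma prefix_letter_frag_of [simp]: "prefix_letter a (frag_of w) = frag_of (a # w)"
  by (simp add: prefix_letter_def)

lemma keys_mixable_shuffle:
  "z \<in> supp (mixable_shuffle l A u v) \<Longrightarrow>
     length z \<le> length u + length v \<and> (length z = length u + length v \<longrightarrow> z \<in> shuffles u v)"
proof (induction l A u v arbitrary: z rule: mixable_shuffle.induct)
  case (3 l A a u b v)
  from "3.prems" have "z \<in> supp (prefix_letter a (mixable_shuffle l A u (b # v))) \<or>
      z \<in> supp (prefix_letter b (mixable_shuffle l A (a # u) v)) \<or>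
      z \<in> supp (prefix_letter (a \<otimes>\<^bsub>A\<^esub> b) (mixable_shuffle l A u v))"
    by (auto dest!: subsetD[OF Poly_Mapping.keys_add])
  then show ?case
    unfolding keys_prefix_letter
    by (elim disjE imageE) (auto dest!: "3.IH")
qed auto

section \<open>Evaluation of mixable shuffles at integer points\<close>

text \<open>
  The word \<open>a\<^sub>1 \<dots> a\<^sub>k\<close> is sent to the sum of \<open>l\<^sup>k c\<^sub>i\<^sub>1(a\<^sub>1) \<dots> c\<^sub>i\<^sub>k(a\<^sub>k)\<close> over all \<open>i\<^sub>1 < \<dots> < i\<^sub>k\<close>, where
  \<open>c\<^sub>1, c\<^sub>2, \<dots>\<close> are given functions on letters: a monomial quasi-symmetric function, twisted by the weight.
\<close>

fun quasi_eval :: "int \<Rightarrow> ('a \<Rightarrow> int) list \<Rightarrow> 'a list \<Rightarrow> int" where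
  "quasi_eval l cs [] = 1"
| "quasi_eval l [] (a # w) = 0"
| "quasi_eval l (c # cs) (a # w) = quasi_eval l cs (a # w) + l * c a * quasi_eval l cs w"

lemma lin_ext_qeval_prefix_letter:
  "lin_ext (quasi_eval l []) (prefix_letter a f) = 0"
  "lin_ext (quasi_eval l (c # cs)) (prefix_letter a f) =
     lin_ext (quasi_eval l cs) (prefix_letter a f) + l * c a * lin_ext (quasi_eval l cs) f"
  by (simp_all add: lin_ext_prefix_letter lin_ext_add_fun lin_ext_mult_left)

text \<open>
  Pairs of index sequences are merged; equal indices produce the product of two letters. The
  three summands of the mixable shuffle record which of the two sequences uses the first index.
\<close>

lemma quasi_eval_mixable_shuffle:
  assumes "\<And>c a b. c \<in> set cs \<Longrightarrow> c (a \<otimes>\<^bsub>A\<^esub> b) = c a * c b"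
  shows "lin_ext (quasi_eval l cs) (mixable_shuffle l A u v) = quasi_eval l cs u * quasi_eval l cs v"
  using assms
proof (induction cs arbitrary: u v)
  case Nil
  show ?case
    by (cases u; cases v) (simp_all add: lin_ext_add lin_ext_cmul lin_ext_qeval_prefix_letter)
next
  case (Cons c cs)
  then have IH: "lin_ext (quasi_eval l cs) (mixable_shuffle l A u v) = quasi_eval l cs u * quasi_eval l cs v" for u v
    by simp
  show ?case
  proof (cases u; cases v)
    fix a u' b v' assume uv: "u = a # u'" "v = b # v'"
    have "lin_ext (quasi_eval l (c # cs)) (mixable_shuffle l A u v) =
        lin_ext (quasi_eval l cs) (mixable_shuffle l A u v)
        + l * c a * (quasi_eval l cs u' * quasi_eval l cs v) + l * c b * (quasi_eval l cs u * quasi_eval l cs v')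
        + l * l * (c a * c b) * (quasi_eval l cs u' * quasi_eval l cs v')"
      by (simp add: uv lin_ext_add lin_ext_cmul lin_ext_qeval_prefix_letter IH Cons.prems algebra_simps)
    then show ?thesis by (simp add: IH) (simp add: uv algebra_simps)
  qed simp_all
qed

text \<open>
  The value of a monomial at a point. It is used both for monomials in the given variables
  and for monomials in the polynomial generators.
\<close>

definition mon_eval :: "('x \<Rightarrow> int) \<Rightarrow> 'x multiset \<Rightarrow> int" where
  "mon_eval c m = prod_mset (image_mset c m)"

lemma mon_eval_empty [simp]: "mon_eval c {#} = 1"
  and mon_eval_add: "mon_eval c (m + n) = mon_eval c m * mon_eval c n"
  and mon_eval_single [simp]: "mon_eval c {#x#} = c x"
  by (simp_all add: mon_eval_def)

lemma mon_eval_mult: "mon_eval (\<lambda>x. c x * d x) m = mon_eval c m * mon_eval d m"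
  by (simp add: mon_eval_def prod_mset.distrib)

lemma mon_eval_repeat: "mon_eval c (repeat_mset k m) = mon_eval c m ^ k"
  by (induction k) (simp_all add: mon_eval_add)

lemma mon_eval_separates:
  assumes "m \<noteq> m'" shows "\<exists>c. mon_eval c m \<noteq> mon_eval c m'"
proof -
  from assms obtain x where x: "count m x \<noteq> count m' x" by (auto simp: multiset_eq_iff)
  have "mon_eval (\<lambda>y. if y = x then 2 else 1) m = 2 ^ count m x" for m :: "'a multiset"
    by (induction m) (simp_all add: mon_eval_def)
  with x show ?thesis by (intro exI[of _ "\<lambda>y. if y = x then 2 else 1"]) simp
qed

text \<open>
  Evaluations at distinct monomials are distinct homomorphisms from the monoid of points, under
  pointwise multiplication, to the integers; this is the linear independence of characters.
\<close>

lemma mon_eval_independent: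
  assumes "finite F" "\<And>c. (\<Sum>m\<in>F. mon_eval c m * k m) = 0" "n \<in> F"
  shows "k n = 0"
  using assms
proof (induction "card F" arbitrary: F k n rule: less_induct)
  case less
  show ?case
  proof (cases "F = {n}")
    case True
    then show ?thesis using less.prems(2)[of "\<lambda>_. 1"] by (simp add: mon_eval_def)
  next
    case False
    with less.prems(3) obtain m where m: "m \<in> F" "m \<noteq> n" by blast
    then obtain d where d: "mon_eval d m \<noteq> mon_eval d n" using mon_eval_separates by blast
    have "(\<Sum>p\<in>F - {m}. mon_eval c p * ((mon_eval d p - mon_eval d m) * k p)) = 0" for c
    proof -
      have "(\<Sum>p\<in>F. mon_eval c p * ((mon_eval d p - mon_eval d m) * k p)) =
          (\<Sum>p\<in>F. mon_eval (\<lambda>x. c x * d x) p * k p) - mon_eval d m * (\<Sum>p\<in>F. mon_eval c p * k p)"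
        by (simp add: sum_distrib_left mon_eval_mult flip: sum_subtractf) (simp add: algebra_simps)
      also have "\<dots> = 0" by (simp add: less.prems(2))
      finally show ?thesis using less.prems(1) m by (simp add: sum.remove)
    qed
    then have "(mon_eval d n - mon_eval d m) * k n = 0"
      by (intro less.hyps[of "F - {m}" "\<lambda>p. (mon_eval d p - mon_eval d m) * k p" n])
        (use less.prems m card_Diff1_less[OF less.prems(1) m(1)] in \<open>auto simp del: card_Diff_insert\<close>)
    with d show ?thesis by simp
  qed
qed

definition residual :: "'a \<Rightarrow> ('a list \<Rightarrow>\<^sub>0 int) \<Rightarrow> ('a list \<Rightarrow>\<^sub>0 int)" where
  "residual a = frag_extend (\<lambda>w. if w \<noteq> [] \<and> hd w = a then frag_of (tl w) else 0)"

lemma lookup_residual: "coeff (residual a f) w = coeff f (a # w)"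
proof -
  have "lin_ext (\<lambda>v. coeff (if v \<noteq> [] \<and> hd v = a then frag_of (tl v) else 0) w) f =
      lin_ext (\<lambda>v. if v = a # w then 1 else 0) f"
    by (rule lin_ext_cong) (auto split: if_splits)
  then show ?thesis
    by (simp add: residual_def lookup_frag_extend lookup_eq_lin[of f])
qed

lemma frag_split_heads:
  "f = frag_cmul (coeff f []) (frag_of []) +
     (\<Sum>a\<in>hd ` supp f. prefix_letter a (residual a f))"
proof (rule poly_mapping_eqI)
  fix w
  show "coeff f w = coeff (frag_cmul (coeff f []) (frag_of []) +
     (\<Sum>a\<in>hd ` supp f. prefix_letter a (residual a f))) w"
  proof (cases w)
    case Nil
    then show ?thesis by (simp add: lookup_add lookup_sum lookup_prefix_letter)
  next
    case (Cons b v)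
    have "b \<in> hd ` supp f" if "coeff f (b # v) \<noteq> 0"
      using that by (intro image_eqI[of b hd "b # v"]) (auto simp: in_keys_iff)
    then show ?thesis
      by (auto simp: Cons lookup_add lookup_sum lookup_prefix_letter lookup_residual)
  qed
qed

lemma lin_ext_heads:
  "lin_ext h f = coeff f [] * h [] +
     (\<Sum>a\<in>hd ` supp f. lin_ext (\<lambda>w. h (a # w)) (residual a f))"
  by (subst frag_split_heads) (simp add: lin_ext_add lin_ext_cmul lin_ext_sum lin_ext_prefix_letter)

lemma quasi_eval_Cons_residual:
  "lin_ext (quasi_eval l (c # cs)) f = lin_ext (quasi_eval l cs) f +
     l * (\<Sum>a\<in>hd ` supp f. c a * lin_ext (quasi_eval l cs) (residual a f))"
  unfolding lin_ext_heads[of "quasi_eval l (c # cs)"] lin_ext_heads[of "quasi_eval l cs" f]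
  by (simp add: lin_ext_add_fun lin_ext_mult_left sum.distrib sum_distrib_left mult.assoc)

text \<open>
  Adding a point in front separates the words by their first letters, by the independence of
  monomials. Hence every identity in the mixable shuffle algebra, commutativity included, can be
  verified on integer values.
\<close>

lemma quasi_eval_injective:
  fixes f :: "'x multiset list \<Rightarrow>\<^sub>0 int"
  assumes l: "l \<noteq> 0" and f: "\<And>cs. lin_ext (quasi_eval l (map mon_eval cs)) f = 0"
  shows "f = 0"
proof -
  have "coeff f w = 0" for w
    using f
  proof (induction w arbitrary: f)
    case Nil
    have "lin_ext (quasi_eval l []) f = lin_ext (\<lambda>v. if v = [] then 1 else 0) f"
    proof (rule lin_ext_cong)
      fix v :: "'x multiset list" show "quasi_eval l [] v = (if v = [] then 1 else 0)" by (cases v) auto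
    qed
    then show ?case using Nil[of "[]"] by (simp add: lookup_eq_lin)
  next
    case (Cons a w)
    have "lin_ext (quasi_eval l (map mon_eval cs)) (residual a f) = 0" for cs
    proof (cases "a \<in> hd ` supp f")
      case True
      have "(\<Sum>a\<in>hd ` supp f. mon_eval c a * lin_ext (quasi_eval l (map mon_eval cs)) (residual a f)) = 0" for c
        using quasi_eval_Cons_residual[of l "mon_eval c" "map mon_eval cs" f] Cons.prems[of "c # cs"] Cons.prems[of cs] l
        by simp
      from mon_eval_independent[OF _ this True] show ?thesis by simp
    next
      case False
      then have "residual a f = 0"
        by (intro poly_mapping_eqI) (force simp: lookup_residual in_keys_iff image_iff)
      then show ?thesis by simp
    qed
    from Cons.IH[OF this] show ?case by (simp add: lookup_residual)
  qed
  then show ?thesis by (intro poly_mapping_eqI) simp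
qed

section \<open>Symmetric functions of integer lists\<close>

fun elem_sym :: "nat \<Rightarrow> int list \<Rightarrow> int" where
  "elem_sym 0 xs = 1"
| "elem_sym (Suc n) [] = 0"
| "elem_sym (Suc n) (x # xs) = elem_sym (Suc n) xs + x * elem_sym n xs"

lemma elem_sym_Nil: "elem_sym n [] = (if n = 0 then 1 else 0)"
  by (cases n) auto

lemma elem_sym_append: "elem_sym n (xs @ ys) = (\<Sum>i\<le>n. elem_sym i ys * elem_sym (n - i) xs)"
proof (induction xs arbitrary: n)
  case Nil
  have "(\<Sum>i\<le>n. elem_sym i ys * elem_sym (n - i) []) = (\<Sum>i\<le>n. if i = n then elem_sym i ys else 0)"
    by (rule sum.cong) (auto simp: elem_sym_Nil)
  then show ?case by simp
next
  case (Cons x xs)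
  show ?case
  proof (cases n)
    case (Suc m)
    have "(\<Sum>i\<le>m. elem_sym i ys * elem_sym (Suc m - i) (x # xs)) =
        (\<Sum>i\<le>m. elem_sym i ys * elem_sym (Suc m - i) xs + x * (elem_sym i ys * elem_sym (m - i) xs))"
      by (rule sum.cong) (auto simp: Suc_diff_le algebra_simps)
    then show ?thesis
      by (simp add: Suc Cons sum.distrib sum_distrib_left)
  qed simp
qed

lemma elem_sym_scale: "elem_sym n (map (\<lambda>x. s * x) xs) = s ^ n * elem_sym n xs"
  by (induction n xs rule: elem_sym.induct) (simp_all add: algebra_simps)

text \<open>
  The functions that are integer polynomials in the elementary symmetric functions, uniformly in the
  length of the list.
\<close>

inductive sym_fun :: "(int list \<Rightarrow> int) \<Rightarrow> bool" where
  const: "sym_fun (\<lambda>_. c)"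
| elem_sym: "sym_fun (elem_sym n)"
| add: "sym_fun f \<Longrightarrow> sym_fun g \<Longrightarrow> sym_fun (\<lambda>xs. f xs + g xs)"
| mult: "sym_fun f \<Longrightarrow> sym_fun g \<Longrightarrow> sym_fun (\<lambda>xs. f xs * g xs)"

lemma sym_fun_uminus: "sym_fun f \<Longrightarrow> sym_fun (\<lambda>xs. - f xs)"
  using sym_fun.mult[OF sym_fun.const[of "-1"]] by simp

lemma sym_fun_diff: "sym_fun f \<Longrightarrow> sym_fun g \<Longrightarrow> sym_fun (\<lambda>xs. f xs - g xs)"
  using sym_fun.add[OF _ sym_fun_uminus] by simp

lemma sym_fun_power: "sym_fun f \<Longrightarrow> sym_fun (\<lambda>xs. f xs ^ n)"
  by (induction n) (simp_all add: sym_fun.intros)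

lemma sym_fun_sum: "(\<And>i. i \<in> I \<Longrightarrow> sym_fun (f i)) \<Longrightarrow> sym_fun (\<lambda>xs. \<Sum>i\<in>I. f i xs)"
  by (induction I rule: infinite_finite_induct) (auto intro: sym_fun.intros)

definition sym_fps :: "(int list \<Rightarrow> int fps) \<Rightarrow> bool" where
  "sym_fps F \<longleftrightarrow> (\<forall>n. sym_fun (\<lambda>xs. fps_nth (F xs) n))"

lemma sym_fps_const: "sym_fps (\<lambda>_. c)"
  by (simp add: sym_fps_def sym_fun.const)

lemma sym_fps_mult: "sym_fps F \<Longrightarrow> sym_fps G \<Longrightarrow> sym_fps (\<lambda>xs. F xs * G xs)"
  by (auto simp: sym_fps_def fps_mult_nth intro!: sym_fun_sum sym_fun.mult)

lemma sym_fps_power: "sym_fps F \<Longrightarrow> sym_fps (\<lambda>xs. F xs ^ n)"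
  by (induction n) (auto intro: sym_fps_mult sym_fps_const)

lemma sym_fps_prod: "(\<And>i. i \<in> I \<Longrightarrow> sym_fps (F i)) \<Longrightarrow> sym_fps (\<lambda>xs. \<Prod>i\<in>I. F i xs)"
  by (induction I rule: infinite_finite_induct) (auto intro: sym_fps_mult sym_fps_const)

text \<open>
  The factors of \<open>\<Prod>\<^sub>i (1 - x\<^sub>i T)\<close>, and of its expansion as \<open>\<Prod>\<^sub>d (1 - q\<^sub>d T\<^sup>d)\<close> whose \<open>q\<^sub>d\<close> are the
  Witt vector coordinates of the list.
\<close>

definition witt_factor :: "int \<Rightarrow> nat \<Rightarrow> int fps" where
  "witt_factor q d = 1 - fps_const q * fps_X ^ d"

lemma sym_fps_witt_factor: "sym_fun q \<Longrightarrow> sym_fps (\<lambda>xs. witt_factor (q xs) d)"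
  by (auto simp: sym_fps_def witt_factor_def fps_X_power_iff intro!: sym_fun_uminus sym_fun_diff sym_fun.const sym_fun.mult)

definition root_fps :: "int list \<Rightarrow> int fps" where
  "root_fps xs = (\<Prod>x\<leftarrow>xs. witt_factor x 1)"

lemma fps_nth_witt_factor_mult: "fps_nth (witt_factor q d * f) n = fps_nth f n - (if n < d then 0 else q * fps_nth f (n - d))"
  by (simp add: witt_factor_def left_diff_distrib mult.assoc fps_X_power_mult_nth)

lemma fps_nth_root_fps: "fps_nth (root_fps xs) n = (-1) ^ n * elem_sym n xs"
proof (induction xs arbitrary: n)
  case Nil
  then show ?case by (simp add: root_fps_def elem_sym_Nil)
next
  case (Cons x xs)
  have "root_fps (x # xs) = witt_factor x 1 * root_fps xs" by (simp add: root_fps_def)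
  then have "fps_nth (root_fps (x # xs)) n =
      fps_nth (root_fps xs) n - (if n < 1 then 0 else x * fps_nth (root_fps xs) (n - 1))"
    by (simp only: fps_nth_witt_factor_mult)
  then show ?case unfolding Cons by (cases n) (simp_all add: algebra_simps)
qed

lemma sym_fps_root_fps: "sym_fps root_fps"
  by (auto simp: sym_fps_def fps_nth_root_fps intro: sym_fun.intros)

text \<open>
  \<open>P\<close> is minus \<open>T\<close> times the logarithmic derivative of \<open>f\<close>, written without division. For
  \<open>f = \<Prod>\<^sub>i (1 - x\<^sub>i T)\<close> the coefficients of \<open>P\<close> are the power sums of the \<open>x\<^sub>i\<close>.
\<close>

definition has_power_sums :: "int fps \<Rightarrow> int fps \<Rightarrow> bool" where
  "has_power_sums f P \<longleftrightarrow> fps_nth f 0 = 1 \<and> fps_nth P 0 = 0 \<and> fps_X * fps_deriv f = - (f * P)"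

lemma has_power_sums_1: "has_power_sums 1 0"
  by (simp add: has_power_sums_def)

lemma has_power_sums_mult:
  assumes "has_power_sums f P" "has_power_sums g Q"
  shows "has_power_sums (f * g) (P + Q)"
proof -
  have "fps_X * fps_deriv (f * g) = (fps_X * fps_deriv f) * g + f * (fps_X * fps_deriv g)"
    by (simp add: algebra_simps)
  also have "\<dots> = - (f * g * (P + Q))"
    using assms by (simp add: has_power_sums_def algebra_simps)
  finally show ?thesis using assms by (simp add: has_power_sums_def)
qed

lemma has_power_sums_power: "has_power_sums f P \<Longrightarrow> has_power_sums (f ^ k) (of_nat k * P)"
  by (induction k) (auto simp: has_power_sums_1 algebra_simps dest: has_power_sums_mult)

lemma has_power_sums_prod:
  "(\<And>i. i \<in> I \<Longrightarrow> has_power_sums (f i) (P i)) \<Longrightarrow>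
     has_power_sums (\<Prod>i\<in>I. f i) (\<Sum>i\<in>I. P i)"
  by (induction I rule: infinite_finite_induct) (auto simp: has_power_sums_1 has_power_sums_mult)

lemma has_power_sums_witt_factor:
  assumes "d > 0"
  shows "has_power_sums (witt_factor q d)
    (Abs_fps (\<lambda>n. if n > 0 \<and> d dvd n then int d * q ^ (n div d) else 0))" (is "has_power_sums _ ?P")
proof -
  have "fps_nth (fps_X * fps_deriv (witt_factor q d)) n = fps_nth (- (witt_factor q d * ?P)) n" for n
  proof -
    have 1: "fps_nth (fps_X * fps_deriv (witt_factor q d)) n = (if n = d then - (int d * q) else 0)"
      using assms by (cases n) (auto simp: witt_factor_def fps_X_power_iff)
    have "fps_nth (witt_factor q d * ?P) n = (if n = d then int d * q else 0)"
    proof (cases "n < d")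
      case True
      then show ?thesis by (auto simp: fps_nth_witt_factor_mult dest: dvd_imp_le)
    next
      case False
      then obtain k where k: "n = d + k" using le_Suc_ex not_less by blast
      show ?thesis
        using assms by (auto simp: fps_nth_witt_factor_mult k)
    qed
    with 1 show ?thesis by simp
  qed
  then have "fps_X * fps_deriv (witt_factor q d) = - (witt_factor q d * ?P)" by (rule fps_ext)
  then show ?thesis using assms by (simp add: has_power_sums_def witt_factor_def)
qed

lemma has_power_sums_root_fps:
  "has_power_sums (root_fps xs) (Abs_fps (\<lambda>n. if n > 0 then \<Sum>x\<leftarrow>xs. x ^ n else 0))"
proof (induction xs)
  case Nil
  have "Abs_fps (\<lambda>n. if n > 0 then \<Sum>x\<leftarrow>[]. (x::int) ^ n else 0) = 0" by (rule fps_ext) simp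
  then show ?case by (simp add: root_fps_def has_power_sums_1)
next
  case (Cons x xs)
  have "Abs_fps (\<lambda>n. if n > 0 then \<Sum>x\<leftarrow>x # xs. x ^ n else 0) =
      Abs_fps (\<lambda>n. if n > 0 \<and> 1 dvd n then int 1 * x ^ (n div 1) else 0) +
      Abs_fps (\<lambda>n. if n > 0 then \<Sum>x\<leftarrow>xs. x ^ n else 0)"
    by (rule fps_ext) simp
  then show ?case
    using has_power_sums_mult[OF has_power_sums_witt_factor[of 1 x] Cons] by (simp add: root_fps_def)
qed

text \<open>
  Newton's identities. Up to any given degree, \<open>f\<close> and \<open>P\<close> determine each other, because the integers
  have characteristic zero.
\<close>

lemma power_sums_nth:
  assumes "has_power_sums f P"
  shows "int n * fps_nth f n = - fps_nth P n - (\<Sum>i=1..<n. fps_nth f i * fps_nth P (n - i))"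
proof -
  have "int n * fps_nth f n = fps_nth (fps_X * fps_deriv f) n" by (cases n) simp_all
  also have "\<dots> = - (\<Sum>i=0..n. fps_nth f i * fps_nth P (n - i))"
    using assms by (simp add: has_power_sums_def fps_mult_nth)
  also have "(\<Sum>i=0..n. fps_nth f i * fps_nth P (n - i)) =
      fps_nth P n + (\<Sum>i=1..<n. fps_nth f i * fps_nth P (n - i))"
  proof (cases n)
    case 0
    then show ?thesis using assms by (simp add: has_power_sums_def)
  next
    case (Suc m)
    then show ?thesis
      using assms by (simp add: has_power_sums_def sum.atLeast_Suc_atMost atLeastLessThanSuc_atLeastAtMost)
  qed
  finally show ?thesis by simp
qed

lemma power_sums_cong:
  assumes "has_power_sums f P" "has_power_sums g Q"
    and "\<And>n. n \<le> N \<Longrightarrow> fps_nth f n = fps_nth g n" and "n \<le> N"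
  shows "fps_nth P n = fps_nth Q n"
  using \<open>n \<le> N\<close>
proof (induction n rule: less_induct)
  case (less n)
  have "(\<Sum>i=1..<n. fps_nth f i * fps_nth P (n - i)) = (\<Sum>i=1..<n. fps_nth g i * fps_nth Q (n - i))"
    using less assms(3) by (intro sum.cong) auto
  then show ?case
    using power_sums_nth[OF assms(1), of n] power_sums_nth[OF assms(2), of n] assms(3) less.prems
    by simp
qed

lemma power_sums_determine:
  assumes "has_power_sums f P" "has_power_sums g Q"
    and "\<And>n. n \<le> N \<Longrightarrow> fps_nth P n = fps_nth Q n" and "n \<le> N"
  shows "fps_nth f n = fps_nth g n"
  using \<open>n \<le> N\<close>
proof (induction n rule: less_induct)
  case (less n)
  have "(\<Sum>i=1..<n. fps_nth f i * fps_nth P (n - i)) = (\<Sum>i=1..<n. fps_nth g i * fps_nth Q (n - i))"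
    using less assms(3) by (intro sum.cong) auto
  then have "int n * fps_nth f n = int n * fps_nth g n"
    using power_sums_nth[OF assms(1), of n] power_sums_nth[OF assms(2), of n] assms(3) less.prems
    by simp
  moreover have "n = 0 \<Longrightarrow> ?case" using assms(1,2) by (simp add: has_power_sums_def)
  ultimately show ?case by auto
qed

text \<open>
  The coefficient of \<open>T\<^sup>N\<^sup>+\<^sup>1\<close> is corrected by the choice of \<open>q\<^sub>N\<^sub>+\<^sub>1\<close>, which is an integer
  polynomial in the coefficients up to this one.
\<close>

lemma witt_coordinates:
  "\<exists>q. (\<forall>d. sym_fun (q d)) \<and>
     (\<forall>xs n. n \<le> N \<longrightarrow> fps_nth (root_fps xs) n = fps_nth (\<Prod>d=1..N. witt_factor (q d xs) d) n)"
proof (induction N)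
  case 0
  have "sym_fun (\<lambda>_. 0)" by (rule sym_fun.const)
  then show ?case by (intro exI[of _ "\<lambda>_ _. 0"]) (simp add: fps_nth_root_fps)
next
  case (Suc N)
  then obtain q where q: "\<And>d. sym_fun (q d)"
    "\<And>xs n. n \<le> N \<Longrightarrow> fps_nth (root_fps xs) n = fps_nth (\<Prod>d=1..N. witt_factor (q d xs) d) n" by blast
  define F where "F xs = (\<Prod>d=1..N. witt_factor (q d xs) d)" for xs
  define c where "c xs = fps_nth (F xs) (Suc N) - fps_nth (root_fps xs) (Suc N)" for xs
  have "sym_fps F" unfolding F_def by (intro sym_fps_prod sym_fps_witt_factor q)
  then have c: "sym_fun c"
    using sym_fps_root_fps unfolding c_def sym_fps_def by (intro sym_fun_diff) auto
  define q' where "q' = q(Suc N := c)"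
  have F': "(\<Prod>d=1..Suc N. witt_factor (q' d xs) d) = witt_factor (c xs) (Suc N) * F xs" for xs
  proof -
    have "(\<Prod>d=1..N. witt_factor (q' d xs) d) = F xs"
      unfolding F_def by (rule prod.cong) (auto simp: q'_def)
    then show ?thesis by (simp add: q'_def)
  qed
  have F0: "fps_nth (F xs) 0 = 1" for xs
    using q(2)[of 0 xs] by (simp add: F_def fps_nth_root_fps)
  have "fps_nth (root_fps xs) n = fps_nth (\<Prod>d=1..Suc N. witt_factor (q' d xs) d) n" if "n \<le> Suc N" for xs n
  proof (cases "n = Suc N")
    case True
    then show ?thesis unfolding F' fps_nth_witt_factor_mult by (simp add: c_def F0)
  next
    case False
    then show ?thesis
      using that q(2)[of n xs] unfolding F' fps_nth_witt_factor_mult by (simp add: F_def)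
  qed
  moreover have "sym_fun (q' d)" for d using q c by (simp add: q'_def)
  ultimately show ?case by blast
qed

lemma div_gcd_dvd_iff:
  fixes d g n :: nat
  assumes "d > 0" "g > 0"
  shows "d div gcd d g dvd n \<longleftrightarrow> d dvd g * n"
    and "d dvd g * n \<Longrightarrow> (g div gcd d g) * (n div (d div gcd d g)) = g * n div d"
proof -
  define e where "e = gcd d g"
  have e: "e > 0" using assms by (simp add: e_def)
  obtain d' g' where dg: "d = d' * e" "g = g' * e" "coprime d' g'"
    using gcd_coprime_exists[of d g] e unfolding e_def by auto
  show iff: "d div gcd d g dvd n \<longleftrightarrow> d dvd g * n"
    using e dg(3) unfolding e_def[symmetric] 
    by (simp add: dg(1,2) coprime_dvd_mult_right_iff mult.assoc mult.commute[of _ n] flip: mult.assoc)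
       (simp add: mult.commute coprime_dvd_mult_right_iff coprime_dvd_mult_left_iff)
  show "(g div gcd d g) * (n div (d div gcd d g)) = g * n div d" if "d dvd g * n"
  proof -
    have "d' dvd n" using iff that e unfolding e_def[symmetric] by (simp add: dg(1))
    then obtain k where "n = d' * k" by blast
    then show ?thesis using e assms unfolding e_def[symmetric] by (simp add: dg(1,2))
  qed
qed

text \<open>
  Comparing power sums in the Witt coordinates \<open>q\<^sub>d\<close> gives \<open>p\<^sub>n = \<Sum>\<^bsub>d | n\<^esub> d q\<^sub>d\<^sup>n\<^sup>/\<^sup>d\<close>. The power sums of the
  \<open>x\<^sub>i\<^sup>g\<close> are the \<open>p\<^bsub>gn\<^esub>\<close>, and these are the power sums of
  \<open>\<Prod>\<^sub>d (1 - q\<^sub>d\<^bsup>g/(d,g)\<^esup> T\<^bsup>d/(d,g)\<^esup>)\<^bsup>(d,g)\<^esup>\<close>, the Frobenius image. So \<open>\<Prod>\<^sub>i (1 - x\<^sub>i\<^sup>g T)\<close> agrees with this product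
  up to degree \<open>r\<close> if \<open>d\<close> runs up to \<open>g r\<close>, and the coefficients of the product are integer polynomials
  in the \<open>q\<^sub>d\<close>.
\<close>

theorem elem_sym_powers_symmetric:
  assumes g: "g > 0"
  shows "sym_fun (\<lambda>xs. elem_sym r (map (\<lambda>x. x ^ g) xs))"
proof -
  \<comment> \<open>the coefficient of degree r involves the power sums of the original list up to degree g r\<close>
  define N where "N = g * r"
  obtain q where q: "\<And>d. sym_fun (q d)"
    "\<And>xs n. n \<le> N \<Longrightarrow> fps_nth (root_fps xs) n = fps_nth (\<Prod>d=1..N. witt_factor (q d xs) d) n"
    using witt_coordinates[of N] by blast
  define Z where "Z xs = (\<Prod>d=1..N. witt_factor (q d xs ^ (g div gcd d g)) (d div gcd d g) ^ gcd d g)" for xs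
  have "sym_fps Z"
    unfolding Z_def by (intro sym_fps_prod sym_fps_power sym_fps_witt_factor sym_fun_power q)
  then have Z: "sym_fun (\<lambda>xs. (-1) ^ r * fps_nth (Z xs) r)"
    by (auto simp: sym_fps_def intro: sym_fun.intros)
  have "elem_sym r (map (\<lambda>x. x ^ g) xs) = (-1) ^ r * fps_nth (Z xs) r" for xs
  proof -
    let ?P = "\<lambda>q d. Abs_fps (\<lambda>n. if n > 0 \<and> d dvd n then int d * q ^ (n div d) else 0)"
    have Y: "has_power_sums (\<Prod>d=1..N. witt_factor (q d xs) d) (\<Sum>d=1..N. ?P (q d xs) d)"
      by (rule has_power_sums_prod) (simp add: has_power_sums_witt_factor)
    have ZP: "has_power_sums (Z xs) (\<Sum>d=1..N. of_nat (gcd d g) * ?P (q d xs ^ (g div gcd d g)) (d div gcd d g))"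
      unfolding Z_def
      by (intro has_power_sums_prod has_power_sums_power has_power_sums_witt_factor)
        (use g in \<open>auto simp: div_greater_zero_iff intro!: dvd_imp_le\<close>)
    have "fps_nth (root_fps (map (\<lambda>x. x ^ g) xs)) r = fps_nth (Z xs) r"
    proof (rule power_sums_determine[OF has_power_sums_root_fps ZP])
      fix n assume n: "n \<le> r"
      show "fps_nth (Abs_fps (\<lambda>n. if n > 0 then \<Sum>x\<leftarrow>map (\<lambda>x. x ^ g) xs. x ^ n else 0)) n =
          fps_nth (\<Sum>d=1..N. of_nat (gcd d g) * ?P (q d xs ^ (g div gcd d g)) (d div gcd d g)) n"
      proof (cases "n = 0")
        case True
        then show ?thesis by (simp add: fps_sum_nth fps_mult_nth)
      next
        case False
        have "(\<Sum>x\<leftarrow>map (\<lambda>x. x ^ g) xs. x ^ n) = (\<Sum>x\<leftarrow>xs. x ^ (g * n))"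
          by (simp add: power_mult comp_def)
        also have "\<dots> = fps_nth (\<Sum>d=1..N. ?P (q d xs) d) (g * n)"
          using power_sums_cong[OF has_power_sums_root_fps[of xs] Y, of N "g * n"] q(2) n False g
          by (simp add: N_def)
        also have "\<dots> = (\<Sum>d=1..N. if d dvd g * n then int d * q d xs ^ (g * n div d) else 0)"
          using False g by (simp add: fps_sum_nth)
        also have "\<dots> = (\<Sum>d=1..N. int (gcd d g) * (if d div gcd d g dvd n then int (d div gcd d g) *
            (q d xs ^ (g div gcd d g)) ^ (n div (d div gcd d g)) else 0))"
        proof (rule sum.cong)
          fix d assume "d \<in> {1..N}"
          then have d: "d > 0" by simp
          have "int (gcd d g) * int (d div gcd d g) = int d"
            by (metis dvd_mult_div_cancel gcd_dvd1 of_nat_mult)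
          then show "(if d dvd g * n then int d * q d xs ^ (g * n div d) else 0) =
              int (gcd d g) * (if d div gcd d g dvd n then int (d div gcd d g) *
              (q d xs ^ (g div gcd d g)) ^ (n div (d div gcd d g)) else 0)"
            using div_gcd_dvd_iff[OF d g, of n]
            by (simp flip: power_mult mult.assoc)
        qed simp
        also have "\<dots> = fps_nth (\<Sum>d=1..N. of_nat (gcd d g) * ?P (q d xs ^ (g div gcd d g)) (d div gcd d g)) n"
          using False by (simp add: fps_sum_nth flip: fps_of_nat)
        finally show ?thesis using False by simp
      qed
    qed simp
    then have "(-1) ^ r * elem_sym r (map (\<lambda>x. x ^ g) xs) = fps_nth (Z xs) r"
      by (simp add: fps_nth_root_fps)
    then show ?thesis by (metis left_minus_one_mult_self)
  qed
  with Z show ?thesis by simp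
qed

section \<open>Leading words\<close>

context strict_total
begin

lemma lenlex_iff:
  "(u, v) \<in> lenlex R \<longleftrightarrow> length u < length v \<or> length u = length v \<and> u \<prec> v"
  by (auto simp: lenlex_conv lexord_lex)

text \<open>
  Words are compared by length first: the summands of a mixable shuffle in which letters are
  multiplied are shorter, so only the ordinary shuffles compete for the leading position.
\<close>

definition leads :: "('a list \<Rightarrow>\<^sub>0 int) \<Rightarrow> 'a list \<Rightarrow> bool" where
  "leads f w \<longleftrightarrow> coeff f w = 1 \<and> (\<forall>z\<in>supp f. z = w \<or> (z, w) \<in> lenlex R)"

lemma leads_frag_of: "leads (frag_of w) w"
  by (simp add: leads_def)

lemma leads_prefix_letter: "leads f w \<Longrightarrow> leads (prefix_letter a f) (a # w)"
  by (auto simp: leads_def lookup_prefix_letter keys_prefix_letter lenlex_iff)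

lemma leads_add:
  assumes "leads f w" "\<And>z. z \<in> supp g \<Longrightarrow> length z < length w"
  shows "leads (f + g) w"
proof -
  have "w \<notin> supp g" using assms(2) by blast
  then have "coeff g w = 0" by (simp add: in_keys_iff)
  moreover have "z = w \<or> (z, w) \<in> lenlex R" if "z \<in> supp (f + g)" for z
    using subsetD[OF Poly_Mapping.keys_add that] assms by (auto simp: leads_def lenlex_iff)
  ultimately show ?thesis using assms(1) by (simp add: leads_def lookup_add)
qed

text \<open>
  Only the choice of a first letter from the left factor can produce the word \<open>concat fs @ concat gs\<close>:
  a start with the right factor gives a strictly smaller word, and multiplying two letters gives a
  shorter one.
\<close>

lemma mixable_shuffle_concat_coeff:
  assumes gs: "lyndon_factors gs"
  shows "lyndon_factors fs \<Longrightarrow> \<forall>u\<in>set fs. \<forall>v\<in>set gs. v \<prec> u \<Longrightarrow>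
    coeff (mixable_shuffle l A (concat fs) (concat gs)) (concat fs @ concat gs) = 1"
proof (induction "concat fs" arbitrary: fs)
  case Nil
  from Nil.hyps have "concat fs = []" by simp
  then show ?case by (simp del: concat_eq_Nil_conv)
next
  case (Cons a x)
  from Cons.hyps(2) obtain f fs' where "fs = f # fs'" by (cases fs) auto
  moreover with Cons.prems(1) have "f \<noteq> []" by (auto simp: lyndon_factors_Cons lyndon_def)
  ultimately obtain g where fs: "fs = (a # g) # fs'" and x: "x = g @ concat fs'"
    using Cons.hyps(2) by (cases f) auto
  show ?case
  proof (cases "concat gs")
    case Nil
    then show ?thesis using Cons.hyps(2)[symmetric] by (simp del: concat_eq_Nil_conv)
  next
    case y: (Cons b y)
    then obtain h gs' where "gs = h # gs'" by (cases gs) auto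
    moreover with gs have "h \<noteq> []" by (auto simp: lyndon_factors_Cons lyndon_def)
    ultimately obtain h' where gs': "gs = (b # h') # gs'" and y': "y = h' @ concat gs'"
      using y by (cases h) auto
    obtain ks where ks: "lyndon_factors ks" "concat ks = g" using lyndon_factorization by blast
    have gt: "a # g \<prec> k" if "k \<in> set ks" for k
      using tail_factors_greater[of a ks k] Cons.prems(1) ks that by (simp add: fs lyndon_factors_Cons)
    have fac: "lyndon_factors (ks @ fs')"
      unfolding lyndon_factors_append
    proof (intro conjI ballI)
      show "v \<preceq> k" if "k \<in> set ks" "v \<in> set fs'" for k v
        by (rule word_le_trans[of _ "a # g"])
          (use that gt Cons.prems(1) in \<open>auto simp: fs lyndon_factors_Cons\<close>)
    qed (use ks Cons.prems(1) in \<open>simp_all add: fs lyndon_factors_Cons\<close>)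
    have "v \<prec> u" if "u \<in> set (ks @ fs')" "v \<in> set gs" for u v
    proof (cases "u \<in> set ks")
      case True
      have "v \<prec> a # g" using Cons.prems(2) that by (simp add: fs)
      then show ?thesis using gt[OF True] word_less_trans by blast
    qed (use Cons.prems(2) that in \<open>auto simp: fs\<close>)
    then have 1: "coeff (mixable_shuffle l A x (concat gs)) (x @ concat gs) = 1"
      using Cons.hyps(1)[of "ks @ fs'"] fac ks x by simp
    have 2: "coeff (mixable_shuffle l A (a # x) y) (x @ concat gs) = 0" if "b = a"
    proof (rule ccontr)
      assume "\<not> ?thesis"
      then have k: "x @ concat gs \<in> supp (mixable_shuffle l A (a # x) y)"
        by (simp add: in_keys_iff)
      from keys_mixable_shuffle[OF k] have "x @ concat gs \<in> shuffles (a # x) y"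
        by (simp add: y)
      then have "b # (x @ concat gs) \<prec> concat fs @ concat ((b # h') # gs')"
        using Cons.prems gs Cons.hyps(2) y'
        by (intro late_start_less) (auto simp: gs' fs simp del: concat.simps)
      then show False using that Cons.hyps(2)[symmetric] by (simp add: gs' del: lexord_cons_cons)
    qed
    have 3: "coeff (mixable_shuffle l A x y) (x @ concat gs) = 0"
    proof (rule ccontr)
      assume "\<not> ?thesis"
      then have k: "x @ concat gs \<in> supp (mixable_shuffle l A x y)"
        by (simp add: in_keys_iff)
      from keys_mixable_shuffle[OF k] show False by (simp add: y)
    qed
    have "coeff (mixable_shuffle l A (a # x) (b # y)) (a # x @ concat gs) = 1"
      using 1 2 3 by (cases "b = a") (simp_all add: lookup_add lookup_prefix_letter y)
    then show ?thesis using Cons.hyps(2)[symmetric] y by simp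
  qed
qed

lemma shuffles_mono:
  assumes "length u = length x" "u \<preceq> x" "z \<in> shuffles u y"
  shows "\<exists>z'\<in>shuffles x y. z \<preceq> z' \<and> (u \<noteq> x \<longrightarrow> z \<prec> z')"
proof (cases "u = x")
  case True
  then show ?thesis using assms(3) by blast
next
  case False
  then have "u \<prec> x" using assms(2) by blast
  from shuffles_strict_mono[OF assms(1) this assms(3)] show ?thesis by blast
qed

text \<open>
  Replacing \<open>u\<close> and \<open>v\<close> by the leading words \<open>concat fs\<close> and \<open>concat gs\<close>, at unchanged positions, only
  enlarges a shuffle.
\<close>

lemma mixable_shuffle_keys_le:
  assumes fs: "lyndon_factors fs" and gs: "lyndon_factors gs"
    and gt: "\<forall>u\<in>set fs. \<forall>v\<in>set gs. v \<prec> u"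
    and u: "u = concat fs \<or> (u, concat fs) \<in> lenlex R"
    and v: "v = concat gs \<or> (v, concat gs) \<in> lenlex R"
    and z: "z \<in> supp (mixable_shuffle l A u v)"
  shows "z = concat fs @ concat gs \<and> u = concat fs \<and> v = concat gs \<or>
    (z, concat fs @ concat gs) \<in> lenlex R"
proof (cases "length z < length (concat fs @ concat gs)")
  case True
  then show ?thesis by (simp add: lenlex_iff)
next
  case False
  let ?x = "concat fs" and ?y = "concat gs"
  have "length u \<le> length ?x" "length v \<le> length ?y" using u v by (auto simp: lenlex_iff)
  with False keys_mixable_shuffle[OF z]
  have len: "length u = length ?x" "length v = length ?y" and zs: "z \<in> shuffles u v" by auto
  have ux: "u \<preceq> ?x" and vy: "v \<preceq> ?y" using u v len by (auto simp: lenlex_iff)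
  have top: "z' \<preceq> ?x @ ?y" if "z' \<in> shuffles ?x ?y" for z'
    using shuffle_le_sort[OF fs gs that] sort_append(1)[OF fs gs] gt by auto
  obtain z1 where z1: "z1 \<in> shuffles ?x v" "z \<preceq> z1" "u \<noteq> ?x \<Longrightarrow> z \<prec> z1"
    using shuffles_mono[OF len(1) ux zs] by blast
  have "z1 \<in> shuffles v ?x" using z1(1) by (simp only: shuffles_commutes)
  from shuffles_mono[OF len(2) vy this]
  obtain z2 where z2: "z2 \<in> shuffles ?y ?x" "z1 \<preceq> z2" "v \<noteq> ?y \<Longrightarrow> z1 \<prec> z2" by blast
  have "z2 \<in> shuffles ?x ?y" using z2(1) by (simp only: shuffles_commutes)
  then have z2': "z2 \<preceq> ?x @ ?y" by (rule top)
  have zz: "length z = length (?x @ ?y)" using length_shuffles[OF zs] len by simp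
  show ?thesis
  proof (cases "u = ?x \<and> v = ?y")
    case True
    then show ?thesis using top[of z] zs zz by (auto simp: lenlex_iff)
  next
    case False
    have "z \<prec> z2"
    proof (cases "u = ?x")
      case True
      then have "z1 \<prec> z2" using False z2(3) by blast
      then show ?thesis using z1(2) word_less_trans[of z z1] by metis
    next
      case False
      then have "z \<prec> z1" using z1(3) by blast
      then show ?thesis using z2(2) word_less_trans[of z z1] by metis
    qed
    then have "z \<prec> ?x @ ?y" using z2' word_less_trans[of z z2] by metis
    then show ?thesis using zz by (simp add: lenlex_iff)
  qed
qed

lemma lenlex_not_refl [simp]: "(w, w) \<notin> lenlex R"
  by (simp add: lenlex_iff)

theorem leads_product:
  assumes fs: "lyndon_factors fs" and gs: "lyndon_factors gs"
    and gt: "\<forall>u\<in>set fs. \<forall>v\<in>set gs. v \<prec> u"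
    and f: "leads f (concat fs)" and g: "leads g (concat gs)"
  shows "leads (frag_bilinear (mixable_shuffle l A) f g) (concat fs @ concat gs)"
proof -
  let ?x = "concat fs" and ?y = "concat gs"
  have below: "u \<in> supp f \<Longrightarrow> u = ?x \<or> (u, ?x) \<in> lenlex R"
    "v \<in> supp g \<Longrightarrow> v = ?y \<or> (v, ?y) \<in> lenlex R" for u v
    using f g by (simp_all add: leads_def)
  have "coeff (mixable_shuffle l A u v) (?x @ ?y) =
      (if u = ?x then 1 else 0) * (if v = ?y then 1 else 0)"
    if "u \<in> supp f" "v \<in> supp g" for u v
  proof (cases "u = ?x \<and> v = ?y")
    case True
    then show ?thesis using mixable_shuffle_concat_coeff[OF gs fs gt] by simp
  next
    case False
    have "?x @ ?y \<notin> supp (mixable_shuffle l A u v)"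
    proof
      assume "?x @ ?y \<in> supp (mixable_shuffle l A u v)"
      from mixable_shuffle_keys_le[OF fs gs gt below(1)[OF that(1)] below(2)[OF that(2)] this] False
      show False by simp
    qed
    then show ?thesis using False by (auto simp: in_keys_iff)
  qed
  then have "lin_ext (\<lambda>z. if z = ?x @ ?y then 1 else 0) (mixable_shuffle l A u v) =
      (if u = ?x then 1 else 0) * (if v = ?y then 1 else 0)"
    if "u \<in> supp f" "v \<in> supp g" for u v
    using that by (simp only: lookup_eq_lin)
  then have "coeff (frag_bilinear (mixable_shuffle l A) f g) (?x @ ?y) =
      coeff f ?x * coeff g ?y"
    unfolding lookup_eq_lin by (rule lin_ext_frag_bilinear)
  moreover have "z = ?x @ ?y \<or> (z, ?x @ ?y) \<in> lenlex R"
    if "z \<in> supp (frag_bilinear (mixable_shuffle l A) f g)" for z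
    using that
  proof (rule keys_frag_bilinearE)
    fix u v assume uv: "u \<in> supp f" "v \<in> supp g"
      "z \<in> supp (mixable_shuffle l A u v)"
    from mixable_shuffle_keys_le[OF fs gs gt below(1)[OF uv(1)] below(2)[OF uv(2)] uv(3)]
    show ?thesis by blast
  qed
  ultimately show ?thesis using f g by (simp add: leads_def)
qed

end

section \<open>Words of monomials\<close>

text \<open>
  The monoid of monomials, packaged so that words of monomials and words of polynomials share one
  mixable shuffle product. Multisets of variables are multiplied by adding them.
\<close>

definition monomials :: "'x multiset ring" where
  "monomials = \<lparr>carrier = UNIV, monoid.mult = (+), one = {#}, zero = {#}, add = (+)\<rparr>"

lemma mult_monomials [simp]: "m \<otimes>\<^bsub>monomials\<^esub> n = m + n"
  by (simp add: monomials_def)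

abbreviation quasi_shuffle where "quasi_shuffle l \<equiv> frag_bilinear (mixable_shuffle l monomials)"

type_synonym 'x word_sum = "'x multiset list \<Rightarrow>\<^sub>0 int"

abbreviation ev :: "int \<Rightarrow> ('x \<Rightarrow> int) list \<Rightarrow> ('x multiset list \<Rightarrow>\<^sub>0 int) \<Rightarrow> int" where
  "ev l cs \<equiv> lin_ext (quasi_eval l (map mon_eval cs))"

lemma ev_qsh: "ev l cs (quasi_shuffle l f g) = ev l cs f * ev l cs g"
  by (intro lin_ext_frag_bilinear quasi_eval_mixable_shuffle) (auto simp: mon_eval_add)

lemma ev_eqI: "l \<noteq> 0 \<Longrightarrow> (\<And>cs. ev l cs f = ev l cs g) \<Longrightarrow> f = g"
  using quasi_eval_injective[of l "f - g"] by (simp add: lin_ext_diff)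

lemma quasi_shuffle_commute: "l \<noteq> 0 \<Longrightarrow> quasi_shuffle l f g = quasi_shuffle l g f"
  by (rule ev_eqI[of l]) (simp_all add: ev_qsh)

lemma quasi_shuffle_one: "l \<noteq> 0 \<Longrightarrow> quasi_shuffle l (frag_of []) f = f"
  by (rule ev_eqI[of l]) (simp_all add: ev_qsh)

text \<open>
  The words of multidegree \<open>M\<close> whose letters are different from the monomial \<open>1\<close>. These sets are finite
  even for infinitely many variables, which permits counting in each multidegree.
\<close>

definition words_of :: "'x multiset \<Rightarrow> 'x multiset list set" where
  "words_of M = {w. {#} \<notin> set w \<and> sum_list w = M}"

lemma finite_words_of: "finite (words_of M)"
proof -
  have mem: "m \<subseteq># sum_list w" if "m \<in> set w" for w and m :: "'x multiset"
    using that by (induction w) (auto intro: subset_mset.add_increasing subset_mset.add_increasing2)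
  have len: "length w \<le> size (sum_list w)" if "{#} \<notin> set w" for w :: "'x multiset list"
    using that
  proof (induction w)
    case (Cons a w)
    then have "size a > 0" by (auto simp: nonempty_has_size)
    with Cons show ?case by auto
  qed simp
  have "finite {m. m \<subseteq># M}"
  proof (rule finite_subset)
    show "{m. m \<subseteq># M} \<subseteq> mset ` {xs. set xs \<subseteq> set_mset M \<and> length xs \<le> size M}"
    proof
      fix m assume "m \<in> {m. m \<subseteq># M}"
      then have m: "m \<subseteq># M" by simp
      obtain xs where xs: "mset xs = m" using ex_mset by blast
      then have "set xs \<subseteq> set_mset M" "length xs \<le> size M"
        using set_mset_mono[OF m] size_mset_mono[OF m] by (auto simp flip: set_mset_mset size_mset)
      with xs show "m \<in> mset ` {xs. set xs \<subseteq> set_mset M \<and> length xs \<le> size M}" by blast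
    qed
  qed (simp add: finite_lists_length_le)
  moreover have "words_of M \<subseteq> {w. set w \<subseteq> {m. m \<subseteq># M} \<and> length w \<le> size M}"
    using mem len by (auto simp: words_of_def)
  ultimately show ?thesis using finite_lists_length_le finite_subset by blast
qed

lemma keys_mixable_shuffle_words_of:
  "z \<in> supp (mixable_shuffle l A u v) \<Longrightarrow> A = monomials \<Longrightarrow>
    u \<in> words_of M \<Longrightarrow> v \<in> words_of N \<Longrightarrow> z \<in> words_of (M + N)"
proof (induction l A u v arbitrary: z M N rule: mixable_shuffle.induct)
  case (3 l A a u b v)
  have a: "a \<noteq> {#}" "b \<noteq> {#}" using "3.prems"(3,4) by (auto simp: words_of_def)
  define M' where "M' = sum_list u"
  define N' where "N' = sum_list v"
  have M: "M = a + M'" "u \<in> words_of M'" "a # u \<in> words_of (a + M')"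
    using "3.prems"(3) by (auto simp: words_of_def M'_def)
  have N: "N = b + N'" "v \<in> words_of N'" "b # v \<in> words_of (b + N')"
    using "3.prems"(4) by (auto simp: words_of_def N'_def)
  from "3.prems"(1) have "z \<in> supp (prefix_letter a (mixable_shuffle l A u (b # v))) \<or>
      z \<in> supp (prefix_letter b (mixable_shuffle l A (a # u) v)) \<or>
      z \<in> supp (prefix_letter (a + b) (mixable_shuffle l A u v))"
    using "3.prems"(2) by (auto dest!: subsetD[OF Poly_Mapping.keys_add])
  then show ?case
    unfolding keys_prefix_letter
  proof (elim disjE imageE)
    fix w assume "z = a # w" "w \<in> supp (mixable_shuffle l A u (b # v))"
    then show ?case using "3.IH"(1)[of w M' "b + N'"] "3.prems"(2) a M N
      by (auto simp: words_of_def ac_simps)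
  next
    fix w assume "z = b # w" "w \<in> supp (mixable_shuffle l A (a # u) v)"
    then show ?case using "3.IH"(2)[of w "a + M'" "N'"] "3.prems"(2) a M N
      by (auto simp: words_of_def ac_simps)
  next
    fix w assume "z = (a + b) # w" "w \<in> supp (mixable_shuffle l A u v)"
    then show ?case using "3.IH"(3)[of w "M'" "N'"] "3.prems"(2) a M N
      by (auto simp: words_of_def ac_simps)
  qed
qed (auto simp: words_of_def)

definition homog :: "'x multiset \<Rightarrow> 'x word_sum \<Rightarrow> bool" where
  "homog M f \<longleftrightarrow> supp f \<subseteq> words_of M"

lemma homog_qsh: "homog M f \<Longrightarrow> homog N g \<Longrightarrow> homog (M + N) (quasi_shuffle l f g)"
  unfolding homog_def
  by (auto elim!: keys_frag_bilinearE intro: keys_mixable_shuffle_words_of)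

lemma homog_prefix_letter: "homog M f \<Longrightarrow> a \<noteq> {#} \<Longrightarrow> homog (a + M) (prefix_letter a f)"
  by (auto simp: homog_def keys_prefix_letter words_of_def)

lemma homog_cmul: "homog M f \<Longrightarrow> homog M (frag_cmul c f)"
  unfolding homog_def using keys_cmul by blast

lemma homog_sum: "(\<And>i. i \<in> I \<Longrightarrow> homog M (f i)) \<Longrightarrow> homog M (sum f I)"
  unfolding homog_def by (rule order_trans[OF Poly_Mapping.keys_sum]) blast

section \<open>Elementary symmetric functions of a word\<close>

text \<open>
  The \<open>n\<close>-th elementary symmetric function of the terms of the sum that defines the value of a word \<open>a w\<close>.
  Split the index sequences by whether they use the first index: the terms that do are multiples of
  the terms for \<open>w\<close> by the value of \<open>a\<close>. If \<open>j + 1\<close> of the \<open>n + 1\<close> chosen terms use it, the first point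
  contributes \<open>a\<^sup>j\<^sup>+\<^sup>1\<close>, and the later points contribute an elementary symmetric function for \<open>a w\<close> times
  one for \<open>w\<close>. So the elementary symmetric functions of a word are integral combinations of words.
\<close>

fun quasi_elem :: "int \<Rightarrow> nat \<Rightarrow> 'x multiset list \<Rightarrow> 'x word_sum" where
  "quasi_elem l 0 w = frag_of []"
| "quasi_elem l (Suc n) [] = (if n = 0 then frag_of [] else 0)"
| "quasi_elem l (Suc n) (a # w) = (\<Sum>j\<le>n. frag_cmul (l ^ j) (prefix_letter (repeat_mset (Suc j) a)
     (quasi_shuffle l (quasi_elem l (n - j) (a # w)) (quasi_elem l (Suc j) w))))"

text \<open>
  The individual terms of the sum that \<open>quasi_eval\<close> computes.
\<close>

fun summands :: "int \<Rightarrow> ('a \<Rightarrow> int) list \<Rightarrow> 'a list \<Rightarrow> int list" where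
  "summands l cs [] = [1]"
| "summands l [] (a # w) = []"
| "summands l (c # cs) (a # w) = summands l cs (a # w) @ map (\<lambda>x. (l * c a) * x) (summands l cs w)"

lemma ev_quasi_elem: "ev l cs (quasi_elem l n w) = elem_sym n (summands l (map mon_eval cs) w)"
proof (induction cs arbitrary: n w)
  case Nil
  show ?case
  proof (cases n)
    case (Suc m)
    then show ?thesis
      by (cases w) (auto simp: elem_sym_Nil lin_ext_sum lin_ext_cmul lin_ext_qeval_prefix_letter)
  qed simp
next
  case (Cons c cs)
  show ?case
  proof (cases n)
    case n: (Suc m)
    show ?thesis
    proof (cases w)
      case Nil
      then show ?thesis by (simp add: n elem_sym_Nil)
    next
      case w: (Cons a v)
      let ?g = "\<lambda>j. quasi_shuffle l (quasi_elem l (m - j) w) (quasi_elem l (Suc j) v)"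
      have quasi_elem: "quasi_elem l n w = (\<Sum>j\<le>m. frag_cmul (l ^ j) (prefix_letter (repeat_mset (Suc j) a) (?g j)))"
        by (simp add: n w)
      have "ev l (c # cs) (quasi_elem l n w) = ev l cs (quasi_elem l n w) +
          (\<Sum>j\<le>m. l ^ j * (l * mon_eval c a ^ Suc j * ev l cs (?g j)))"
        unfolding quasi_elem
        by (simp add: lin_ext_sum lin_ext_cmul lin_ext_qeval_prefix_letter mon_eval_repeat distrib_left sum.distrib
            del: repeat_mset_Suc power_Suc)
      also have "(\<Sum>j\<le>m. l ^ j * (l * mon_eval c a ^ Suc j * ev l cs (?g j))) =
          (\<Sum>j\<le>m. (l * mon_eval c a) ^ Suc j * elem_sym (Suc j) (summands l (map mon_eval cs) v) *
             elem_sym (m - j) (summands l (map mon_eval cs) w))"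
        by (rule sum.cong) (simp_all add: ev_qsh Cons.IH power_mult_distrib mult_ac del: quasi_elem.simps)
      also have "ev l cs (quasi_elem l n w) + \<dots> = elem_sym n (summands l (map mon_eval (c # cs)) w)"
        unfolding Cons.IH
        by (simp add: w elem_sym_append elem_sym_scale n sum.atMost_Suc_shift del: sum.atMost_Suc power_Suc)
      finally show ?thesis .
    qed
  qed simp
qed

lemma quasi_elem_1: "l \<noteq> 0 \<Longrightarrow> quasi_elem l (Suc 0) w = frag_of w"
proof (induction w)
  case (Cons a w)
  then show ?case by (simp add: quasi_shuffle_one)
qed simp

lemma homog_quasi_elem: "w \<in> words_of M \<Longrightarrow> homog (repeat_mset n M) (quasi_elem l n w)"
proof (induction l n w arbitrary: M rule: quasi_elem.induct)
  case (1 l w)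
  then show ?case by (simp add: homog_def words_of_def)
next
  case (2 l n)
  then show ?case by (auto simp: homog_def words_of_def)
next
  case (3 l n a w)
  have a: "a \<noteq> {#}" using "3.prems" by (auto simp: words_of_def)
  define N where "N = sum_list w"
  have M: "M = a + N" "w \<in> words_of N" using "3.prems" by (auto simp: words_of_def N_def)
  have "homog (repeat_mset (Suc n) M) (prefix_letter (repeat_mset (Suc j) a)
     (quasi_shuffle l (quasi_elem l (n - j) (a # w)) (quasi_elem l (Suc j) w)))" if j: "j \<in> {..n}" for j
  proof -
    from j obtain k where k: "n = j + k" using le_Suc_ex by auto
    have "repeat_mset (Suc n) M = repeat_mset (Suc j) a + (repeat_mset (n - j) M + repeat_mset (Suc j) N)"
      by (rule multiset_eqI) (simp add: k M algebra_simps)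
    moreover have "repeat_mset (Suc j) a \<noteq> {#}" using a by simp
    ultimately show ?thesis
      using homog_prefix_letter[OF homog_qsh[OF "3.IH"(1)[OF j "3.prems"] "3.IH"(2)[OF j M(2)]]]
      by presburger
  qed
  then show ?case by (auto intro!: homog_sum homog_cmul simp del: repeat_mset_Suc)
qed

lemma length_quasi_elem: "z \<in> supp (quasi_elem l n w) \<Longrightarrow> length z \<le> n * length w"
proof (induction l n w arbitrary: z rule: quasi_elem.induct)
  case (3 l n a w)
  from "3.prems" obtain j where j: "j \<in> {..n}"
    and "z \<in> supp (prefix_letter (repeat_mset (Suc j) a)
      (quasi_shuffle l (quasi_elem l (n - j) (a # w)) (quasi_elem l (Suc j) w)))"
    by (auto dest!: subsetD[OF Poly_Mapping.keys_sum] simp del: repeat_mset_Suc)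
  then obtain z' where z': "length z = Suc (length z')"
    "z' \<in> supp (quasi_shuffle l (quasi_elem l (n - j) (a # w)) (quasi_elem l (Suc j) w))"
    by (auto simp: keys_prefix_letter)
  from z'(2) obtain u v where uv: "u \<in> supp (quasi_elem l (n - j) (a # w))"
    "v \<in> supp (quasi_elem l (Suc j) w)"
    "z' \<in> supp (mixable_shuffle l monomials u v)" by (rule keys_frag_bilinearE)
  have "length z' \<le> (n - j) * length (a # w) + Suc j * length w"
    using keys_mixable_shuffle[OF uv(3)] "3.IH"(1)[OF j uv(1)] "3.IH"(2)[OF j uv(2)] by simp
  moreover obtain k where k: "n = j + k" using le_Suc_ex j by auto
  ultimately show ?case using z'(1) by (simp add: algebra_simps)
qed (auto split: if_splits)

context strict_total
begin

lemma lyndon_factors_replicate: "lyndon v \<Longrightarrow> lyndon_factors (replicate n v)"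
  by (induction n) (auto simp: lyndon_factors_Cons)

end

locale monomial_order = strict_total R for R :: "('x multiset \<times> 'x multiset) set" +
  assumes scale: "(m, m') \<in> R \<Longrightarrow> k > 0 \<Longrightarrow> (repeat_mset k m, repeat_mset k m') \<in> R"
begin

text \<open>
  In the recursion the summand \<open>j = 0\<close> is the only one with words of maximal length. It prefixes \<open>a\<close> to
  the product of the tail \<open>w\<close> of \<open>v\<close> with the previous elementary symmetric function; the Lyndon factors
  of \<open>w\<close> exceed \<open>v\<close>, so the product leads with \<open>w v\<^sup>n\<close>, with coefficient one. The \<open>n\<close>-th shuffle power of \<open>v\<close>
  itself would lead with coefficient \<open>n!\<close>.
\<close>

lemma leads_quasi_elem:
  assumes l: "l \<noteq> 0" and v: "lyndon v"
  shows "leads (quasi_elem l n v) (concat (replicate n v))"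
proof (induction n)
  case 0
  show ?case by (simp add: leads_frag_of)
next
  case (Suc n)
  from v obtain a w where aw: "v = a # w" by (cases v) (auto simp: lyndon_def)
  obtain ks where ks: "lyndon_factors ks" "concat ks = w" using lyndon_factorization by blast
  let ?t = "\<lambda>j. frag_cmul (l ^ j) (prefix_letter (repeat_mset (Suc j) a)
     (quasi_shuffle l (quasi_elem l (n - j) v) (quasi_elem l (Suc j) w)))"
  have split: "quasi_elem l (Suc n) v = ?t 0 + (\<Sum>j\<in>{1..n}. ?t j)"
    by (simp add: aw atMost_atLeast0 sum.atLeast_Suc_atMost del: repeat_mset_Suc)
  have gt: "\<forall>u\<in>set ks. \<forall>v'\<in>set (replicate n v). v' \<prec> u"
    using tail_factors_greater[of a ks] v ks aw by auto
  have "leads (quasi_shuffle l (frag_of (concat ks)) (quasi_elem l n v)) (concat ks @ concat (replicate n v))"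
    by (rule leads_product[OF ks(1) lyndon_factors_replicate[OF v] gt leads_frag_of Suc.IH])
  then have "leads (prefix_letter a (quasi_shuffle l (frag_of w) (quasi_elem l n v))) (concat (replicate (Suc n) v))"
    using leads_prefix_letter[of _ "w @ concat (replicate n v)" a] by (simp add: ks(2) aw)
  moreover have "?t 0 = prefix_letter a (quasi_shuffle l (frag_of w) (quasi_elem l n v))"
    using quasi_shuffle_commute[OF l, of "quasi_elem l n v" "frag_of w"] by (simp add: quasi_elem_1[OF l])
  ultimately have 0: "leads (?t 0) (concat (replicate (Suc n) v))" by simp
  have "length z < length (concat (replicate (Suc n) v))"
    if "z \<in> supp (\<Sum>j\<in>{1..n}. ?t j)" for z
  proof -
    from that obtain j where j: "j \<in> {1..n}" and "z \<in> supp (?t j)"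
      by (auto dest!: subsetD[OF Poly_Mapping.keys_sum] simp del: repeat_mset_Suc quasi_elem.simps)
    then obtain z' where z': "length z = Suc (length z')"
      "z' \<in> supp (quasi_shuffle l (quasi_elem l (n - j) v) (quasi_elem l (Suc j) w))"
      by (auto simp: keys_prefix_letter)
    from z'(2) obtain x y where xy: "x \<in> supp (quasi_elem l (n - j) v)"
      "y \<in> supp (quasi_elem l (Suc j) w)"
      "z' \<in> supp (mixable_shuffle l monomials x y)" by (rule keys_frag_bilinearE)
    have "length z' \<le> (n - j) * length v + Suc j * length w"
      using keys_mixable_shuffle[OF xy(3)] length_quasi_elem[OF xy(1)] length_quasi_elem[OF xy(2)] by simp
    moreover obtain k where k: "n = j + k" using le_Suc_ex j by auto
    moreover have "length (concat (replicate (Suc n) v)) = Suc n * length v"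
      by (simp add: length_concat sum_list_replicate)
    ultimately show ?thesis using z'(1) aw j by (simp add: algebra_simps)
  qed
  with 0 show ?case unfolding split by (rule leads_add)
qed

end

section \<open>Independence by counting\<close>

text \<open>
  A spanning family of at most \<open>card W\<close> elements of the free abelian group on \<open>W\<close> is independent. Modulo any
  \<open>N\<close> the family defines a surjective map between finite sets, from one that is not larger than
  the other, so the map is injective; take \<open>N\<close> larger than all coefficients of a relation.
\<close>

lemma spanning_independent:
  fixes s :: "'w \<Rightarrow> 'j \<Rightarrow> int" and y :: "'j \<Rightarrow> 'w \<Rightarrow> int"
  assumes J: "finite J" and W: "finite W" and card: "card J \<le> card W"
    and span: "\<And>w z. w \<in> W \<Longrightarrow> z \<in> W \<Longrightarrow> (\<Sum>j\<in>J. s w j * y j z) = (if w = z then 1 else 0)"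
    and rel: "\<And>z. z \<in> W \<Longrightarrow> (\<Sum>j\<in>J. c j * y j z) = 0"
    and j: "j \<in> J"
  shows "c j = 0"
proof -
  define N where "N = 1 + (\<Sum>j\<in>J. \<bar>c j\<bar>)"
  have c_less: "\<bar>c j\<bar> < N" if "j \<in> J" for j
    using member_le_sum[of j J "\<lambda>j. \<bar>c j\<bar>"] that J by (simp add: N_def)
  have N: "N > 0" using c_less[OF j] by simp
  \<comment> \<open>the combination with coefficients d, reduced modulo N\<close>
  define F where "F d = restrict (\<lambda>z. (\<Sum>j\<in>J. d j * y j z) mod N) W" for d
  define A where "A = (J \<rightarrow>\<^sub>E {0..<N})"
  define B where "B = (W \<rightarrow>\<^sub>E {0..<N})"
  have finA: "finite A" using J by (simp add: A_def finite_PiE)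
  have mod_comb: "(\<Sum>j\<in>J. (X j mod N) * y j z) mod N = (\<Sum>j\<in>J. X j * y j z) mod N" for X z
  proof -
    have "(\<Sum>j\<in>J. ((X j mod N) * y j z) mod N) mod N = (\<Sum>j\<in>J. (X j * y j z) mod N) mod N"
      by (simp add: mod_mult_left_eq)
    then show ?thesis unfolding mod_sum_eq .
  qed
  have "B \<subseteq> F ` A"
  proof
    fix b assume b: "b \<in> B"
    define d where "d = restrict (\<lambda>j. (\<Sum>w\<in>W. b w * s w j) mod N) J"
    have "F d z = b z" for z
    proof (cases "z \<in> W")
      case True
      have "(\<Sum>j\<in>J. d j * y j z) mod N = (\<Sum>j\<in>J. (\<Sum>w\<in>W. b w * s w j) * y j z) mod N"
        using mod_comb[of "\<lambda>j. \<Sum>w\<in>W. b w * s w j" z] by (simp add: d_def)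
      also have "(\<Sum>j\<in>J. (\<Sum>w\<in>W. b w * s w j) * y j z) = (\<Sum>w\<in>W. b w * (\<Sum>j\<in>J. s w j * y j z))"
        unfolding sum_distrib_left sum_distrib_right by (subst sum.swap) (simp add: mult.assoc)
      also have "\<dots> = (\<Sum>w\<in>W. if w = z then b w else 0)"
        by (rule sum.cong) (simp_all add: span True)
      also have "\<dots> = b z" using W True by simp
      also have "b z mod N = b z"
        using b True PiE_mem[of b W "\<lambda>_. {0..<N}" z] by (simp add: B_def)
      finally show ?thesis using True by (simp add: F_def)
    next
      case False
      then show ?thesis using b by (auto simp: B_def F_def PiE_def extensional_def)
    qed
    moreover have "d \<in> A" using N by (auto simp: A_def d_def)
    moreover from calculation(1) have "F d = b" by blast
    ultimately show "b \<in> F ` A" by blast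
  qed
  then have "card B \<le> card (F ` A)" by (rule card_mono[rotated]) (use finA in simp)
  moreover have "card A \<le> card B"
    using N card by (simp add: A_def B_def card_PiE J W power_increasing)
  ultimately have "card (F ` A) = card A" using card_image_le[OF finA, of F] by linarith
  then have inj: "inj_on F A" by (rule eq_card_imp_inj_on[OF finA])
  \<comment> \<open>a relation and the trivial one, reduced modulo N, have the same image\<close>
  define d0 where "d0 = restrict (\<lambda>j. c j mod N) J"
  define d1 where "d1 = restrict (\<lambda>j. 0 :: int) J"
  have "F d0 = F d1"
  proof
    fix z show "F d0 z = F d1 z"
    proof (cases "z \<in> W")
      case True
      have "(\<Sum>j\<in>J. d0 j * y j z) mod N = (\<Sum>j\<in>J. c j * y j z) mod N"
        using mod_comb[of c z] by (simp add: d0_def)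
      then show ?thesis using rel[OF True] True by (simp add: F_def d1_def)
    qed (simp add: F_def)
  qed
  moreover have "d0 \<in> A" "d1 \<in> A" using N by (auto simp: A_def d0_def d1_def)
  ultimately have "d0 j = d1 j" using inj by (metis inj_onD)
  then have "N dvd c j" using j by (auto simp: d0_def d1_def)
  then show ?thesis using dvd_imp_le_int[of "c j" N] c_less[OF j] N by force
qed

section \<open>Polynomial generators of the mixable shuffle algebra\<close>

lemma repeat_mset_inject: "k > 0 \<Longrightarrow> repeat_mset k m = repeat_mset k n \<longleftrightarrow> m = n"
  by (auto simp: multiset_eq_iff)

lemma repeat_mset_eq_empty: "k > 0 \<Longrightarrow> repeat_mset k m = {#} \<longleftrightarrow> m = {#}"
  using repeat_mset_inject[of k m "{#}"] by simp

definition content :: "'x multiset list \<Rightarrow> nat" where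
  "content w = Gcd (\<Union>m\<in>set w. count m ` set_mset m)"

lemma set_mset_repeat: "k > 0 \<Longrightarrow> set_mset (repeat_mset k m) = set_mset m"
  by (induction k rule: nat_induct_non_zero) auto

lemma content_scale:
  assumes "k > 0" shows "content (map (repeat_mset k) w) = k * content w"
proof -
  have *: "count (repeat_mset k m) ` set_mset (repeat_mset k m) = (*) k ` (count m ` set_mset m)"
    for m :: "'a multiset"
  proof -
    have "count (repeat_mset k m) ` set_mset m = (\<lambda>x. k * count m x) ` set_mset m"
      by (rule image_cong) simp_all
    then show ?thesis by (simp only: set_mset_repeat[OF assms] image_image)
  qed
  have "(\<Union>m\<in>set (map (repeat_mset k) w). count m ` set_mset m) =
      (\<Union>m\<in>set w. (*) k ` (count m ` set_mset m))"
    unfolding set_map image_image[symmetric] by (simp only: UN_simps(10) *)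
  also have "\<dots> = (*) k ` (\<Union>m\<in>set w. count m ` set_mset m)"
    by (simp only: image_UN)
  finally show ?thesis by (simp only: content_def Gcd_mult normalize_nat_def)  simp
qed

lemma content_pos:
  assumes "w \<noteq> []" "{#} \<notin> set w" shows "content w > 0"
proof -
  from assms obtain m where m: "m \<in> set w" "m \<noteq> {#}" by (cases w) auto
  then obtain x where "x \<in># m" by blast
  then have "count m x \<in> (\<Union>m\<in>set w. count m ` set_mset m)" "0 < count m x" using m by auto
  then show ?thesis unfolding content_def by (intro dvd_pos_nat[OF _ Gcd_dvd])
qed

lemma content_root_exists: "\<exists>u. w = map (repeat_mset (content w)) u"
proof -
  let ?g = "content w"
  have "\<exists>n. m = repeat_mset ?g n" if "m \<in> set w" for m
  proof
    show "m = repeat_mset ?g (\<Sum>x\<in>set_mset m. replicate_mset (count m x div ?g) x)"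
    proof (rule multiset_eqI)
      fix x
      have "?g dvd count m x"
      proof (cases "x \<in># m")
        case True
        then show ?thesis unfolding content_def using that by (intro Gcd_dvd) auto
      qed (simp add: count_eq_zero_iff[THEN iffD2])
      then show "count m x = count (repeat_mset ?g (\<Sum>x\<in>set_mset m. replicate_mset (count m x div ?g) x)) x"
        by (cases "x \<in># m") (simp_all add: count_sum count_eq_zero_iff[THEN iffD2])
    qed
  qed
  then obtain f where "\<And>m. m \<in> set w \<Longrightarrow> m = repeat_mset ?g (f m)" by metis
  then have "map (\<lambda>m. repeat_mset ?g (f m)) w = map (\<lambda>m. m) w"
    by (intro map_cong) simp_all
  then have "w = map (repeat_mset ?g) (map f w)" by (simp add: comp_def)
  then show ?thesis by blast
qed

definition content_root :: "'x multiset list \<Rightarrow> 'x multiset list" where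
  "content_root w = (SOME u. w = map (repeat_mset (content w)) u)"

lemma content_root: "map (repeat_mset (content w)) (content_root w) = w"
  unfolding content_root_def using someI_ex[OF content_root_exists[of w]] by simp

lemma content_root_scale:
  assumes "content u = 1" "k > 0"
  shows "content (map (repeat_mset k) u) = k" "content_root (map (repeat_mset k) u) = u"
proof -
  show c: "content (map (repeat_mset k) u) = k" using assms by (simp add: content_scale)
  have "map (repeat_mset k) (content_root (map (repeat_mset k) u)) = map (repeat_mset k) u"
    using content_root[of "map (repeat_mset k) u"] c by simp
  moreover have "inj (repeat_mset k :: 'a multiset \<Rightarrow> _)"
    using assms(2) by (auto simp: inj_def repeat_mset_inject)
  ultimately show "content_root (map (repeat_mset k) u) = u" by (metis map_injective inj_eq inj_map_eq_map)
qed

lemma sum_list_scale: "sum_list (map (repeat_mset k) w) = repeat_mset k (sum_list w)"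
  by (induction w) auto

text \<open>
  A non-empty word without the letter \<open>1\<close> is uniquely \<open>u\<^sup>(\<^sup>n\<^sup>)\<close>, the word \<open>u\<close> of content one with
  all exponents multiplied by \<open>n\<close>. Its generator is the \<open>n\<close>-th elementary symmetric function of \<open>u\<close>,
  which has the multidegree of \<open>u\<^sup>(\<^sup>n\<^sup>)\<close>.
\<close>

definition lyndon_gen :: "int \<Rightarrow> 'x multiset list \<Rightarrow> 'x word_sum" where
  "lyndon_gen l w = quasi_elem l (content w) (content_root w)"

definition gen_value :: "int \<Rightarrow> ('x \<Rightarrow> int) list \<Rightarrow> 'x multiset list \<Rightarrow> int" where
  "gen_value l cs v = ev l cs (lyndon_gen l v)"

definition total_degree :: "'x multiset list multiset \<Rightarrow> 'x multiset" where
  "total_degree Q = (\<Sum>v\<in>#Q. sum_list v)"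

lemma homog_gen:
  assumes "w \<noteq> []" "{#} \<notin> set w"
  shows "homog (sum_list w) (lyndon_gen l w)"
proof -
  have "{#} \<notin> set (content_root w)" using assms(2) content_root[of w] by (metis image_eqI list.set_map repeat_mset_empty)
  then have "content_root w \<in> words_of (sum_list (content_root w))" by (simp add: words_of_def)
  from homog_quasi_elem[OF this, of "content w" l] show ?thesis
    by (simp add: lyndon_gen_def content_root flip: sum_list_scale)
qed

text \<open>
  The terms for \<open>u\<^sup>(\<^sup>g\<^sup>)\<close> are the \<open>g\<close>-th powers of the terms for \<open>u\<close>, up to a common power of the
  weight, which is a sign for the weights \<open>1\<close> and \<open>-1\<close>.
\<close>

lemma summands_scale:
  assumes "l * l = 1"
  shows "summands l (map mon_eval cs) (map (repeat_mset g) w) =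
    map (\<lambda>x. l ^ ((g + 1) * length w) * x ^ g) (summands l (map mon_eval cs) w)"
proof (induction cs arbitrary: w)
  case Nil
  show ?case by (cases w) simp_all
next
  case (Cons c cs)
  show ?case
  proof (cases w)
    case w: (Cons a v)
    have l2: "l * (l ^ g * l ^ g) = l"
      using assms by (metis mult.assoc mult.right_neutral power_mult_distrib power_one)
    have "l * mon_eval c a ^ g * (l ^ ((g + 1) * length v) * x ^ g) =
        l ^ ((g + 1) * length w) * (l * mon_eval c a * x) ^ g" for x
    proof -
      have "l ^ ((g + 1) * length w) * (l * mon_eval c a * x) ^ g =
          (l * (l ^ g * l ^ g)) * l ^ ((g + 1) * length v) * mon_eval c a ^ g * x ^ g"
        by (simp add: w power_add power_mult_distrib mult_ac)
      then show ?thesis unfolding l2 by (simp add: mult_ac)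
    qed
    then show ?thesis
      using Cons.IH[of w] Cons.IH[of v] by (simp add: w mon_eval_repeat comp_def)
  qed simp
qed

context strict_total
begin

lemma lyndon_factors_multiset:
  assumes "\<And>v. v \<in># Q \<Longrightarrow> lyndon v"
  shows "\<exists>ws. lyndon_factors ws \<and> mset ws = Q"
proof -
  obtain xs where "mset xs = Q" using ex_mset by blast
  moreover from this have "lyndon_factors (words.sort xs)"
    using assms by (intro lyndon_factors_sort) auto
  ultimately show ?thesis by (intro exI[of _ "words.sort xs"]) simp
qed

end

context monomial_order
begin

lemma scale_iff: "k > 0 \<Longrightarrow> (repeat_mset k m, repeat_mset k m') \<in> R \<longleftrightarrow> (m, m') \<in> R"
proof
  assume k: "k > 0" and *: "(repeat_mset k m, repeat_mset k m') \<in> R"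
  show "(m, m') \<in> R"
  proof (rule ccontr)
    assume "(m, m') \<notin> R"
    then have "m = m' \<or> (m', m) \<in> R" using total_R unfolding total_on_def by blast
    then show False
    proof
      assume "(m', m) \<in> R"
      from transD[OF trans_R * scale[OF this k]] show False by simp
    qed (use * in simp)
  qed
qed (rule scale)

lemma lexord_scale:
  "k > 0 \<Longrightarrow> map (repeat_mset k) u \<prec> map (repeat_mset k) v \<longleftrightarrow> u \<prec> v"
proof (induction u arbitrary: v)
  case Nil
  then show ?case by (cases v) auto
next
  case (Cons a u)
  then show ?case by (cases v) (auto simp: scale_iff repeat_mset_inject)
qed

lemma lyndon_scale:
  assumes k: "k > 0" shows "lyndon (map (repeat_mset k) w) \<longleftrightarrow> lyndon w"
proof
  assume w: "lyndon (map (repeat_mset k) w)"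
  have "w \<prec> v" if "u \<noteq> []" "v \<noteq> []" "w = u @ v" for u v
    using lyndon_suffix[of "map (repeat_mset k) u" "map (repeat_mset k) v"] w that
      lexord_scale[OF k, of w v] by simp
  moreover have "w \<noteq> []" using w by (auto simp: lyndon_def)
  ultimately show "lyndon w" by (simp add: lyndon_def)
next
  assume w: "lyndon w"
  have "map (repeat_mset k) w \<prec> v" if uv: "u \<noteq> []" "v \<noteq> []" "map (repeat_mset k) w = u @ v" for u v
  proof -
    from uv(3) obtain u' v' where "w = u' @ v'" "u = map (repeat_mset k) u'" "v = map (repeat_mset k) v'"
      unfolding map_eq_append_conv by blast
    then show ?thesis using lyndon_suffix[of u' v'] w uv(1,2) lexord_scale[OF k, of w v'] by simp
  qed
  moreover have "w \<noteq> []" using w by (simp add: lyndon_def)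
  ultimately show "lyndon (map (repeat_mset k) w)" unfolding lyndon_def by blast
qed

definition lyndon_monomial_words :: "'x multiset list set" where
  "lyndon_monomial_words = {v. lyndon v \<and> {#} \<notin> set v}"

lemma primitive_root:
  assumes "v \<in> lyndon_monomial_words"
  obtains u g where "v = map (repeat_mset g) u" "g > 0" "content u = 1" "lyndon u" "{#} \<notin> set u"
proof -
  have v: "lyndon v" "{#} \<notin> set v" "v \<noteq> []" using assms by (auto simp: lyndon_monomial_words_def lyndon_def)
  let ?g = "content v" and ?u = "content_root v"
  have g: "?g > 0" using v content_pos by blast
  have "content (map (repeat_mset ?g) ?u) = ?g * content ?u" by (rule content_scale[OF g])
  then have "content ?u = 1" using g unfolding content_root by simp
  moreover have "lyndon ?u" using lyndon_scale[OF g, of ?u] v unfolding content_root by simp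
  moreover have "{#} \<notin> set ?u" using v(2) content_root[of v] by (metis image_eqI list.set_map repeat_mset_empty)
  ultimately show ?thesis using that[of ?g ?u] g content_root[of v] by simp
qed

lemma gen_scale: "content u = 1 \<Longrightarrow> k > 0 \<Longrightarrow> lyndon_gen l (map (repeat_mset k) u) = quasi_elem l k u"
  by (simp add: lyndon_gen_def content_root_scale)

text \<open>
  The functions of points that are integer polynomials in the values of the generators.
\<close>

definition generated :: "int \<Rightarrow> (('x \<Rightarrow> int) list \<Rightarrow> int) \<Rightarrow> bool" where
  "generated l \<phi> \<longleftrightarrow> (\<exists>c. (\<forall>Q\<in>supp c. set_mset Q \<subseteq> lyndon_monomial_words) \<and>
     (\<forall>cs. \<phi> cs = lin_ext (mon_eval (gen_value l cs)) c))"

lemma generated_const: "generated l (\<lambda>_. k)"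
  unfolding generated_def by (intro exI[of _ "frag_cmul k (frag_of {#})"]) (simp add: lin_ext_cmul)

lemma generated_gen: "v \<in> lyndon_monomial_words \<Longrightarrow> generated l (\<lambda>cs. ev l cs (lyndon_gen l v))"
  unfolding generated_def by (intro exI[of _ "frag_of {#v#}"]) (simp add: gen_value_def)

lemma generated_add:
  assumes "generated l \<phi>" "generated l \<psi>" shows "generated l (\<lambda>cs. \<phi> cs + \<psi> cs)"
proof -
  from assms obtain c d where
    c: "\<forall>Q\<in>supp c. set_mset Q \<subseteq> lyndon_monomial_words" "\<And>cs. \<phi> cs = lin_ext (mon_eval (gen_value l cs)) c" and
    d: "\<forall>Q\<in>supp d. set_mset Q \<subseteq> lyndon_monomial_words" "\<And>cs. \<psi> cs = lin_ext (mon_eval (gen_value l cs)) d"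
    unfolding generated_def by blast
  have "\<forall>Q\<in>supp (c + d). set_mset Q \<subseteq> lyndon_monomial_words"
    using Poly_Mapping.keys_add[of c d] c(1) d(1) by blast
  then show ?thesis unfolding generated_def by (intro exI[of _ "c + d"]) (simp add: lin_ext_add c d)
qed

lemma generated_mult:
  assumes "generated l \<phi>" "generated l \<psi>" shows "generated l (\<lambda>cs. \<phi> cs * \<psi> cs)"
proof -
  from assms obtain c d where
    c: "\<forall>Q\<in>supp c. set_mset Q \<subseteq> lyndon_monomial_words" "\<And>cs. \<phi> cs = lin_ext (mon_eval (gen_value l cs)) c" and
    d: "\<forall>Q\<in>supp d. set_mset Q \<subseteq> lyndon_monomial_words" "\<And>cs. \<psi> cs = lin_ext (mon_eval (gen_value l cs)) d"
    unfolding generated_def by blast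
  have "\<forall>Q\<in>supp (c * d). set_mset Q \<subseteq> lyndon_monomial_words"
    using Poly_Mapping.keys_mult[of c d] c(1) d(1) by fastforce
  then show ?thesis unfolding generated_def
    by (intro exI[of _ "c * d"]) (simp add: lin_ext_times mon_eval_add c d)
qed

lemma generated_sum:
  "(\<And>i. i \<in> I \<Longrightarrow> generated l (\<phi> i)) \<Longrightarrow> generated l (\<lambda>cs. \<Sum>i\<in>I. \<phi> i cs)"
  by (induction I rule: infinite_finite_induct) (auto intro: generated_const generated_add)

lemma generated_sym_fun:
  assumes "sym_fun F" "\<And>n. generated l (\<lambda>cs. elem_sym n (\<sigma> cs))"
  shows "generated l (\<lambda>cs. F (\<sigma> cs))"
  using assms(1) by induction (use assms(2) generated_const generated_add generated_mult in auto)

text \<open>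
  For \<open>v = u\<^sup>(\<^sup>g\<^sup>)\<close> the elementary symmetric functions of \<open>v\<close> are, up to sign, those of the \<open>g\<close>-th powers of
  the terms for \<open>u\<close>, hence integer polynomials in the elementary symmetric functions of \<open>u\<close>; these are
  generators.
\<close>

lemma generated_quasi_elem:
  assumes l: "l * l = 1" and v: "v \<in> lyndon_monomial_words"
  shows "generated l (\<lambda>cs. ev l cs (quasi_elem l r v))"
proof -
  obtain u g where u: "v = map (repeat_mset g) u" "g > 0" "content u = 1" "lyndon u" "{#} \<notin> set u"
    using primitive_root[OF v] .
  have e: "generated l (\<lambda>cs. elem_sym n (summands l (map mon_eval cs) u))" for n
  proof (cases "n = 0")
    case True
    then show ?thesis by (simp add: generated_const)
  next
    case False
    have "map (repeat_mset n) u \<in> lyndon_monomial_words"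
      using u False lyndon_scale by (auto simp: lyndon_monomial_words_def repeat_mset_eq_empty)
    from generated_gen[OF this] show ?thesis using False u(3) by (simp add: gen_scale ev_quasi_elem)
  qed
  have "ev l cs (quasi_elem l r v) = (l ^ ((g + 1) * length u)) ^ r *
      elem_sym r (map (\<lambda>x. x ^ g) (summands l (map mon_eval cs) u))" for cs
    unfolding ev_quasi_elem u(1) summands_scale[OF l]
    using elem_sym_scale[of r "l ^ ((g + 1) * length u)" "map (\<lambda>x. x ^ g) (summands l (map mon_eval cs) u)"]
    by (simp add: comp_def)
  moreover have "generated l (\<lambda>cs. (l ^ ((g + 1) * length u)) ^ r *
      elem_sym r (map (\<lambda>x. x ^ g) (summands l (map mon_eval cs) u)))"
    by (intro generated_mult generated_const
        generated_sym_fun[OF elem_sym_powers_symmetric[OF u(2)] e])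
  ultimately show ?thesis by simp
qed

text \<open>
  If \<open>v\<^sub>1 > v\<^sub>2 > \<dots>\<close> are the distinct Lyndon factors and \<open>r\<^sub>i\<close> their multiplicities, the product of the
  \<open>r\<^sub>i\<close>-th elementary symmetric functions of the \<open>v\<^sub>i\<close> leads with \<open>v\<^sub>1\<^bsup>r\<^sub>1\<^esup> v\<^sub>2\<^bsup>r\<^sub>2\<^esup> \<dots>\<close>.
\<close>

lemma generated_leader_factors:
  assumes l: "l * l = 1"
  shows "lyndon_factors ws \<Longrightarrow> \<forall>v\<in>set ws. {#} \<notin> set v \<Longrightarrow>
    \<exists>f. generated l (\<lambda>cs. ev l cs f) \<and> homog (sum_list (concat ws)) f \<and> leads f (concat ws)"
proof (induction "length ws" arbitrary: ws rule: less_induct)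
  case less
  have l0: "l \<noteq> 0" using l by auto
  show ?case
  proof (cases ws)
    case Nil
    show ?thesis
      by (intro exI[of _ "frag_of []"])
        (simp add: Nil generated_const homog_def words_of_def leads_frag_of)
  next
    case (Cons v vs)
    \<comment> \<open>the copies of the largest factor are treated together\<close>
    define us where "us = takeWhile (\<lambda>u. u = v) ws"
    define gs where "gs = dropWhile (\<lambda>u. u = v) ws"
    have ws: "ws = us @ gs" by (simp add: us_def gs_def)
    have us: "us = replicate (length us) v"
      by (rule replicate_eqI) (auto simp: us_def dest: set_takeWhileD)
    have ne: "us \<noteq> []" by (simp add: us_def Cons)
    have v: "lyndon v" "{#} \<notin> set v" using less.prems Cons by (auto simp: lyndon_factors_Cons)
    have gs: "lyndon_factors gs" using less.prems(1) unfolding ws lyndon_factors_append by blast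
    have le: "u \<preceq> v" if "u \<in> set gs" for u
      using less.prems(1) that us ne unfolding ws lyndon_factors_append by (cases us) auto
    have gt: "u \<prec> v" if "u \<in> set gs" for u
    proof (cases gs)
      case (Cons h hs)
      then have "h \<noteq> v" by (metis (full_types) gs_def hd_dropWhile list.discI list.sel(1))
      then have h: "h \<prec> v" using le[of h] Cons by simp
      have "u \<preceq> h" using gs that Cons by (auto simp: lyndon_factors_Cons)
      then show ?thesis using h word_less_trans[of u h v] by metis
    qed (use that in simp)
    have "length gs < length ws" using ws ne by (cases us) auto
    then obtain f where f: "generated l (\<lambda>cs. ev l cs f)" "homog (sum_list (concat gs)) f"
      "leads f (concat gs)"
      using less.hyps[of gs] gs less.prems(2) ws by auto
    let ?e = "quasi_elem l (length us) v"
    have "leads (quasi_shuffle l ?e f) (concat (replicate (length us) v) @ concat gs)"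
      by (rule leads_product[OF lyndon_factors_replicate[OF v(1)] gs _ leads_quasi_elem[OF l0 v(1)] f(3)])
        (use gt in auto)
    then have 1: "leads (quasi_shuffle l ?e f) (concat ws)" using ws us by simp
    have "generated l (\<lambda>cs. ev l cs ?e * ev l cs f)"
      by (intro generated_mult f generated_quasi_elem l) (use v in \<open>simp add: lyndon_monomial_words_def\<close>)
    then have 2: "generated l (\<lambda>cs. ev l cs (quasi_shuffle l ?e f))" by (simp add: ev_qsh)
    have "sum_list (concat (replicate k v)) = repeat_mset k (sum_list v)" for k
      by (induction k) auto
    then have "sum_list (concat ws) = repeat_mset (length us) (sum_list v) + sum_list (concat gs)"
      using ws us by (metis concat_append sum_list_append)
    then have 3: "homog (sum_list (concat ws)) (quasi_shuffle l ?e f)"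
      using homog_qsh[OF homog_quasi_elem f(2), of v "sum_list v"] v by (simp add: words_of_def)
    from 1 2 3 show ?thesis by blast
  qed
qed

lemma generated_frag_of:
  assumes l: "l * l = 1"
  shows "w \<in> words_of M \<Longrightarrow> generated l (\<lambda>cs. ev l cs (frag_of w))"
proof (induction "card {z \<in> words_of M. (z, w) \<in> lenlex R}" arbitrary: w rule: less_induct)
  case less
  obtain ws where ws: "lyndon_factors ws" "concat ws = w" using lyndon_factorization by blast
  have "\<forall>v\<in>set ws. {#} \<notin> set v" using less.prems ws(2) by (auto simp: words_of_def)
  from generated_leader_factors[OF l ws(1) this]
  obtain f where f: "generated l (\<lambda>cs. ev l cs f)" "homog M f" "leads f w"
    using less.prems unfolding ws(2) by (auto simp: words_of_def)
  have "generated l (\<lambda>cs. ev l cs (frag_of z))" if z: "z \<in> supp (f - frag_of w)" for z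
  proof (rule less.hyps)
    have zw: "z \<noteq> w" using z f(3) by (auto simp: leads_def in_keys_iff lookup_minus)
    then have "z \<in> supp f" using z by (auto simp: in_keys_iff lookup_minus)
    with f zw show zM: "z \<in> words_of M" by (auto simp: homog_def)
    have zl: "(z, w) \<in> lenlex R" using \<open>z \<in> supp f\<close> f(3) zw by (auto simp: leads_def)
    show "card {x \<in> words_of M. (x, z) \<in> lenlex R} < card {x \<in> words_of M. (x, w) \<in> lenlex R}"
    proof (rule psubset_card_mono)
      show "finite {x \<in> words_of M. (x, w) \<in> lenlex R}" 
        by (rule finite_subset[OF _ finite_words_of[of M]]) auto
      have "(x, w) \<in> lenlex R" if "(x, z) \<in> lenlex R" for x
        using lenlex_trans[OF that zl trans_R] .
      moreover have "z \<in> {x \<in> words_of M. (x, w) \<in> lenlex R} - {x \<in> words_of M. (x, z) \<in> lenlex R}"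
        using zM zl by simp
      ultimately show "{x \<in> words_of M. (x, z) \<in> lenlex R} \<subset> {x \<in> words_of M. (x, w) \<in> lenlex R}"
        by blast
    qed
  qed
  then have "generated l (\<lambda>cs. \<Sum>z\<in>supp (f - frag_of w).
      coeff (f - frag_of w) z * ev l cs (frag_of z))"
    by (intro generated_sum generated_mult generated_const)
  then have "generated l (\<lambda>cs. ev l cs (f - frag_of w))" by (simp add: lin_ext_def)
  then have "generated l (\<lambda>cs. ev l cs f + (-1) * ev l cs (f - frag_of w))"
    by (intro generated_add f generated_mult generated_const)
  then show ?case by (simp add: lin_ext_diff)
qed

lemma gen_product:
  assumes "set_mset Q \<subseteq> lyndon_monomial_words"
  shows "\<exists>f. homog (total_degree Q) f \<and> (\<forall>cs. ev l cs f = mon_eval (gen_value l cs) Q)"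
  using assms
proof (induction Q)
  case empty
  show ?case by (intro exI[of _ "frag_of []"]) (simp add: homog_def words_of_def total_degree_def)
next
  case (add v Q)
  then obtain f where f: "homog (total_degree Q) f" "\<And>cs. ev l cs f = mon_eval (gen_value l cs) Q" by auto
  have "homog (sum_list v) (lyndon_gen l v)"
    using add.prems by (intro homog_gen) (auto simp: lyndon_monomial_words_def lyndon_def)
  from homog_qsh[OF this f(1), of l]
  have "homog (total_degree (add_mset v Q)) (quasi_shuffle l (lyndon_gen l v) f)" by (simp add: total_degree_def)
  moreover have "ev l cs (quasi_shuffle l (lyndon_gen l v) f) = mon_eval (gen_value l cs) (add_mset v Q)" for cs
    by (simp add: ev_qsh f(2) gen_value_def mon_eval_def)
  ultimately show ?case by blast
qed

definition gen_prod :: "int \<Rightarrow> 'x multiset list multiset \<Rightarrow> 'x word_sum" where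
  "gen_prod l Q = (SOME f. homog (total_degree Q) f \<and> (\<forall>cs. ev l cs f = mon_eval (gen_value l cs) Q))"

lemma gen_prod:
  assumes "set_mset Q \<subseteq> lyndon_monomial_words"
  shows "homog (total_degree Q) (gen_prod l Q)" "ev l cs (gen_prod l Q) = mon_eval (gen_value l cs) Q"
  using someI_ex[OF gen_product[OF assms, of l]] unfolding gen_prod_def by auto

lemma ev_gen_prods:
  assumes "\<forall>Q\<in>supp c. set_mset Q \<subseteq> lyndon_monomial_words"
  shows "ev l cs (frag_extend (gen_prod l) c) = lin_ext (mon_eval (gen_value l cs)) c"
  unfolding lin_ext_frag_extend by (rule lin_ext_cong) (use assms gen_prod(2) in blast)

definition lyndon_multisets :: "'x multiset \<Rightarrow> 'x multiset list multiset set" where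
  "lyndon_multisets M = {Q. set_mset Q \<subseteq> lyndon_monomial_words \<and> total_degree Q = M}"

text \<open>
  A multiset of Lyndon words is recovered from the concatenation of its elements in non-increasing
  order, by the uniqueness of the factorization.
\<close>

lemma card_lyndon_multisets:
  "finite (lyndon_multisets M)" "card (lyndon_multisets M) \<le> card (words_of M)"
proof -
  have "\<exists>ws. lyndon_factors ws \<and> mset ws = Q" if "Q \<in> lyndon_multisets M" for Q
    using that by (intro lyndon_factors_multiset) (auto simp: lyndon_multisets_def lyndon_monomial_words_def)
  then obtain h where h: "\<And>Q. Q \<in> lyndon_multisets M \<Longrightarrow> lyndon_factors (h Q)"
    "\<And>Q. Q \<in> lyndon_multisets M \<Longrightarrow> mset (h Q) = Q" by metis
  have inj: "inj_on (\<lambda>Q. concat (h Q)) (lyndon_multisets M)"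
    by (rule inj_onI) (metis h lyndon_factors_unique)
  have sum_concat: "sum_list (concat ws) = total_degree (mset ws)" for ws :: "'x multiset list list"
    by (induction ws) (auto simp: total_degree_def)
  have sub: "(\<lambda>Q. concat (h Q)) ` lyndon_multisets M \<subseteq> words_of M"
  proof (rule image_subsetI)
    fix Q assume Q: "Q \<in> lyndon_multisets M"
    have "{#} \<notin> set v" if "v \<in> set (h Q)" for v
    proof -
      have "v \<in># Q" using that h(2)[OF Q] by (metis set_mset_mset)
      then show ?thesis using Q by (auto simp: lyndon_multisets_def lyndon_monomial_words_def)
    qed
    then show "concat (h Q) \<in> words_of M"
      using h(2)[OF Q] Q by (auto simp: words_of_def sum_concat lyndon_multisets_def)
  qed
  show "finite (lyndon_multisets M)" using inj_on_finite[OF inj sub finite_words_of] .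
  show "card (lyndon_multisets M) \<le> card (words_of M)" by (rule card_inj_on_le[OF inj sub finite_words_of])
qed

lemma lookup_gen_prod_degree:
  assumes "set_mset Q \<subseteq> lyndon_monomial_words" "z \<in> words_of M" "total_degree Q \<noteq> M"
  shows "coeff (gen_prod l Q) z = 0"
  using gen_prod(1)[OF assms(1), of l] assms(2,3)
  by (auto simp: homog_def words_of_def in_keys_iff)

lemma lookup_gen_prods:
  assumes c: "\<forall>Q\<in>supp c. set_mset Q \<subseteq> lyndon_monomial_words" and z: "z \<in> words_of M"
  shows "coeff (frag_extend (gen_prod l) c) z =
    (\<Sum>Q\<in>lyndon_multisets M. coeff c Q * coeff (gen_prod l Q) z)"
proof -
  have "coeff (frag_extend (gen_prod l) c) z =
      (\<Sum>Q\<in>supp c \<union> lyndon_multisets M.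
         coeff c Q * coeff (gen_prod l Q) z)"
    unfolding lookup_frag_extend by (rule lin_ext_superset) (simp_all add: card_lyndon_multisets)
  also have "\<dots> = (\<Sum>Q\<in>lyndon_multisets M. coeff c Q * coeff (gen_prod l Q) z)"
  proof (rule sum.mono_neutral_right)
    show "\<forall>Q\<in>supp c \<union> lyndon_multisets M - lyndon_multisets M.
        coeff c Q * coeff (gen_prod l Q) z = 0"
    proof
      fix Q assume "Q \<in> supp c \<union> lyndon_multisets M - lyndon_multisets M"
      then have "set_mset Q \<subseteq> lyndon_monomial_words" "total_degree Q \<noteq> M"
        using c by (auto simp: lyndon_multisets_def)
      from lookup_gen_prod_degree[OF this(1) z this(2)]
      show "coeff c Q * coeff (gen_prod l Q) z = 0" by simp
    qed
  qed (simp_all add: card_lyndon_multisets)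
  finally show ?thesis .
qed

lemma frag_of_gen_prods:
  assumes l: "l * l = 1" and w: "w \<in> words_of M"
  obtains c where "\<forall>Q\<in>supp c. Q \<in> lyndon_multisets M" "frag_of w = frag_extend (gen_prod l) c"
proof -
  have l0: "l \<noteq> 0" using l by auto
  from generated_frag_of[OF l w] obtain c where
    c: "\<forall>Q\<in>supp c. set_mset Q \<subseteq> lyndon_monomial_words"
      "\<And>cs. ev l cs (frag_of w) = lin_ext (mon_eval (gen_value l cs)) c"
    unfolding generated_def by blast
  have fw: "frag_of w = frag_extend (gen_prod l) c"
    by (rule ev_eqI[OF l0]) (simp only: c(2) ev_gen_prods[OF c(1)])
  \<comment> \<open>discard the monomials of other multidegrees; they cannot contribute to w\<close>
  define d where "d = frag_extend (\<lambda>Q. if total_degree Q = M then frag_of Q else 0) c"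
  have d: "coeff d Q = (if total_degree Q = M then coeff c Q else 0)" for Q
  proof -
    have "coeff d Q = lin_ext (\<lambda>j. (if total_degree Q = M then 1 else 0) * (if j = Q then 1 else 0)) c"
      unfolding d_def lookup_frag_extend by (rule lin_ext_cong) auto
    then show ?thesis unfolding lin_ext_mult_left by (simp flip: lookup_eq_lin)
  qed
  have keys: "\<forall>Q\<in>supp d. Q \<in> lyndon_multisets M"
    using c(1) by (auto simp: in_keys_iff d lyndon_multisets_def split: if_splits)
  have "frag_of w = frag_extend (gen_prod l) d"
  proof (rule poly_mapping_eqI)
    fix z
    show "coeff (frag_of w) z = coeff (frag_extend (gen_prod l) d) z"
    proof (cases "z \<in> words_of M")
      case True
      have dk: "\<forall>Q\<in>supp d. set_mset Q \<subseteq> lyndon_monomial_words"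
        using keys by (auto simp: lyndon_multisets_def)
      show ?thesis
        unfolding fw lookup_gen_prods[OF c(1) True] lookup_gen_prods[OF dk True]
        by (intro sum.cong) (auto simp: d lyndon_multisets_def)
    next
      case False
      have "coeff (frag_extend (gen_prod l) d) z = lin_ext (\<lambda>_. 0) d"
        unfolding lookup_frag_extend
      proof (rule lin_ext_cong)
        fix Q assume "Q \<in> supp d"
        then have "homog M (gen_prod l Q)" using keys gen_prod(1) by (auto simp: lyndon_multisets_def)
        then show "coeff (gen_prod l Q) z = 0"
          using False by (auto simp: homog_def in_keys_iff)
      qed
      then show ?thesis using w False by auto
    qed
  qed
  with keys show ?thesis by (rule that)
qed

text \<open>
  In each multidegree the monomials in the generators span the words, and they are at most as
  many.
\<close>

theorem gens_independent:
  assumes l: "l * l = 1" and c: "\<forall>Q\<in>supp c. set_mset Q \<subseteq> lyndon_monomial_words"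
    and zero: "\<And>cs. lin_ext (mon_eval (gen_value l cs)) c = 0"
  shows "c = 0"
proof -
  have l0: "l \<noteq> 0" using l by auto
  have "frag_extend (gen_prod l) c = 0"
    by (rule ev_eqI[OF l0]) (simp only: zero ev_gen_prods[OF c] lin_ext_0)
  have "coeff c Q = 0" for Q
  proof (rule ccontr)
    assume Q: "coeff c Q \<noteq> 0"
    define M where "M = total_degree Q"
    have QM: "Q \<in> lyndon_multisets M"
      using Q c by (auto simp: lyndon_multisets_def M_def in_keys_iff)
    have "\<exists>s. (\<forall>P\<in>supp s. P \<in> lyndon_multisets M) \<and> frag_of w = frag_extend (gen_prod l) s"
      if "w \<in> words_of M" for w
      by (rule frag_of_gen_prods[OF l that]) blast
    then obtain s where s: "\<And>w. w \<in> words_of M \<Longrightarrow> \<forall>P\<in>supp (s w). P \<in> lyndon_multisets M"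
      "\<And>w. w \<in> words_of M \<Longrightarrow> frag_of w = frag_extend (gen_prod l) (s w)" by metis
    have "coeff c Q = 0"
    proof (rule spanning_independent[where J = "lyndon_multisets M" and W = "words_of M"
          and y = "\<lambda>Q z. coeff (gen_prod l Q) z" and s = "\<lambda>w. coeff (s w)"
          and c = "coeff c"])
      fix w z assume wz: "w \<in> words_of M" "z \<in> words_of M"
      have "\<forall>P\<in>supp (s w). set_mset P \<subseteq> lyndon_monomial_words"
        using s(1)[OF wz(1)] by (auto simp: lyndon_multisets_def)
      from lookup_gen_prods[OF this wz(2), of l]
      show "(\<Sum>Q\<in>lyndon_multisets M. coeff (s w) Q * coeff (gen_prod l Q) z) =
          (if w = z then 1 else 0)"
        using s(2)[OF wz(1)] by (metis lookup_frag_of)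
    next
      fix z assume z: "z \<in> words_of M"
      from lookup_gen_prods[OF c z, of l]
      show "(\<Sum>Q\<in>lyndon_multisets M. coeff c Q * coeff (gen_prod l Q) z) = 0"
        using \<open>frag_extend (gen_prod l) c = 0\<close> by simp
    qed (rule card_lyndon_multisets finite_words_of QM)+
    with Q show False by simp
  qed
  then show ?thesis by (intro poly_mapping_eqI) simp
qed

theorem gens_span:
  assumes l: "l * l = 1" and w: "w \<in> words_of M"
  obtains c where "\<forall>Q\<in>supp c. Q \<in> lyndon_multisets M"
    "\<And>cs. ev l cs (frag_of w) = lin_ext (mon_eval (gen_value l cs)) c"
proof (rule frag_of_gen_prods[OF l w])
  fix c assume c: "\<forall>Q\<in>supp c. Q \<in> lyndon_multisets M" "frag_of w = frag_extend (gen_prod l) c"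
  have "\<forall>Q\<in>supp c. set_mset Q \<subseteq> lyndon_monomial_words"
    using c(1) by (auto simp: lyndon_multisets_def)
  with c show thesis by (intro that[of c]) (simp_all only: ev_gen_prods)
qed

end

section \<open>The degree-lexicographic order on monomials\<close>

lemma lexord_cong_on:
  "set u \<subseteq> A \<Longrightarrow> set v \<subseteq> A \<Longrightarrow> (\<And>a b. a \<in> A \<Longrightarrow> b \<in> A \<Longrightarrow> (a, b) \<in> r \<longleftrightarrow> (a, b) \<in> r') \<Longrightarrow>
    (u, v) \<in> lexord r \<longleftrightarrow> (u, v) \<in> lexord r'"
proof (induction u arbitrary: v)
  case Nil
  then show ?case by (cases v) auto
next
  case (Cons a u)
  then show ?case by (cases v) auto
qed

abbreviation sorted_by :: "('x \<times> 'x) set \<Rightarrow> 'x list \<Rightarrow> bool" where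
  "sorted_by r \<equiv> sorted_wrt (\<lambda>x y. (x, y) \<in> r\<^sup>=)"

lemma monomial_less_cong_on:
  assumes "set_mset m \<subseteq> X" "set_mset m' \<subseteq> X"
    and r: "\<And>a b. a \<in> X \<Longrightarrow> b \<in> X \<Longrightarrow> (a, b) \<in> r \<longleftrightarrow> (a, b) \<in> r'"
  shows "(m, m') \<in> monomial_less r \<longleftrightarrow> (m, m') \<in> monomial_less r'"
proof -
  have "(m, m') \<in> monomial_less r'"
    if "(m, m') \<in> monomial_less r" and r: "\<And>a b. a \<in> X \<Longrightarrow> b \<in> X \<Longrightarrow> (a, b) \<in> r \<longleftrightarrow> (a, b) \<in> r'"
    for r r'
  proof -
    from that(1) obtain xs ys where m: "m = mset xs" "m' = mset ys" and s: "sorted_by r xs" "sorted_by r ys"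
      and l: "(xs, ys) \<in> lenlex r" unfolding monomial_less_def by blast
    have sub: "set xs \<subseteq> X" "set ys \<subseteq> X" using assms m by auto
    have "sorted_by r' xs"
      by (rule sorted_wrt_mono_rel[OF _ s(1)]) (use sub r in blast)
    moreover have "sorted_by r' ys"
      by (rule sorted_wrt_mono_rel[OF _ s(2)]) (use sub r in blast)
    moreover have "(xs, ys) \<in> lenlex r'"
      using l lexord_cong_on[OF sub r] by (auto simp: lenlex_conv lexord_lex)
    ultimately show ?thesis using m unfolding monomial_less_def by blast
  qed
  then show ?thesis using r by blast
qed

lemma (in strict_total) sorted_by_unique:
  assumes "sorted_by R xs" "sorted_by R ys" "mset xs = mset ys"
  shows "xs = ys"
proof -
  interpret L: linorder "\<lambda>x y. (x, y) \<in> R\<^sup>=" "\<lambda>x y. (x, y) \<in> R"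
    using trans_R irrefl_R total_R
    by unfold_locales (unfold trans_def irrefl_def total_on_def, blast+)
  from L.properties_for_sort[OF assms(3,1)] L.properties_for_sort[OF refl assms(2)]
  show ?thesis by (rule trans[OF sym])
qed

lemma (in strict_total) sorted_by_exists: "\<exists>xs. sorted_by R xs \<and> mset xs = m"
proof -
  interpret L: linorder "\<lambda>x y. (x, y) \<in> R\<^sup>=" "\<lambda>x y. (x, y) \<in> R"
    using trans_R irrefl_R total_R
    by unfold_locales (unfold trans_def irrefl_def total_on_def, blast+)
  obtain xs where xs: "mset xs = m" using ex_mset by blast
  show ?thesis using L.sorted_sort[of xs] L.mset_sort[of "\<lambda>x. x" xs] xs by blast
qed

lemma sorted_by_repeat:
  "sorted_by r xs \<Longrightarrow> sorted_by r (concat (map (replicate k) xs))"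
proof (induction xs)
  case (Cons x xs)
  have "sorted_by r (replicate k x)" by (induction k) auto
  with Cons show ?case by (auto simp: sorted_wrt_append)
qed simp

lemma mset_concat_replicate: "mset (concat (map (replicate k) xs)) = repeat_mset k (mset xs)"
  by (induction xs) auto

lemma lenlex_repeat:
  assumes "(xs, ys) \<in> lenlex r" "k > 0"
  shows "(concat (map (replicate k) xs), concat (map (replicate k) ys)) \<in> lenlex r"
proof -
  have len: "length (concat (map (replicate k) zs)) = k * length zs" for zs :: "'a list"
    by (induction zs) auto
  from assms(1) consider "length xs < length ys" |
    p x y s t where "length xs = length ys" "(x, y) \<in> r" "xs = p @ x # s" "ys = p @ y # t"
    unfolding lenlex_conv lex_conv by auto
  then show ?thesis
  proof cases
    case 1
    then show ?thesis using assms(2) by (simp add: lenlex_conv len)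
  next
    case 2
    obtain j where k: "k = Suc j" using assms(2) by (cases k) auto
    have "(concat (map (replicate k) xs), concat (map (replicate k) ys)) \<in> lexord r"
      using lexord_append_left_rightI[OF 2(2)] by (simp add: 2(3,4) k)
    then have "(concat (map (replicate k) xs), concat (map (replicate k) ys)) \<in> lex r"
      using 2(1) by (simp add: lexord_lex len)
    then show ?thesis using 2(1) by (simp add: lenlex_conv len)
  qed
qed

lemma (in strict_total) monomial_order_monomial_less: "monomial_order (monomial_less R)"
proof
  show "trans (monomial_less R)"
  proof (rule transI)
    fix a b c assume "(a, b) \<in> monomial_less R" "(b, c) \<in> monomial_less R"
    then obtain xs ys ys' zs where 1: "a = mset xs" "b = mset ys" "b = mset ys'" "c = mset zs"
      "sorted_by R xs" "sorted_by R ys" "sorted_by R ys'" "sorted_by R zs"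
      "(xs, ys) \<in> lenlex R" "(ys', zs) \<in> lenlex R"
      unfolding monomial_less_def by blast
    then have "ys' = ys" using sorted_by_unique[of ys' ys] by simp
    then have "(xs, zs) \<in> lenlex R" using 1 lenlex_trans[OF _ _ trans_R] by blast
    then show "(a, c) \<in> monomial_less R" using 1 unfolding monomial_less_def by blast
  qed
  show "irrefl (monomial_less R)"
  proof (rule irreflI)
    fix a show "(a, a) \<notin> monomial_less R"
    proof
      assume "(a, a) \<in> monomial_less R"
      then obtain xs ys where 1: "a = mset xs" "a = mset ys"
        "sorted_by R xs" "sorted_by R ys" "(xs, ys) \<in> lenlex R"
        unfolding monomial_less_def by blast
      then have "xs = ys" using sorted_by_unique[of xs ys] by simp
      with 1 show False by simp
    qed
  qed
  show "total (monomial_less R)"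
    unfolding total_on_def
  proof (intro ballI impI)
    fix a b :: "'a multiset" assume "a \<noteq> b"
    obtain xs ys where 1: "a = mset xs" "b = mset ys" "sorted_by R xs" "sorted_by R ys"
      using sorted_by_exists[of a] sorted_by_exists[of b] by blast
    then have "xs \<noteq> ys" using \<open>a \<noteq> b\<close> by blast
    then have "(xs, ys) \<in> lenlex R \<or> (ys, xs) \<in> lenlex R"
      using total_lenlex[OF total_R] unfolding total_on_def by blast
    then show "(a, b) \<in> monomial_less R \<or> (b, a) \<in> monomial_less R"
      using 1 unfolding monomial_less_def by blast
  qed
  fix m m' :: "'a multiset" and k :: nat
  assume "(m, m') \<in> monomial_less R" and k: "k > 0"
  then obtain xs ys where 1: "m = mset xs" "m' = mset ys"
    "sorted_by R xs" "sorted_by R ys" "(xs, ys) \<in> lenlex R"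
    unfolding monomial_less_def by blast
  have "(mset (concat (map (replicate k) xs)), mset (concat (map (replicate k) ys))) \<in> monomial_less R"
    using sorted_by_repeat[OF 1(3)] sorted_by_repeat[OF 1(4)] lenlex_repeat[OF 1(5) k]
    unfolding monomial_less_def by blast
  then show "(repeat_mset k m, repeat_mset k m') \<in> monomial_less R"
    unfolding 1 mset_concat_replicate .
qed

text \<open>
  The variables outside \<open>X\<close> are placed above those in \<open>X\<close> and ordered by some well-order.
\<close>

lemma strict_total_extension:
  fixes r :: "('x \<times> 'x) set"
  shows "\<exists>r'. strict_total r' \<and>
    (strict_linear_order_on X r \<longrightarrow> (\<forall>a\<in>X. \<forall>b\<in>X. (a, b) \<in> r \<longleftrightarrow> (a, b) \<in> r'))"
proof -
  obtain W :: "('x \<times> 'x) set" where "well_order_on UNIV W" using well_order_on by blast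
  then have W: "trans W" "antisym W" "total W"
    by (auto simp: well_order_on_def linear_order_on_def partial_order_on_def preorder_on_def)
  have s: "strict_total (W - Id)"
  proof
    show "trans (W - Id)" using W(1,2) by (rule trans_diff_Id)
    show "irrefl (W - Id)" by (simp add: irrefl_def)
    show "total (W - Id)" using W(3) by (simp add: total_on_diff_Id)
  qed
  show ?thesis
  proof (cases "strict_linear_order_on X r")
    case False
    then show ?thesis using s by blast
  next
    case True
    then have r: "trans r" "irrefl r" "total_on X r" by (auto simp: strict_linear_order_on_def)
    define r' where "r' = {(x, y). (x \<in> X \<and> y \<in> X \<and> (x, y) \<in> r) \<or> (x \<in> X \<and> y \<notin> X) \<or>
      (x \<notin> X \<and> y \<notin> X \<and> (x, y) \<in> W - Id)}"
    have sW: "trans (W - Id)" "irrefl (W - Id)" "total (W - Id)"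
      using s unfolding strict_total_def by blast+
    have "strict_total r'"
    proof
      show "trans r'"
        using r(1) sW(1) unfolding trans_def r'_def by blast
      show "irrefl r'"
        using r(2) sW(2) unfolding irrefl_def r'_def by blast
      show "total r'"
        using r(3) sW(3) unfolding total_on_def r'_def by blast
    qed
    moreover have "\<forall>a\<in>X. \<forall>b\<in>X. (a, b) \<in> r \<longleftrightarrow> (a, b) \<in> r'" by (simp add: r'_def)
    ultimately show ?thesis by blast
  qed
qed

lemma set_mset_sum_list: "set_mset (sum_list w) = (\<Union>m\<in>set w. set_mset m)"
  by (induction w) auto

lemma lyndon_words_eq:
  assumes st: "strict_total r'"
    and r: "\<And>a b. a \<in> X \<Longrightarrow> b \<in> X \<Longrightarrow> (a, b) \<in> r \<longleftrightarrow> (a, b) \<in> r'"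
  shows "lyndon_words X r = {v \<in> monomial_order.lyndon_monomial_words (monomial_less r').
    set_mset (sum_list v) \<subseteq> X}"
proof -
  interpret strict_total r' by (rule st)
  interpret M: monomial_order "monomial_less r'" by (rule monomial_order_monomial_less)
  have "(w, v) \<in> lexord (monomial_less r) \<longleftrightarrow> (w, v) \<in> lexord (monomial_less r')"
    if "set w \<subseteq> {m. set_mset m \<subseteq> X}" "set v \<subseteq> {m. set_mset m \<subseteq> X}" for v w
    by (rule lexord_cong_on[OF that]) (use monomial_less_cong_on[OF _ _ r] in blast)
  then have lex: "(w, v) \<in> lexord (monomial_less r) \<longleftrightarrow> (w, v) \<in> lexord (monomial_less r')"
    if "set w \<subseteq> {m. set_mset m \<subseteq> X}" "w = u @ v" for u v w
    using that by simp
  show ?thesis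
  proof (rule Set.set_eqI)
    fix w :: "'a multiset list"
    have "set w \<subseteq> free_abelian_semigroup X \<longleftrightarrow> {#} \<notin> set w \<and> set w \<subseteq> {m. set_mset m \<subseteq> X}"
      unfolding free_abelian_semigroup_def by blast
    moreover have "set_mset (sum_list w) \<subseteq> X \<longleftrightarrow> set w \<subseteq> {m. set_mset m \<subseteq> X}"
      unfolding set_mset_sum_list by blast
    moreover have "(\<forall>u v. u \<noteq> [] \<and> v \<noteq> [] \<and> w = u @ v \<longrightarrow> (w, v) \<in> lexord (monomial_less r)) \<longleftrightarrow>
        (\<forall>u v. u \<noteq> [] \<and> v \<noteq> [] \<and> w = u @ v \<longrightarrow> (w, v) \<in> lexord (monomial_less r'))"
      if w: "set w \<subseteq> {m. set_mset m \<subseteq> X}"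
    proof (intro all_cong1 imp_cong refl)
      fix u v assume "u \<noteq> [] \<and> v \<noteq> [] \<and> w = u @ v"
      then show "(w, v) \<in> lexord (monomial_less r) \<longleftrightarrow> (w, v) \<in> lexord (monomial_less r')"
        using lex[OF w, of u v] by blast
    qed
    ultimately show "w \<in> lyndon_words X r \<longleftrightarrow>
        w \<in> {v \<in> M.lyndon_monomial_words. set_mset (sum_list v) \<subseteq> X}"
      unfolding lyndon_words_def M.lyndon_monomial_words_def M.lyndon_def mem_Collect_eq by argo
  qed
qed

section \<open>The Rota-Baxter algebra as a ring of functions\<close>

definition letter_eval :: "('x \<Rightarrow> int) \<Rightarrow> ('x multiset \<Rightarrow>\<^sub>0 int) \<Rightarrow> int" where
  "letter_eval c p = lin_ext (mon_eval c) p"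

lemma letter_eval_mult: "letter_eval c (p * q) = letter_eval c p * letter_eval c q"
  unfolding letter_eval_def by (rule lin_ext_times) (rule mon_eval_add)

lemma letter_eval_add: "letter_eval c (p + q) = letter_eval c p + letter_eval c q"
  by (simp add: letter_eval_def lin_ext_add)

lemma letter_eval_one [simp]: "letter_eval c 1 = 1"
  by (simp add: letter_eval_def)

lemma letter_eval_frag_of [simp]: "letter_eval c (frag_of m) = mon_eval c m"
  by (simp add: letter_eval_def del: single_one)

type_synonym 'x poly_words = "('x multiset \<Rightarrow>\<^sub>0 int) list \<Rightarrow>\<^sub>0 int"
type_synonym 'x tensor_coset = "'x poly_words set"
type_synonym 'x point = "('x \<Rightarrow> int) \<times> ('x \<Rightarrow> int) list"

text \<open>
  The left tensor factor \<open>A\<close> is evaluated at a point of its own.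
\<close>

definition word_eval :: "int \<Rightarrow> 'x point \<Rightarrow> ('x multiset \<Rightarrow>\<^sub>0 int) list \<Rightarrow> int" where
  "word_eval l pt ws = letter_eval (fst pt) (hd ws) * quasi_eval l (map letter_eval (snd pt)) (tl ws)"

abbreviation sha_eval :: "int \<Rightarrow> 'x point \<Rightarrow> 'x poly_words \<Rightarrow> int" where
  "sha_eval l pt \<equiv> lin_ext (word_eval l pt)"

lemma int_poly_ring_simps [simp]:
  "carrier (int_poly_ring V) = {p. \<forall>m \<in> supp p. set_mset m \<subseteq> V}"
  "p \<otimes>\<^bsub>int_poly_ring V\<^esub> q = p * q" "p \<oplus>\<^bsub>int_poly_ring V\<^esub> q = p + q"
  "\<one>\<^bsub>int_poly_ring V\<^esub> = 1" "\<zero>\<^bsub>int_poly_ring V\<^esub> = 0"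
  by (simp_all add: int_poly_ring_def)

lemma sha_free_simps [simp]:
  "carrier (sha_free l A) = {p. supp p \<subseteq> sha_words A}"
  "P \<otimes>\<^bsub>sha_free l A\<^esub> Q = frag_bilinear (sha_word_mult l A) P Q"
  "P \<oplus>\<^bsub>sha_free l A\<^esub> Q = P + Q"
  "\<one>\<^bsub>sha_free l A\<^esub> = frag_of [\<one>\<^bsub>A\<^esub>]" "\<zero>\<^bsub>sha_free l A\<^esub> = 0"
  by (simp_all add: sha_free_def frag_bilinear_def)

lemma sha_eval_mult:
  "sha_eval l pt (P \<otimes>\<^bsub>sha_free l (int_poly_ring X)\<^esub> Q) = sha_eval l pt P * sha_eval l pt Q"
proof -
  have "sha_eval l pt (sha_word_mult l (int_poly_ring X) u v) = word_eval l pt u * word_eval l pt v" for u v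
  proof -
    have "lin_ext (quasi_eval l (map letter_eval (snd pt))) (mixable_shuffle l (int_poly_ring X) (tl u) (tl v)) =
        quasi_eval l (map letter_eval (snd pt)) (tl u) * quasi_eval l (map letter_eval (snd pt)) (tl v)"
      by (rule quasi_eval_mixable_shuffle) (auto simp: letter_eval_mult)
    then show ?thesis
      by (simp add: sha_word_mult_def lin_ext_prefix_letter word_eval_def lin_ext_mult_left letter_eval_mult)
  qed
  then show ?thesis by (simp add: lin_ext_frag_bilinear)
qed

lemma quasi_eval_additive:
  assumes "\<And>c a b. c \<in> set cs \<Longrightarrow> c (a + b) = c a + c b"
  shows "quasi_eval l cs (u @ [a + b] @ v) = quasi_eval l cs (u @ [a] @ v) + quasi_eval l cs (u @ [b] @ v)"
  using assms
proof (induction cs arbitrary: u)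
  case Nil
  then show ?case by (cases u) auto
next
  case (Cons c cs)
  have IH: "quasi_eval l cs (u @ [a + b] @ v) = quasi_eval l cs (u @ [a] @ v) + quasi_eval l cs (u @ [b] @ v)" for u
    by (rule Cons.IH) (use Cons.prems in simp)
  show ?case
  proof (cases u)
    case Nil
    have "c (a + b) = c a + c b" using Cons.prems by simp
    then show ?thesis using IH[of "[]"] Nil by (simp add: algebra_simps)
  next
    case (Cons d w)
    then show ?thesis using IH[of w] IH[of "d # w"] by (simp add: algebra_simps)
  qed
qed

lemma word_eval_additive:
  "word_eval l pt (u @ [a + b] @ v) = word_eval l pt (u @ [a] @ v) + word_eval l pt (u @ [b] @ v)"
proof (cases u)
  case Nil
  then show ?thesis by (simp add: word_eval_def letter_eval_add algebra_simps)
next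
  case (Cons d w)
  have "quasi_eval l (map letter_eval (snd pt)) (w @ [a + b] @ v) =
      quasi_eval l (map letter_eval (snd pt)) (w @ [a] @ v) + quasi_eval l (map letter_eval (snd pt)) (w @ [b] @ v)"
    by (rule quasi_eval_additive) (auto simp: letter_eval_add)
  then show ?thesis using Cons by (simp add: word_eval_def algebra_simps)
qed

text \<open>
  Generated subgroups are defined through the inverse of the additive monoid.
\<close>

lemma add_monoid_sha_free:
  "comm_group (add_monoid (sha_free l A))"
  "P \<in> carrier (sha_free l A) \<Longrightarrow> inv\<^bsub>add_monoid (sha_free l A)\<^esub> P = - P"
proof -
  show g: "comm_group (add_monoid (sha_free l A))"
  proof (rule comm_groupI)
    fix P Q assume "P \<in> carrier (add_monoid (sha_free l A))" "Q \<in> carrier (add_monoid (sha_free l A))"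
    then show "P \<otimes>\<^bsub>add_monoid (sha_free l A)\<^esub> Q \<in> carrier (add_monoid (sha_free l A))"
      using Poly_Mapping.keys_add[of P Q] by auto
  next
    fix P assume "P \<in> carrier (add_monoid (sha_free l A))"
    then show "\<exists>Q\<in>carrier (add_monoid (sha_free l A)).
        Q \<otimes>\<^bsub>add_monoid (sha_free l A)\<^esub> P = \<one>\<^bsub>add_monoid (sha_free l A)\<^esub>"
      by (intro bexI[of _ "- P"]) auto
  qed (auto simp: ac_simps)
  then interpret comm_group "add_monoid (sha_free l A)" .
  show "inv\<^bsub>add_monoid (sha_free l A)\<^esub> P = - P" if "P \<in> carrier (sha_free l A)"
    by (rule inv_equality) (use that in auto)
qed

definition monomial_frag :: "'x word_sum \<Rightarrow> 'x poly_words" where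
  "monomial_frag = frag_extend (\<lambda>ws. frag_of (map frag_of ws))"

definition tensor_eval :: "int \<Rightarrow> 'x point \<Rightarrow> 'x multiset list \<Rightarrow> int" where
  "tensor_eval l pt ws = mon_eval (fst pt) (hd ws) * quasi_eval l (map mon_eval (snd pt)) (tl ws)"

lemma quasi_eval_map: "quasi_eval l cs (map f w) = quasi_eval l (map (\<lambda>c. c \<circ> f) cs) w"
proof (induction cs arbitrary: w)
  case Nil
  show ?case by (cases w) auto
next
  case (Cons c cs)
  show ?case using Cons[of w] Cons[of "tl w"] by (cases w) auto
qed

abbreviation tensor_value :: "int \<Rightarrow> 'x point \<Rightarrow> 'x word_sum \<Rightarrow> int" where
  "tensor_value l pt \<equiv> lin_ext (tensor_eval l pt)"

text \<open>
  Distinct first letters are separated by the independence of monomials, and the tails by the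
  injectivity for the mixable shuffle algebra.
\<close>

lemma tensor_eval_injective:
  assumes l: "l \<noteq> 0" and ne: "[] \<notin> supp g"
    and zero: "\<And>pt. tensor_value l pt g = 0"
  shows "g = 0"
proof -
  have ev: "ev l cs (residual a g) = 0" if "a \<in> hd ` supp g" for cs a
  proof (rule mon_eval_independent[OF _ _ that])
    fix c
    have "tensor_value l (c, cs) g = 0" by (rule zero)
    then show "(\<Sum>a\<in>hd ` supp g. mon_eval c a * ev l cs (residual a g)) = 0"
      using ne by (subst (asm) lin_ext_heads) (simp add: tensor_eval_def lin_ext_mult_left in_keys_iff)
  qed simp
  have "residual a g = 0" for a
  proof (cases "a \<in> hd ` supp g")
    case True
    show ?thesis by (rule quasi_eval_injective[OF l ev[OF True]])
  next
    case False
    then show ?thesis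
      by (intro poly_mapping_eqI) (force simp: lookup_residual in_keys_iff image_iff)
  qed
  then have "coeff g (a # w) = 0" for a w by (metis lookup_residual lookup_zero)
  moreover have "coeff g [] = 0" using ne by (simp add: in_keys_iff)
  ultimately show ?thesis
    by (intro poly_mapping_eqI) (metis list.exhaust lookup_zero)
qed

context
  fixes l :: int and X :: "'x set"
begin

abbreviation (input) "A \<equiv> int_poly_ring X"
abbreviation (input) "F \<equiv> sha_free l A"
abbreviation (input) "I \<equiv> tensor_relations l A"

lemma relation_generators_carrier:
  "{frag_of (u @ [a \<oplus>\<^bsub>A\<^esub> b] @ v) - frag_of (u @ [a] @ v) - frag_of (u @ [b] @ v) | u v a b.
        set u \<subseteq> carrier A \<and> set v \<subseteq> carrier A \<and> a \<in> carrier A \<and> b \<in> carrier A} \<subseteq> carrier (add_monoid F)"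
proof
  fix P
  assume "P \<in> {frag_of (u @ [a \<oplus>\<^bsub>A\<^esub> b] @ v) - frag_of (u @ [a] @ v) - frag_of (u @ [b] @ v) | u v a b.
        set u \<subseteq> carrier A \<and> set v \<subseteq> carrier A \<and> a \<in> carrier A \<and> b \<in> carrier A}"
  then obtain u v a b where
    P: "P = frag_of (u @ [a \<oplus>\<^bsub>A\<^esub> b] @ v) - frag_of (u @ [a] @ v) - frag_of (u @ [b] @ v)"
    and uv: "set u \<subseteq> carrier A" "set v \<subseteq> carrier A" "a \<in> carrier A" "b \<in> carrier A" by blast
  have "a \<oplus>\<^bsub>A\<^esub> b \<in> carrier A"
    using uv(3,4) Poly_Mapping.keys_add[of a b] by auto
  then have "{u @ [a \<oplus>\<^bsub>A\<^esub> b] @ v, u @ [a] @ v, u @ [b] @ v} \<subseteq> sha_words A"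
    using uv by (simp add: sha_words_def del: int_poly_ring_simps)
  moreover have "supp P \<subseteq> {u @ [a \<oplus>\<^bsub>A\<^esub> b] @ v, u @ [a] @ v, u @ [b] @ v}"
    unfolding P by (auto simp: in_keys_iff lookup_minus simp del: int_poly_ring_simps split: if_splits)
  ultimately show "P \<in> carrier (add_monoid F)" by auto
qed

lemma relations_zero: "0 \<in> I"
  using generate.one[of "add_monoid F"] unfolding tensor_relations_def by simp

lemma relations_subset: "I \<subseteq> carrier F"
  using group.generate_in_carrier[OF comm_group.axioms(2)[OF add_monoid_sha_free(1)[of l A]]
      relation_generators_carrier]
  unfolding tensor_relations_def by auto

lemma relations_add: "P \<in> I \<Longrightarrow> Q \<in> I \<Longrightarrow> P + Q \<in> I"
  using generate.eng[of P "add_monoid F" _ Q] unfolding tensor_relations_def by simp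

lemma relations_uminus:
  assumes "P \<in> I" shows "- P \<in> I"
proof -
  have "inv\<^bsub>add_monoid F\<^esub> P \<in> I"
    using group.generate_m_inv_closed[OF comm_group.axioms(2)[OF add_monoid_sha_free(1)[of l A]]
      relation_generators_carrier] assms
    unfolding tensor_relations_def by blast
  moreover have "P \<in> carrier F" using relations_subset assms by blast
  ultimately show ?thesis by (simp only: add_monoid_sha_free(2))
qed

lemma relations_diff: "P \<in> I \<Longrightarrow> Q \<in> I \<Longrightarrow> P - Q \<in> I"
  using relations_add[of P "- Q"] relations_uminus by simp

lemma relations_incl:
  assumes "set u \<subseteq> carrier A" "set v \<subseteq> carrier A" "a \<in> carrier A" "b \<in> carrier A"
  shows "frag_of (u @ (a + b) # v) - frag_of (u @ a # v) - frag_of (u @ b # v) \<in> I"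
  unfolding tensor_relations_def
  by (rule generate.incl) (use assms in \<open>force\<close>)

lemma sha_eval_relations:
  assumes "P \<in> I" shows "sha_eval l pt P = 0"
  using assms unfolding tensor_relations_def
proof (induction rule: generate.induct)
  case (incl P)
  then obtain u v a b where "P = frag_of (u @ [a + b] @ v) - frag_of (u @ [a] @ v) - frag_of (u @ [b] @ v)"
    by auto
  then show ?case by (simp add: lin_ext_diff word_eval_additive[simplified])
next
  case (inv P)
  have "P \<in> carrier F" using subsetD[OF relation_generators_carrier inv] by simp
  obtain u v a b where "P = frag_of (u @ [a + b] @ v) - frag_of (u @ [a] @ v) - frag_of (u @ [b] @ v)"
    using inv by auto
  then have "sha_eval l pt P = 0" by (simp add: lin_ext_diff word_eval_additive[simplified])
  then show ?case using add_monoid_sha_free(2)[OF \<open>P \<in> carrier F\<close>] by (simp add: lin_ext_uminus)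
qed (simp_all add: lin_ext_add)

definition monomial_words :: "'x multiset list set" where
  "monomial_words = {ws. ws \<noteq> [] \<and> (\<forall>m\<in>set ws. set_mset m \<subseteq> X)}"

text \<open>
  The letters of \<open>v\<close> are expanded into monomials from left to right; \<open>u\<close> holds the monomials obtained so
  far.
\<close>

lemma reduce_word:
  "set v \<subseteq> carrier A \<Longrightarrow> (\<forall>m\<in>set u. set_mset m \<subseteq> X) \<Longrightarrow> u \<noteq> [] \<or> v \<noteq> [] \<Longrightarrow>
    \<exists>g. supp g \<subseteq> monomial_words \<and> frag_of (map frag_of u @ v) - monomial_frag g \<in> I"
proof (induction v arbitrary: u)
  case Nil
  then show ?case
    by (intro exI[of _ "frag_of u"]) (auto simp: monomial_words_def monomial_frag_def relations_zero)
next
  case (Cons p v)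
  define S where "S = {m. set_mset m \<subseteq> X}"
  have u: "set (map frag_of u) \<subseteq> carrier A" using Cons.prems(2) by auto
  have v: "set v \<subseteq> carrier A" using Cons.prems(1) by auto
  have S: "p \<in> carrier A \<longleftrightarrow> supp p \<subseteq> S" for p by (auto simp: S_def)
  let ?w = "\<lambda>p. frag_of (map frag_of u @ p # v)"
  have "supp p \<subseteq> S" using Cons.prems(1) by (auto simp: S_def)
  then have "supp p \<subseteq> S \<and>
      (\<exists>g. supp g \<subseteq> monomial_words \<and> ?w p - monomial_frag g \<in> I)"
  proof (induction p rule: frag_induction)
    case zero
    \<comment> \<open>additivity forces a word with a letter 0 into the relations\<close>
    have "?w (0 + 0) - ?w 0 - ?w 0 \<in> I" by (rule relations_incl[OF u v]) auto
    from relations_uminus[OF this] have "?w 0 - monomial_frag 0 \<in> I" by (simp add: monomial_frag_def)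
    then show ?case by (intro conjI exI[of _ 0]) simp_all
  next
    case (one m)
    then have "\<forall>m\<in>set (u @ [m]). set_mset m \<subseteq> X" using Cons.prems(2) by (auto simp: S_def)
    from Cons.IH[OF v this] obtain g where
      "supp g \<subseteq> monomial_words" "frag_of (map frag_of (u @ [m]) @ v) - monomial_frag g \<in> I"
      by auto
    then show ?case using one by auto
  next
    case (diff a b)
    then obtain ga gb where g: "supp ga \<subseteq> monomial_words" "?w a - monomial_frag ga \<in> I"
      "supp gb \<subseteq> monomial_words" "?w b - monomial_frag gb \<in> I" by blast
    have ab: "supp (a - b) \<subseteq> S" using diff keys_diff[of a b] by blast
    have "?w ((a - b) + b) - ?w (a - b) - ?w b \<in> I"
      by (rule relations_incl[OF u v]) (use ab diff S in blast)+
    then have r: "?w a - ?w (a - b) - ?w b \<in> I" by simp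
    have eq: "?w (a - b) - monomial_frag (ga - gb) =
        (?w a - monomial_frag ga) - (?w b - monomial_frag gb) - (?w a - ?w (a - b) - ?w b)"
      by (simp add: monomial_frag_def frag_extend_diff)
    have "?w (a - b) - monomial_frag (ga - gb) \<in> I"
      unfolding eq by (rule relations_diff[OF relations_diff[OF g(2,4)] r])
    moreover have "supp (ga - gb) \<subseteq> monomial_words" using g keys_diff[of ga gb] by blast
    ultimately show ?case using ab by blast
  qed
  then show ?case by blast
qed

lemma reduce:
  assumes "P \<in> carrier F"
  shows "\<exists>g. supp g \<subseteq> monomial_words \<and> P - monomial_frag g \<in> I"
proof -
  have "supp P \<subseteq> sha_words A" using assms by simp
  then show ?thesis
  proof (induction P rule: frag_induction)
    case zero
    show ?case by (intro exI[of _ 0]) (simp add: monomial_frag_def relations_zero)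
  next
    case (one w)
    then show ?case using reduce_word[of w "[]"] by (auto simp: sha_words_def)
  next
    case (diff a b)
    then obtain ga gb where g: "supp ga \<subseteq> monomial_words" "a - monomial_frag ga \<in> I"
      "supp gb \<subseteq> monomial_words" "b - monomial_frag gb \<in> I" by blast
    have eq: "a - b - monomial_frag (ga - gb) = (a - monomial_frag ga) - (b - monomial_frag gb)"
      by (simp add: monomial_frag_def frag_extend_diff)
    have "a - b - monomial_frag (ga - gb) \<in> I"
      unfolding eq by (rule relations_diff[OF g(2,4)])
    moreover have "supp (ga - gb) \<subseteq> monomial_words" using g keys_diff[of ga gb] by blast
    ultimately show ?case by blast
  qed
qed

lemma sha_eval_monomial_frag:
  assumes "supp g \<subseteq> monomial_words"
  shows "sha_eval l pt (monomial_frag g) = tensor_value l pt g"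
  unfolding monomial_frag_def lin_ext_frag_extend
proof (rule lin_ext_cong)
  fix ws assume "ws \<in> supp g"
  then have "ws \<noteq> []" using assms by (auto simp: monomial_words_def)
  then obtain m v where "ws = m # v" by (cases ws) auto
  moreover have "quasi_eval l (map letter_eval (snd pt)) (map frag_of v) = quasi_eval l (map mon_eval (snd pt)) v"
    unfolding quasi_eval_map by (simp add: comp_def)
  ultimately show "sha_eval l pt (frag_of (map frag_of ws)) = tensor_eval l pt ws"
    by (simp add: word_eval_def tensor_eval_def)
qed

lemma monomial_frag_carrier:
  "supp g \<subseteq> monomial_words \<Longrightarrow> monomial_frag g \<in> carrier F"
  unfolding monomial_frag_def
  by (auto elim!: keys_frag_extendE simp: monomial_words_def sha_words_def dest!: subsetD) blast

abbreviation (input) "cls P \<equiv> I +>\<^bsub>F\<^esub> P"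

lemma mem_class: "Q \<in> cls P \<longleftrightarrow> (\<exists>h\<in>I. Q = h + P)"
  by (auto simp: a_r_coset_def r_coset_def)

lemma class_self: "P \<in> cls P"
  unfolding mem_class using relations_zero by (intro bexI[of _ 0]) simp_all

lemma eval_class: "Q \<in> cls P \<Longrightarrow> sha_eval l pt Q = sha_eval l pt P"
  by (auto simp: mem_class lin_ext_add sha_eval_relations)

lemma class_carrier: "P \<in> carrier F \<Longrightarrow> Q \<in> cls P \<Longrightarrow> Q \<in> carrier F"
  using relations_subset Poly_Mapping.keys_add by (fastforce simp: mem_class)

text \<open>
  Modulo the relations an element is a combination of words of monomials, and evaluations detect
  those. As the evaluations are multiplicative, the relations form an ideal, and the quotient is a
  ring of integer-valued functions.
\<close>

lemma kernel_relations:
  assumes l: "l \<noteq> 0" and P: "P \<in> carrier F" and zero: "\<And>pt. sha_eval l pt P = 0"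
  shows "P \<in> I"
proof -
  obtain g where g: "supp g \<subseteq> monomial_words" "P - monomial_frag g \<in> I"
    using reduce[OF P] by blast
  have "tensor_value l pt g = 0" for pt
    using sha_eval_relations[OF g(2), of pt] zero[of pt] sha_eval_monomial_frag[OF g(1), of pt]
    by (simp add: lin_ext_diff)
  moreover have "[] \<notin> supp g" using g(1) by (auto simp: monomial_words_def)
  ultimately have "g = 0" using tensor_eval_injective[OF l] by blast
  then show ?thesis using g(2) by (simp add: monomial_frag_def)
qed

lemma class_eq_iff:
  assumes l: "l \<noteq> 0" and P: "P \<in> carrier F" and Q: "Q \<in> carrier F"
  shows "cls P = cls Q \<longleftrightarrow> (\<forall>pt. sha_eval l pt P = sha_eval l pt Q)"
proof
  assume "cls P = cls Q"
  then have "P \<in> cls Q" using class_self by blast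
  then show "\<forall>pt. sha_eval l pt P = sha_eval l pt Q" using eval_class by blast
next
  assume eq: "\<forall>pt. sha_eval l pt P = sha_eval l pt Q"
  have sub: "cls P \<subseteq> cls Q" if PQ: "P - Q \<in> I" for P Q
  proof
    fix S assume "S \<in> cls P"
    then obtain h where "h \<in> I" "S = h + P" by (auto simp: mem_class)
    then have "h + (P - Q) \<in> I" "S = (h + (P - Q)) + Q" using relations_add[OF _ PQ] by auto
    then show "S \<in> cls Q" unfolding mem_class by blast
  qed
  have "P - Q \<in> carrier F" using P Q keys_diff[of P Q] by auto
  then have "P - Q \<in> I"
    by (rule kernel_relations[OF l]) (simp only: lin_ext_diff spec[OF eq] diff_self)
  moreover from relations_uminus[OF this] have "Q - P \<in> I" by simp
  ultimately show "cls P = cls Q" using sub by blast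
qed

lemma sha_carrier: "carrier (sha l A) = (\<lambda>P. cls P) ` carrier F"
  by (auto simp: sha_def FactRing_def A_RCOSETS_def')

lemma zero_sha: "\<zero>\<^bsub>sha l A\<^esub> = cls 0"
  by (auto simp: sha_def FactRing_def mem_class)

lemma one_sha: "\<one>\<^bsub>sha l A\<^esub> = cls (frag_of [1])"
  by (simp add: sha_def FactRing_def)

lemma add_sha:
  assumes P: "P \<in> carrier F" and Q: "Q \<in> carrier F"
  shows "cls P \<oplus>\<^bsub>sha l A\<^esub> cls Q = cls (P + Q)"
proof -
  have "cls P \<oplus>\<^bsub>sha l A\<^esub> cls Q = (\<Union>h\<in>cls P. \<Union>k\<in>cls Q. {h + k})"
    by (simp add: sha_def FactRing_def set_add_def' del: UN_singleton)
  also have "\<dots> = cls (P + Q)"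
  proof (intro subset_antisym subsetI)
    fix S assume "S \<in> (\<Union>h\<in>cls P. \<Union>k\<in>cls Q. {h + k})"
    then obtain h k where "h \<in> I" "k \<in> I" "S = (h + P) + (k + Q)" by (auto simp: mem_class)
    then have "h + k \<in> I" "S = (h + k) + (P + Q)" by (auto simp: relations_add)
    then show "S \<in> cls (P + Q)" unfolding mem_class by blast
  next
    fix S assume "S \<in> cls (P + Q)"
    then obtain h where "h \<in> I" "S = (h + P) + Q" by (auto simp: mem_class add.assoc)
    moreover from this(1) have "h + P \<in> cls P" unfolding mem_class by blast
    ultimately show "S \<in> (\<Union>h\<in>cls P. \<Union>k\<in>cls Q. {h + k})" using class_self[of Q] by blast
  qed
  finally show ?thesis .
qed

lemma keys_mixable_shuffle_lists:
  "z \<in> supp (mixable_shuffle k B u v) \<Longrightarrow> set u \<subseteq> C \<Longrightarrow> set v \<subseteq> C \<Longrightarrow>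
     (\<And>a b. a \<in> C \<Longrightarrow> b \<in> C \<Longrightarrow> a \<otimes>\<^bsub>B\<^esub> b \<in> C) \<Longrightarrow> set z \<subseteq> C"
proof (induction k B u v arbitrary: z rule: mixable_shuffle.induct)
  case (3 k B a u b v)
  from "3.prems"(1) have "z \<in> supp (prefix_letter a (mixable_shuffle k B u (b # v))) \<or>
      z \<in> supp (prefix_letter b (mixable_shuffle k B (a # u) v)) \<or>
      z \<in> supp (prefix_letter (a \<otimes>\<^bsub>B\<^esub> b) (mixable_shuffle k B u v))"
    by (auto dest!: subsetD[OF Poly_Mapping.keys_add])
  then show ?case
    unfolding keys_prefix_letter
    by (elim disjE imageE) (use "3.IH" "3.prems" in \<open>simp_all\<close>)
qed auto

lemma mult_carrier:
  assumes P: "P \<in> carrier F" and Q: "Q \<in> carrier F"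
  shows "P \<otimes>\<^bsub>F\<^esub> Q \<in> carrier F"
proof -
  have mult: "a \<otimes>\<^bsub>A\<^esub> b \<in> carrier A" if "a \<in> carrier A" "b \<in> carrier A" for a b
    using that Poly_Mapping.keys_mult[of a b] by fastforce
  have "z \<in> sha_words A" if z: "z \<in> supp (frag_bilinear (sha_word_mult l A) P Q)" for z
    using z
  proof (rule keys_frag_bilinearE)
    fix u v assume uv: "u \<in> supp P" "v \<in> supp Q"
      "z \<in> supp (sha_word_mult l A u v)"
    then have "u \<in> sha_words A" "v \<in> sha_words A" using P Q by auto
    then have u: "u \<noteq> []" "set u \<subseteq> carrier A" and v: "v \<noteq> []" "set v \<subseteq> carrier A"
      unfolding sha_words_def by blast+
    then have uv': "hd u \<in> carrier A" "hd v \<in> carrier A" "set (tl u) \<subseteq> carrier A" "set (tl v) \<subseteq> carrier A"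
      by (meson hd_in_set list.set_sel(2) subset_iff)+
    obtain z' where z': "z = hd u \<otimes>\<^bsub>A\<^esub> hd v # z'"
      "z' \<in> supp (mixable_shuffle l A (tl u) (tl v))"
      using uv(3) unfolding sha_word_mult_def keys_prefix_letter by blast
    have "set z' \<subseteq> carrier A"
      using keys_mixable_shuffle_lists[OF z'(2) uv'(3,4) mult] .
    then show ?thesis
      using mult[OF uv'(1,2)] unfolding z'(1) sha_words_def by (simp del: int_poly_ring_simps)
  qed
  then show ?thesis by auto
qed

lemma mult_sha:
  assumes l: "l \<noteq> 0" and P: "P \<in> carrier F" and Q: "Q \<in> carrier F"
  shows "cls P \<otimes>\<^bsub>sha l A\<^esub> cls Q = cls (P \<otimes>\<^bsub>F\<^esub> Q)"
proof -
  have "cls P \<otimes>\<^bsub>sha l A\<^esub> cls Q = (\<Union>a\<in>cls P. \<Union>b\<in>cls Q. cls (a \<otimes>\<^bsub>F\<^esub> b))"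
    by (simp add: sha_def FactRing_def rcoset_mult_def)
  also have "\<dots> = (\<Union>a\<in>cls P. \<Union>b\<in>cls Q. cls (P \<otimes>\<^bsub>F\<^esub> Q))"
  proof (intro SUP_cong refl)
    fix a b assume ab: "a \<in> cls P" "b \<in> cls Q"
    then have "a \<in> carrier F" "b \<in> carrier F" using class_carrier P Q by blast+
    from class_eq_iff[OF l mult_carrier[OF this] mult_carrier[OF P Q]]
    show "cls (a \<otimes>\<^bsub>F\<^esub> b) = cls (P \<otimes>\<^bsub>F\<^esub> Q)"
      using eval_class[OF ab(1)] eval_class[OF ab(2)] by (simp only: sha_eval_mult) blast
  qed
  also have "\<dots> = cls (P \<otimes>\<^bsub>F\<^esub> Q)" using class_self[of P] class_self[of Q] by blast
  finally show ?thesis .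
qed

end

section \<open>The polynomial subalgebra\<close>

definition tensor_class :: "int \<Rightarrow> 'x set \<Rightarrow> 'x word_sum \<Rightarrow>
    'x tensor_coset" where
  "tensor_class l X g =
     tensor_relations l (int_poly_ring X) +>\<^bsub>sha_free l (int_poly_ring X)\<^esub> monomial_frag g"

definition monomial_frags :: "'x set \<Rightarrow> 'x word_sum set" where
  "monomial_frags X = {g. supp g \<subseteq> monomial_words X}"

lemma tensor_class_eq_iff:
  assumes l: "l \<noteq> 0" and g: "g \<in> monomial_frags X" and h: "h \<in> monomial_frags X"
  shows "tensor_class l X g = tensor_class l X h \<longleftrightarrow> g = h"
proof
  assume eq: "tensor_class l X g = tensor_class l X h"
  have gh: "supp g \<subseteq> monomial_words X" "supp h \<subseteq> monomial_words X"
    using g h by (simp_all add: monomial_frags_def)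
  have "tensor_value l pt (g - h) = 0" for pt
  proof -
    have "\<forall>pt. sha_eval l pt (monomial_frag g) = sha_eval l pt (monomial_frag h)"
      using eq class_eq_iff[OF l monomial_frag_carrier[OF gh(1)] monomial_frag_carrier[OF gh(2)]]
      unfolding tensor_class_def by blast
    then have "tensor_value l pt g = tensor_value l pt h"
      by (simp only: sha_eval_monomial_frag[OF gh(1)] sha_eval_monomial_frag[OF gh(2)])
    then show ?thesis by (simp add: lin_ext_diff)
  qed
  moreover have "[] \<notin> supp (g - h)"
    using gh keys_diff[of g h] by (auto simp: monomial_words_def)
  ultimately have "g - h = 0" using tensor_eval_injective[OF l] by blast
  then show "g = h" by simp
qed simp

lemma carrier_sha:
  assumes l: "l \<noteq> 0"
  shows "carrier (sha_poly l X) = tensor_class l X ` monomial_frags X"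
proof (intro subset_antisym subsetI)
  fix c assume "c \<in> carrier (sha_poly l X)"
  then obtain P where P: "P \<in> carrier (sha_free l (int_poly_ring X))"
    and c: "c = tensor_relations l (int_poly_ring X) +>\<^bsub>sha_free l (int_poly_ring X)\<^esub> P"
    unfolding sha_carrier by blast
  obtain g where g: "supp g \<subseteq> monomial_words X"
    "P - monomial_frag g \<in> tensor_relations l (int_poly_ring X)" using reduce[OF P] by blast
  have "sha_eval l pt P = sha_eval l pt (monomial_frag g)" for pt
    using sha_eval_relations[OF g(2), of pt] by (simp add: lin_ext_diff)
  then have "c = tensor_class l X g"
    unfolding c tensor_class_def
    using class_eq_iff[OF l P monomial_frag_carrier[OF g(1)]] by blast
  then show "c \<in> tensor_class l X ` monomial_frags X" using g(1) by (auto simp: monomial_frags_def)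
next
  fix c assume "c \<in> tensor_class l X ` monomial_frags X"
  then obtain g where "supp g \<subseteq> monomial_words X" "c = tensor_class l X g"
    by (auto simp: monomial_frags_def)
  then show "c \<in> carrier (sha_poly l X)"
    unfolding sha_carrier tensor_class_def using monomial_frag_carrier by blast
qed

lemma monomial_frags_zero [simp]: "0 \<in> monomial_frags X"
  by (simp add: monomial_frags_def)

lemma monomial_frags_add: "g \<in> monomial_frags X \<Longrightarrow> h \<in> monomial_frags X \<Longrightarrow> g + h \<in> monomial_frags X"
  unfolding monomial_frags_def using Poly_Mapping.keys_add[of g h] by blast

lemma monomial_frags_uminus: "g \<in> monomial_frags X \<Longrightarrow> - g \<in> monomial_frags X"
  by (simp add: monomial_frags_def)

lemma zero_tensor_class: "\<zero>\<^bsub>sha_poly l X\<^esub> = tensor_class l X 0"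
  by (simp add: zero_sha tensor_class_def monomial_frag_def)

lemma one_tensor_class: "\<one>\<^bsub>sha_poly l X\<^esub> = tensor_class l X (frag_of [{#}])"
  by (simp add: one_sha tensor_class_def monomial_frag_def)

lemma add_tensor_class:
  assumes g: "g \<in> monomial_frags X" and h: "h \<in> monomial_frags X"
  shows "tensor_class l X g \<oplus>\<^bsub>sha_poly l X\<^esub> tensor_class l X h = tensor_class l X (g + h)"
proof -
  have gh: "supp g \<subseteq> monomial_words X" "supp h \<subseteq> monomial_words X"
    using g h by (simp_all add: monomial_frags_def)
  show ?thesis
    unfolding tensor_class_def
      add_sha[OF monomial_frag_carrier[OF gh(1)] monomial_frag_carrier[OF gh(2)]]
    by (simp only: monomial_frag_def frag_extend_add)
qed

lemma mult_tensor_class: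
  assumes l: "l \<noteq> 0" and g: "g \<in> monomial_frags X" and h: "h \<in> monomial_frags X"
    and k: "k \<in> monomial_frags X"
    and eval: "\<And>pt. tensor_value l pt k = tensor_value l pt g * tensor_value l pt h"
  shows "tensor_class l X g \<otimes>\<^bsub>sha_poly l X\<^esub> tensor_class l X h = tensor_class l X k"
proof -
  have ghk: "supp g \<subseteq> monomial_words X" "supp h \<subseteq> monomial_words X"
    "supp k \<subseteq> monomial_words X"
    using g h k by (simp_all add: monomial_frags_def)
  note car = monomial_frag_carrier[OF ghk(1)] monomial_frag_carrier[OF ghk(2)] monomial_frag_carrier[OF ghk(3)]
  show ?thesis
    unfolding tensor_class_def mult_sha[OF l car(1,2)]
      class_eq_iff[OF l mult_carrier[OF car(1,2)] car(3)]
    by (simp only: sha_eval_mult sha_eval_monomial_frag[OF ghk(1)] sha_eval_monomial_frag[OF ghk(2)]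
        sha_eval_monomial_frag[OF ghk(3)] eval) simp
qed

lemma add_monoid_sha:
  assumes l: "l \<noteq> 0"
  shows "comm_group (add_monoid (sha_poly l X))"
    and "g \<in> monomial_frags X \<Longrightarrow> inv\<^bsub>add_monoid (sha_poly l X)\<^esub> tensor_class l X g = tensor_class l X (- g)"
proof -
  have car: "carrier (add_monoid (sha_poly l X)) = tensor_class l X ` monomial_frags X"
    by (simp add: carrier_sha[OF l])
  have add: "tensor_class l X g \<otimes>\<^bsub>add_monoid (sha_poly l X)\<^esub> tensor_class l X h = tensor_class l X (g + h)"
    if "g \<in> monomial_frags X" "h \<in> monomial_frags X" for g h
    using add_tensor_class[OF that] by simp
  have one: "\<one>\<^bsub>add_monoid (sha_poly l X)\<^esub> = tensor_class l X 0"
    by (simp add: zero_tensor_class)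
  show gr: "comm_group (add_monoid (sha_poly l X))"
  proof (rule comm_groupI; (unfold car one)?)
    show "tensor_class l X 0 \<in> tensor_class l X ` monomial_frags X" by simp
  next
    fix x y assume "x \<in> tensor_class l X ` monomial_frags X" "y \<in> tensor_class l X ` monomial_frags X"
    then obtain g h where gh: "g \<in> monomial_frags X" "h \<in> monomial_frags X"
      "x = tensor_class l X g" "y = tensor_class l X h" by blast
    show "x \<otimes>\<^bsub>add_monoid (sha_poly l X)\<^esub> y \<in> tensor_class l X ` monomial_frags X"
      unfolding gh(3,4) add[OF gh(1,2)] using monomial_frags_add[OF gh(1,2)] by blast
    show "x \<otimes>\<^bsub>add_monoid (sha_poly l X)\<^esub> y = y \<otimes>\<^bsub>add_monoid (sha_poly l X)\<^esub> x"
      unfolding gh(3,4) add[OF gh(1,2)] add[OF gh(2,1)] by (simp only: add.commute)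
    fix z assume "z \<in> tensor_class l X ` monomial_frags X"
    then obtain k where k: "k \<in> monomial_frags X" "z = tensor_class l X k" by blast
    show "x \<otimes>\<^bsub>add_monoid (sha_poly l X)\<^esub> y \<otimes>\<^bsub>add_monoid (sha_poly l X)\<^esub> z =
        x \<otimes>\<^bsub>add_monoid (sha_poly l X)\<^esub> (y \<otimes>\<^bsub>add_monoid (sha_poly l X)\<^esub> z)"
      unfolding gh(3,4) k(2) add[OF gh(1,2)] add[OF gh(2) k(1)]
        add[OF monomial_frags_add[OF gh(1,2)] k(1)] add[OF gh(1) monomial_frags_add[OF gh(2) k(1)]]
      by (simp only: add.assoc)
  next
    fix x assume "x \<in> tensor_class l X ` monomial_frags X"
    then obtain g where g: "g \<in> monomial_frags X" "x = tensor_class l X g" by blast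
    show "tensor_class l X 0 \<otimes>\<^bsub>add_monoid (sha_poly l X)\<^esub> x = x"
      unfolding g(2) add[OF monomial_frags_zero g(1)] by simp
    have "tensor_class l X (- g) \<otimes>\<^bsub>add_monoid (sha_poly l X)\<^esub> x = tensor_class l X 0"
      unfolding g(2) add[OF monomial_frags_uminus[OF g(1)] g(1)] by simp
    then show "\<exists>y\<in>tensor_class l X ` monomial_frags X.
        y \<otimes>\<^bsub>add_monoid (sha_poly l X)\<^esub> x = tensor_class l X 0"
      using monomial_frags_uminus[OF g(1)] by blast
  qed
  then interpret comm_group "add_monoid (sha_poly l X)" .
  show "inv\<^bsub>add_monoid (sha_poly l X)\<^esub> tensor_class l X g = tensor_class l X (- g)"
    if "g \<in> monomial_frags X"
    by (rule inv_equality)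
      (use that in \<open>simp_all only: add one car monomial_frags_uminus add.left_inverse imageI\<close>)
qed

lemma generate_tensor_classes:
  assumes l: "l \<noteq> 0" and S: "S \<subseteq> monomial_words X"
  shows "generate (add_monoid (sha_poly l X)) ((\<lambda>ws. tensor_class l X (frag_of ws)) ` S) =
    tensor_class l X ` {g. supp g \<subseteq> S}"
proof (intro subset_antisym subsetI)
  have frags: "g \<in> monomial_frags X" if "supp g \<subseteq> S" for g
    using that S by (auto simp: monomial_frags_def)
  fix c assume "c \<in> generate (add_monoid (sha_poly l X)) ((\<lambda>ws. tensor_class l X (frag_of ws)) ` S)"
  then show "c \<in> tensor_class l X ` {g. supp g \<subseteq> S}"
  proof (induction rule: generate.induct)
    case one
    show ?case by (intro image_eqI[of _ _ 0]) (simp_all add: zero_tensor_class)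
  next
    case (incl c)
    then show ?case by auto
  next
    case (inv c)
    then obtain ws where "ws \<in> S" "c = tensor_class l X (frag_of ws)" by blast
    then show ?case using add_monoid_sha(2)[OF l frags[of "frag_of ws"]] by auto
  next
    case (eng c d)
    then obtain g h where gh: "supp g \<subseteq> S" "supp h \<subseteq> S"
      "c = tensor_class l X g" "d = tensor_class l X h" by blast
    have "supp (g + h) \<subseteq> S" using gh Poly_Mapping.keys_add[of g h] by blast
    then show ?case using add_tensor_class[OF frags[OF gh(1)] frags[OF gh(2)]] gh by auto
  qed
next
  have frags: "g \<in> monomial_frags X" if "supp g \<subseteq> S" for g
    using that S by (auto simp: monomial_frags_def)
  let ?G = "generate (add_monoid (sha_poly l X)) ((\<lambda>ws. tensor_class l X (frag_of ws)) ` S)"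
  interpret comm_group "add_monoid (sha_poly l X)" by (rule add_monoid_sha(1)[OF l])
  have sub: "(\<lambda>ws. tensor_class l X (frag_of ws)) ` S \<subseteq> carrier (add_monoid (sha_poly l X))"
    using carrier_sha[OF l, of X] frags by auto
  fix c assume "c \<in> tensor_class l X ` {g. supp g \<subseteq> S}"
  then obtain g where g: "supp g \<subseteq> S" "c = tensor_class l X g" by blast
  from g(1) have "supp g \<subseteq> S \<and> tensor_class l X g \<in> ?G"
  proof (induction g rule: frag_induction)
    case zero
    show ?case using generate.one[of "add_monoid (sha_poly l X)"] by (simp add: zero_tensor_class)
  next
    case (one ws)
    then show ?case by (auto intro: generate.incl)
  next
    case (diff a b)
    have "tensor_class l X (- b) \<in> ?G"
      using generate_m_inv_closed[OF sub, of "tensor_class l X b"] diff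
        add_monoid_sha(2)[OF l frags[of b]] by auto
    then have "tensor_class l X a \<oplus>\<^bsub>sha_poly l X\<^esub> tensor_class l X (- b) \<in> ?G"
      using generate.eng[of _ "add_monoid (sha_poly l X)"] diff by auto
    moreover have "supp (a - b) \<subseteq> S" using diff keys_diff[of a b] by blast
    ultimately show ?case
      using add_tensor_class[OF frags[of a] frags[of "- b"]] diff by simp
  qed
  then show "c \<in> ?G" using g by simp
qed

lemma monomial_tensor_eq: "monomial_tensor l X ws = tensor_class l X (frag_of ws)"
  by (simp add: monomial_tensor_def pure_tensor_def tensor_class_def monomial_frag_def)

lemma subset_monomials_iff:
  "set ws \<subseteq> {{#}} \<union> free_abelian_semigroup X \<longleftrightarrow> (\<forall>m\<in>set ws. set_mset m \<subseteq> X)"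
  unfolding free_abelian_semigroup_def by auto

definition unit_words :: "'x set \<Rightarrow> 'x multiset list set" where
  "unit_words X = {ws \<in> monomial_words X. {#} \<in> set (tl ws)}"

definition unit_free_words :: "'x set \<Rightarrow> 'x multiset list set" where
  "unit_free_words X = {ws \<in> monomial_words X. {#} \<notin> set (tl ws)}"

lemma unit_words_subset: "unit_words X \<subseteq> monomial_words X"
  by (auto simp: unit_words_def)

lemma sha_unit_part_eq:
  assumes l: "l \<noteq> 0"
  shows "sha_unit_part l X = tensor_class l X ` {g. supp g \<subseteq> unit_words X}"
proof -
  have "{monomial_tensor l X ws | ws r.
        r \<ge> 1 \<and> length ws = r + 1 \<and> set ws \<subseteq> {{#}} \<union> free_abelian_semigroup X \<and>
        (\<exists>i \<in> {1..r}. ws ! i = {#})} = (\<lambda>ws. tensor_class l X (frag_of ws)) ` unit_words X"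
    (is "?L = _ ` _")
  proof -
    have iff: "(\<exists>r. r \<ge> 1 \<and> length ws = r + 1 \<and> set ws \<subseteq> {{#}} \<union> free_abelian_semigroup X \<and>
        (\<exists>i \<in> {1..r}. ws ! i = {#})) \<longleftrightarrow> ws \<in> unit_words X" for ws
    proof (cases ws)
      case (Cons a w)
      have "(\<exists>i \<in> {1..length w}. ws ! i = {#}) \<longleftrightarrow> {#} \<in> set w"
      proof
        assume "\<exists>i \<in> {1..length w}. ws ! i = {#}"
        then obtain i where "1 \<le> i" "i \<le> length w" "ws ! i = {#}" by auto
        then show "{#} \<in> set w" using Cons nth_mem[of "i - 1" w] by (cases i) (auto simp: Suc_le_eq)
      next
        assume "{#} \<in> set w"
        then obtain i where "i < length w" "w ! i = {#}" by (auto simp: in_set_conv_nth)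
        then show "\<exists>i \<in> {1..length w}. ws ! i = {#}"
          using Cons by (intro bexI[of _ "Suc i"]) auto
      qed
      moreover have "{#} \<in> set w \<Longrightarrow> length w \<ge> 1" by (cases w) auto
      moreover have len: "length ws = length w + 1" using Cons by simp
      moreover have "ws \<in> unit_words X \<longleftrightarrow>
          set ws \<subseteq> {{#}} \<union> free_abelian_semigroup X \<and> {#} \<in> set w"
        unfolding unit_words_def monomial_words_def subset_monomials_iff Cons by simp
      ultimately show ?thesis by (simp only: len add_right_cancel) blast
    qed (simp add: unit_words_def monomial_words_def)
    have "{ws. \<exists>r. r \<ge> 1 \<and> length ws = r + 1 \<and> set ws \<subseteq> {{#}} \<union> free_abelian_semigroup X \<and>
        (\<exists>i \<in> {1..r}. ws ! i = {#})} = unit_words X" (is "?W = _")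
      by (rule Set.set_eqI) (simp only: mem_Collect_eq iff)
    moreover have "?L = (\<lambda>ws. tensor_class l X (frag_of ws)) ` ?W"
      unfolding monomial_tensor_eq by (rule Set.set_eqI) (simp only: mem_Collect_eq image_iff bex_simps, blast)
    ultimately show ?thesis by simp
  qed
  then show ?thesis
    unfolding sha_unit_part_def
    by (simp only: generate_tensor_classes[OF l, of "unit_words X" X] unit_words_subset)
qed

lemma tensor_class_homogeneous:
  assumes l: "l \<noteq> 0" and g: "g \<in> monomial_frags X"
    and d: "\<And>ws. ws \<in> supp g \<Longrightarrow> word_degree ws = d"
  shows "tensor_class l X g \<in> sha_homogeneous l X d"
proof -
  let ?S = "{ws \<in> monomial_words X. word_degree ws = d}"
  have "{monomial_tensor l X ws | ws.
        ws \<noteq> [] \<and> set ws \<subseteq> {{#}} \<union> free_abelian_semigroup X \<and> word_degree ws = d} =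
      (\<lambda>ws. tensor_class l X (frag_of ws)) ` ?S"
    unfolding monomial_tensor_eq subset_monomials_iff monomial_words_def by blast
  then have "sha_homogeneous l X d = tensor_class l X ` {g. supp g \<subseteq> ?S}"
    unfolding sha_homogeneous_def using generate_tensor_classes[OF l, of ?S X] by auto
  then show ?thesis using g d by (auto simp: monomial_frags_def)
qed

definition unit_free_frags :: "'x set \<Rightarrow> 'x word_sum set" where
  "unit_free_frags X = {g. supp g \<subseteq> unit_free_words X}"

lemma unit_free_frags_subset: "unit_free_frags X \<subseteq> monomial_frags X"
  by (auto simp: unit_free_frags_def monomial_frags_def unit_free_words_def)

text \<open>
  A product of monomials different from \<open>1\<close> is different from \<open>1\<close>.
\<close>

lemma unit_free_product:
  assumes g: "g \<in> unit_free_frags X" and h: "h \<in> unit_free_frags X"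
  shows "\<exists>k\<in>unit_free_frags X. \<forall>pt. tensor_value l pt k = tensor_value l pt g * tensor_value l pt h"
proof (intro bexI allI)
  let ?k = "frag_bilinear (sha_word_mult l monomials) g h"
  show "tensor_value l pt ?k = tensor_value l pt g * tensor_value l pt h" for pt
  proof (rule lin_ext_frag_bilinear)
    fix u v :: "'a multiset list"
    have "lin_ext (quasi_eval l (map mon_eval (snd pt))) (mixable_shuffle l monomials (tl u) (tl v)) =
        quasi_eval l (map mon_eval (snd pt)) (tl u) * quasi_eval l (map mon_eval (snd pt)) (tl v)"
      by (rule quasi_eval_mixable_shuffle) (auto simp: mon_eval_add)
    then show "tensor_value l pt (sha_word_mult l monomials u v) = tensor_eval l pt u * tensor_eval l pt v"
      by (simp add: sha_word_mult_def lin_ext_prefix_letter tensor_eval_def lin_ext_mult_left mon_eval_add)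
  qed
  have "z \<in> unit_free_words X" if z: "z \<in> supp ?k" for z
    using z
  proof (rule keys_frag_bilinearE)
    fix u v assume uv: "u \<in> supp g" "v \<in> supp h"
      "z \<in> supp (sha_word_mult l monomials u v)"
    then have u: "u \<in> unit_free_words X" and v: "v \<in> unit_free_words X"
      using g h by (auto simp: unit_free_frags_def)
    obtain z' where z': "z = (hd u + hd v) # z'"
      "z' \<in> supp (mixable_shuffle l monomials (tl u) (tl v))"
      using uv(3) by (auto simp: sha_word_mult_def keys_prefix_letter)
    obtain a u' b v' where ab: "u = a # u'" "v = b # v'"
      using u v by (cases u; cases v) (auto simp: unit_free_words_def monomial_words_def)
    have "z' \<in> words_of (sum_list u' + sum_list v')"
      by (rule keys_mixable_shuffle_words_of[OF z'(2) refl])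
        (use u v ab in \<open>auto simp: unit_free_words_def words_of_def\<close>)
    then have "{#} \<notin> set z'" and sum: "sum_list z' = sum_list u' + sum_list v'"
      by (auto simp: words_of_def)
    moreover have "set_mset (sum_list z') \<subseteq> X"
      unfolding sum set_mset_union set_mset_sum_list
      using u v ab by (auto simp: unit_free_words_def monomial_words_def)
    ultimately show "z \<in> unit_free_words X"
      using u v ab z'(1) unfolding set_mset_sum_list by (auto simp: unit_free_words_def monomial_words_def)
  qed
  then show "?k \<in> unit_free_frags X" by (auto simp: unit_free_frags_def)
qed

locale sha_generators = monomial_order R
  for R :: "('x multiset \<times> 'x multiset) set" +
  fixes l :: int and X :: "'x set"
  assumes l: "l * l = 1"
begin

abbreviation (input) cl :: "'x word_sum \<Rightarrow> 'x tensor_coset" where "cl \<equiv> tensor_class l X"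
abbreviation (input) Sha where "Sha \<equiv> sha_poly l X"
abbreviation (input) val :: "'x point \<Rightarrow> 'x word_sum \<Rightarrow> int" where "val \<equiv> tensor_value l"

lemma l_nonzero: "l \<noteq> 0" using l by auto

definition lyndon_index :: "'x multiset list set" where
  "lyndon_index = {v \<in> lyndon_monomial_words. set_mset (sum_list v) \<subseteq> X}"

text \<open>
  The preimages, in the free abelian group on words of monomials, of the two kinds of polynomial
  generators.
\<close>

definition letter_frag :: "'x \<Rightarrow> 'x word_sum" where
  "letter_frag x = frag_of [{#x#}]"

definition lyndon_frag :: "'x multiset list \<Rightarrow> 'x word_sum" where
  "lyndon_frag v = prefix_letter {#} (lyndon_gen l v)"

lemma letter_frag_unit_free: "x \<in> X \<Longrightarrow> letter_frag x \<in> unit_free_frags X"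
  by (auto simp: letter_frag_def unit_free_frags_def unit_free_words_def monomial_words_def)

lemma keys_lyndon_frag:
  assumes "v \<in> lyndon_index" "ws \<in> supp (lyndon_frag v)"
  obtains w where "ws = {#} # w" "w \<in> words_of (sum_list v)"
proof -
  have "v \<noteq> []" "{#} \<notin> set v"
    using assms(1) by (auto simp: lyndon_index_def lyndon_monomial_words_def lyndon_def)
  from homog_gen[OF this, of l] show ?thesis
    using assms(2) that by (auto simp: lyndon_frag_def keys_prefix_letter homog_def)
qed

lemma lyndon_frag_unit_free:
  assumes v: "v \<in> lyndon_index" shows "lyndon_frag v \<in> unit_free_frags X"
proof -
  have "ws \<in> unit_free_words X" if "ws \<in> supp (lyndon_frag v)" for ws
  proof (rule keys_lyndon_frag[OF v that])
    fix w assume w: "ws = {#} # w" "w \<in> words_of (sum_list v)"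
    have "set_mset (sum_list w) \<subseteq> X"
      using w(2) v by (auto simp: words_of_def lyndon_index_def)
    then show ?thesis
      using w unfolding set_mset_sum_list
      by (auto simp: unit_free_words_def monomial_words_def words_of_def)
  qed
  then show ?thesis by (auto simp: unit_free_frags_def)
qed

lemma eval_letter_frag: "val pt (letter_frag x) = fst pt x"
  by (simp add: letter_frag_def tensor_eval_def)

lemma eval_lyndon_frag: "val pt (lyndon_frag v) = gen_value l (snd pt) v"
  by (simp add: lyndon_frag_def lin_ext_prefix_letter tensor_eval_def gen_value_def)

definition letter_var :: "'x \<Rightarrow> 'x tensor_coset" where
  "letter_var x = cl (letter_frag x)"

definition lyndon_var :: "'x multiset list \<Rightarrow> 'x tensor_coset" where
  "lyndon_var v = cl (lyndon_frag v)"

definition vars :: "'x tensor_coset set" where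
  "vars = letter_var ` X \<union> lyndon_var ` lyndon_index"

text \<open>
  The variables of the polynomial ring are cosets; their values are read off from the unique
  combination of monomial words in the coset.
\<close>

definition frag_rep :: "'x tensor_coset \<Rightarrow> 'x word_sum" where
  "frag_rep = inv_into (monomial_frags X) cl"

definition var_eval :: "'x point \<Rightarrow> 'x tensor_coset \<Rightarrow> int" where
  "var_eval pt y = val pt (frag_rep y)"

lemma tensor_class_inj: "inj_on cl (monomial_frags X)"
  by (rule inj_onI) (simp add: tensor_class_eq_iff[OF l_nonzero])

lemma frag_rep: "g \<in> monomial_frags X \<Longrightarrow> frag_rep (cl g) = g"
  unfolding frag_rep_def by (rule inv_into_f_f[OF tensor_class_inj])

lemma var_eval_letter: "x \<in> X \<Longrightarrow> var_eval pt (letter_var x) = fst pt x"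
  unfolding var_eval_def letter_var_def
  by (subst frag_rep) (use letter_frag_unit_free unit_free_frags_subset eval_letter_frag in blast)+

lemma var_eval_lyndon: "v \<in> lyndon_index \<Longrightarrow> var_eval pt (lyndon_var v) = gen_value l (snd pt) v"
  unfolding var_eval_def lyndon_var_def
  by (subst frag_rep) (use lyndon_frag_unit_free unit_free_frags_subset eval_lyndon_frag in blast)+

lemma letter_var_inj: "inj_on letter_var X"
proof (rule inj_onI)
  fix x y assume "x \<in> X" "y \<in> X" "letter_var x = letter_var y"
  then have "letter_frag x = letter_frag y"
    using tensor_class_eq_iff[OF l_nonzero, of "letter_frag x" X "letter_frag y"]
      letter_frag_unit_free unit_free_frags_subset unfolding letter_var_def by blast
  then show "x = y" by (simp add: letter_frag_def frag_of_eq)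
qed

lemma lyndon_var_inj: "inj_on lyndon_var lyndon_index"
proof (rule inj_onI)
  fix v w assume vw: "v \<in> lyndon_index" "w \<in> lyndon_index" "lyndon_var v = lyndon_var w"
  then have "lyndon_frag v = lyndon_frag w"
    using tensor_class_eq_iff[OF l_nonzero, of "lyndon_frag v" X "lyndon_frag w"]
      lyndon_frag_unit_free unit_free_frags_subset unfolding lyndon_var_def by blast
  then have eq: "gen_value l cs v = gen_value l cs w" for cs
    using eval_lyndon_frag[of "(\<lambda>_. 0, cs)" v] eval_lyndon_frag[of "(\<lambda>_. 0, cs)" w] by simp
  have "frag_of {#v#} - frag_of {#w#} = 0"
  proof (rule gens_independent[OF l])
    show "\<forall>Q\<in>supp (frag_of {#v#} - frag_of {#w#}). set_mset Q \<subseteq> lyndon_monomial_words"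
      using keys_diff[of "frag_of {#v#}" "frag_of {#w#}"] vw by (auto simp: lyndon_index_def)
    show "lin_ext (mon_eval (gen_value l cs)) (frag_of {#v#} - frag_of {#w#}) = 0" for cs
      by (simp add: lin_ext_diff eq)
  qed
  then show "v = w" by (simp add: frag_of_eq)
qed

lemma letter_lyndon_disjoint: "letter_var ` X \<inter> lyndon_var ` lyndon_index = {}"
proof -
  have False if xv: "x \<in> X" "v \<in> lyndon_index" "letter_var x = lyndon_var v" for x v
  proof -
    have eq: "letter_frag x = lyndon_frag v"
      using tensor_class_eq_iff[OF l_nonzero, of "letter_frag x" X "lyndon_frag v"] xv
        letter_frag_unit_free lyndon_frag_unit_free unit_free_frags_subset
      unfolding letter_var_def lyndon_var_def by blast
    have "[{#x#}] \<in> supp (lyndon_frag v)"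
      unfolding eq[symmetric] by (simp add: letter_frag_def)
    from keys_lyndon_frag[OF xv(2) this] show False by auto
  qed
  then show ?thesis by blast
qed

definition poly_eval :: "'x point \<Rightarrow> ('x tensor_coset multiset \<Rightarrow>\<^sub>0 int) \<Rightarrow> int" where
  "poly_eval pt p = lin_ext (mon_eval (var_eval pt)) p"

lemma mon_eval_image_mset: "mon_eval c (image_mset f m) = mon_eval (c \<circ> f) m"
  by (simp add: mon_eval_def comp_def image_mset.compositionality)

lemma mon_eval_cong: "(\<And>x. x \<in># m \<Longrightarrow> c x = d x) \<Longrightarrow> mon_eval c m = mon_eval d m"
  unfolding mon_eval_def by (simp cong: image_mset_cong)

lemma poly_realized:
  assumes "p \<in> carrier (int_poly_ring vars)"
  shows "\<exists>g\<in>unit_free_frags X. \<forall>pt. val pt g = poly_eval pt p"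
proof -
  have monom: "\<exists>g\<in>unit_free_frags X. \<forall>pt. val pt g = mon_eval (var_eval pt) m"
    if "set_mset m \<subseteq> vars" for m
    using that
  proof (induction m)
    case empty
    have "frag_of [{#}] \<in> unit_free_frags X"
      by (auto simp: unit_free_frags_def unit_free_words_def monomial_words_def)
    then show ?case by (rule bexI[rotated]) (simp add: tensor_eval_def)
  next
    case (add y m)
    then obtain g where g: "g \<in> unit_free_frags X" "\<And>pt. val pt g = mon_eval (var_eval pt) m"
      by auto
    have "\<exists>h\<in>unit_free_frags X. \<forall>pt. val pt h = var_eval pt y"
    proof -
      have "y \<in> letter_var ` X \<or> y \<in> lyndon_var ` lyndon_index" using add.prems by (simp add: vars_def)
      then show ?thesis
      proof
        assume "y \<in> letter_var ` X"
        then show ?thesis using letter_frag_unit_free eval_letter_frag var_eval_letter by (metis imageE)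
      next
        assume "y \<in> lyndon_var ` lyndon_index"
        then show ?thesis using lyndon_frag_unit_free eval_lyndon_frag var_eval_lyndon by (metis imageE)
      qed
    qed
    then obtain h where h: "h \<in> unit_free_frags X" "\<And>pt. val pt h = var_eval pt y" by blast
    from unit_free_product[OF h(1) g(1), of l] show ?case
      by (simp add: g(2) h(2) mon_eval_def)
  qed
  have "supp p \<subseteq> {m. set_mset m \<subseteq> vars}" using assms by auto
  then show ?thesis
  proof (induction p rule: frag_induction)
    case zero
    show ?case by (intro bexI[of _ 0]) (simp_all add: poly_eval_def unit_free_frags_def)
  next
    case (one m)
    then show ?case using monom by (simp add: poly_eval_def)
  next
    case (diff a b)
    then obtain ga gb where "ga \<in> unit_free_frags X" "\<forall>pt. val pt ga = poly_eval pt a"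
      "gb \<in> unit_free_frags X" "\<forall>pt. val pt gb = poly_eval pt b" by blast
    moreover from this have "ga - gb \<in> unit_free_frags X"
      unfolding unit_free_frags_def using keys_diff[of ga gb] by blast
    ultimately show ?case by (intro bexI[of _ "ga - gb"]) (auto simp: poly_eval_def lin_ext_diff)
  qed
qed

lemma unit_free_realized:
  assumes "g \<in> unit_free_frags X"
  shows "\<exists>p\<in>carrier (int_poly_ring vars). \<forall>pt. poly_eval pt p = val pt g"
proof -
  have "supp g \<subseteq> unit_free_words X" using assms by (simp add: unit_free_frags_def)
  then show ?thesis
  proof (induction g rule: frag_induction)
    case zero
    show ?case by (intro bexI[of _ 0]) (simp_all add: poly_eval_def)
  next
    case (one ws)
    then obtain m w where ws: "ws = m # w" by (cases ws) (auto simp: unit_free_words_def monomial_words_def)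
    have m: "set_mset m \<subseteq> X" using one ws by (auto simp: unit_free_words_def monomial_words_def)
    have wX: "set_mset (sum_list w) \<subseteq> X"
      unfolding set_mset_sum_list using one ws by (auto simp: unit_free_words_def monomial_words_def)
    have "w \<in> words_of (sum_list w)" using one ws by (simp add: unit_free_words_def words_of_def)
    from gens_span[OF l this] obtain c where
      c: "\<forall>Q\<in>supp c. Q \<in> lyndon_multisets (sum_list w)"
        "\<And>cs. ev l cs (frag_of w) = lin_ext (mon_eval (gen_value l cs)) c" by blast
    have idx: "v \<in> lyndon_index" if "Q \<in> supp c" "v \<in># Q" for Q v
    proof -
      have Q: "v \<in> lyndon_monomial_words" "total_degree Q = sum_list w"
        using c(1) that by (auto simp: lyndon_multisets_def)
      have "v \<in># Q" by (rule that(2))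
      then obtain Q' where "Q = add_mset v Q'" by (metis multi_member_split)
      then have "set_mset (sum_list v) \<subseteq> set_mset (total_degree Q)" by (simp add: total_degree_def)
      then show ?thesis using Q wX by (simp add: lyndon_index_def)
    qed
    let ?p = "frag_extend (\<lambda>Q. frag_of (image_mset letter_var m + image_mset lyndon_var Q)) c"
    have "letter_var x \<in> vars" if "x \<in># m" for x using m that unfolding vars_def by blast
    moreover have "lyndon_var v \<in> vars" if "Q \<in> supp c" "v \<in># Q" for Q v
      using idx[OF that] unfolding vars_def by blast
    ultimately have "?p \<in> carrier (int_poly_ring vars)"
      by (auto elim!: keys_frag_extendE)
    moreover have "poly_eval pt ?p = val pt (frag_of ws)" for pt
    proof -
      have "mon_eval (var_eval pt) (image_mset letter_var m) = mon_eval (fst pt) m"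
        unfolding mon_eval_image_mset by (rule mon_eval_cong) (use m var_eval_letter[of _ pt] in auto)
      moreover have "mon_eval (var_eval pt) (image_mset lyndon_var Q) = mon_eval (gen_value l (snd pt)) Q"
        if "Q \<in> supp c" for Q
        unfolding mon_eval_image_mset by (rule mon_eval_cong) (use idx[OF that] var_eval_lyndon[of _ pt] in auto)
      ultimately have "poly_eval pt ?p = lin_ext (\<lambda>Q. mon_eval (fst pt) m * mon_eval (gen_value l (snd pt)) Q) c"
        unfolding poly_eval_def lin_ext_frag_extend by (intro lin_ext_cong) (simp add: mon_eval_add)
      also have "\<dots> = mon_eval (fst pt) m * ev l (snd pt) (frag_of w)"
        by (simp only: lin_ext_mult_left c(2))
      finally show ?thesis by (simp add: ws tensor_eval_def)
    qed
    ultimately show ?case by blast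
  next
    case (diff a b)
    then obtain pa pb where p: "pa \<in> carrier (int_poly_ring vars)" "\<forall>pt. poly_eval pt pa = val pt a"
      "pb \<in> carrier (int_poly_ring vars)" "\<forall>pt. poly_eval pt pb = val pt b" by blast
    moreover have "pa - pb \<in> carrier (int_poly_ring vars)"
      using p(1,3) keys_diff[of pa pb] by auto
    ultimately show ?case by (intro bexI[of _ "pa - pb"]) (auto simp: poly_eval_def lin_ext_diff)
  qed
qed

text \<open>
  A monomial in the generators is a pair of a monomial in the given variables and a multiset of
  Lyndon words.
\<close>

definition letter_part :: "'x tensor_coset multiset \<Rightarrow> 'x multiset" where
  "letter_part m = image_mset (inv_into X letter_var) (filter_mset (\<lambda>y. y \<in> letter_var ` X) m)"

definition lyndon_part :: "'x tensor_coset multiset \<Rightarrow> 'x multiset list multiset" where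
  "lyndon_part m = image_mset (inv_into lyndon_index lyndon_var) (filter_mset (\<lambda>y. y \<notin> letter_var ` X) m)"

lemma split_monomial:
  assumes "set_mset m \<subseteq> vars"
  shows "set_mset (letter_part m) \<subseteq> X" "set_mset (lyndon_part m) \<subseteq> lyndon_index"
    "m = image_mset letter_var (letter_part m) + image_mset lyndon_var (lyndon_part m)"
proof -
  have *: "set_mset (letter_part m) \<subseteq> X \<and> set_mset (lyndon_part m) \<subseteq> lyndon_index \<and>
      m = image_mset letter_var (letter_part m) + image_mset lyndon_var (lyndon_part m)"
    using assms
  proof (induction m)
    case empty
    show ?case by (simp add: letter_part_def lyndon_part_def)
  next
    case (add y m)
    show ?case
    proof (cases "y \<in> letter_var ` X")
      case True
      then have "letter_part (add_mset y m) = add_mset (inv_into X letter_var y) (letter_part m)"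
        "lyndon_part (add_mset y m) = lyndon_part m"
        by (simp_all add: letter_part_def lyndon_part_def)
      then show ?thesis using add True by (simp add: f_inv_into_f inv_into_into)
    next
      case False
      then have y: "y \<in> lyndon_var ` lyndon_index" using add.prems by (simp add: vars_def)
      have "letter_part (add_mset y m) = letter_part m"
        "lyndon_part (add_mset y m) = add_mset (inv_into lyndon_index lyndon_var y) (lyndon_part m)"
        using False by (simp_all add: letter_part_def lyndon_part_def)
      then show ?thesis using add y by (simp add: f_inv_into_f inv_into_into)
    qed
  qed
  then show "set_mset (letter_part m) \<subseteq> X" "set_mset (lyndon_part m) \<subseteq> lyndon_index"
    "m = image_mset letter_var (letter_part m) + image_mset lyndon_var (lyndon_part m)" by blast+
qed

text \<open>
  Collect the terms with the same monomial \<open>a\<close> in the given variables. The values of the first tensor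
  factor vary independently of the others, so the collected sum \<open>q a\<close> vanishes for each \<open>a\<close>, and the
  independence of the generators of the mixable shuffle algebra applies.
\<close>

lemma vars_independent:
  assumes p: "p \<in> carrier (int_poly_ring vars)" and zero: "\<And>pt. poly_eval pt p = 0"
  shows "p = 0"
proof -
  have vars: "set_mset m \<subseteq> vars" if "m \<in> supp p" for m using p that by simp
  define q where "q a = frag_extend (\<lambda>m. if letter_part m = a then frag_of (lyndon_part m) else 0) p" for a
  have eval_q: "lin_ext (mon_eval (gen_value l cs)) (q a) =
      lin_ext (\<lambda>m. if letter_part m = a then mon_eval (gen_value l cs) (lyndon_part m) else 0) p" for cs a
    unfolding q_def lin_ext_frag_extend by (rule lin_ext_cong) simp
  let ?K = "letter_part ` supp p"
  have ev0: "lin_ext (mon_eval (gen_value l cs)) (q a) = 0" if "a \<in> ?K" for cs a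
  proof (rule mon_eval_independent[OF _ _ that])
    fix c
    have "(\<Sum>a\<in>?K. mon_eval c a * lin_ext (mon_eval (gen_value l cs)) (q a)) =
        (\<Sum>m\<in>supp p. \<Sum>a\<in>?K. if letter_part m = a then
           mon_eval c a * (coeff p m * mon_eval (gen_value l cs) (lyndon_part m)) else 0)"
      unfolding eval_q unfolding lin_ext_def sum_distrib_left
      by (subst sum.swap) (intro sum.cong refl, simp)
    also have "\<dots> = lin_ext (\<lambda>m. mon_eval c (letter_part m) * mon_eval (gen_value l cs) (lyndon_part m)) p"
      unfolding lin_ext_def by (intro sum.cong refl) (simp add: mult.left_commute)
    also have "\<dots> = poly_eval (c, cs) p"
      unfolding poly_eval_def
    proof (rule lin_ext_cong)
      fix m assume "m \<in> supp p"
      note s = split_monomial[OF vars[OF this]]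
      have "mon_eval (var_eval (c, cs)) m = mon_eval (var_eval (c, cs)) (image_mset letter_var (letter_part m))
          * mon_eval (var_eval (c, cs)) (image_mset lyndon_var (lyndon_part m))"
        by (subst s(3)) (rule mon_eval_add)
      also have "mon_eval (var_eval (c, cs)) (image_mset letter_var (letter_part m)) = mon_eval c (letter_part m)"
        unfolding mon_eval_image_mset by (rule mon_eval_cong) (use s(1) var_eval_letter in auto)
      also have "mon_eval (var_eval (c, cs)) (image_mset lyndon_var (lyndon_part m)) = mon_eval (gen_value l cs) (lyndon_part m)"
        unfolding mon_eval_image_mset by (rule mon_eval_cong) (use s(2) var_eval_lyndon in auto)
      finally show "mon_eval c (letter_part m) * mon_eval (gen_value l cs) (lyndon_part m) = mon_eval (var_eval (c, cs)) m" ..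
    qed
    finally show "(\<Sum>a\<in>?K. mon_eval c a * lin_ext (mon_eval (gen_value l cs)) (q a)) = 0" by (simp add: zero)
  qed simp
  have "coeff p m = 0" for m
  proof (rule ccontr)
    assume "coeff p m \<noteq> 0"
    then have m: "m \<in> supp p" by (simp add: in_keys_iff)
    define a where "a = letter_part m"
    have "\<forall>Q\<in>supp (q a). set_mset Q \<subseteq> lyndon_monomial_words"
    proof
      fix Q assume "Q \<in> supp (q a)"
      then obtain n where "n \<in> supp p" "Q = lyndon_part n"
        unfolding q_def by (auto elim!: keys_frag_extendE split: if_splits)
      then show "set_mset Q \<subseteq> lyndon_monomial_words"
        using split_monomial(2)[OF vars] by (auto simp: lyndon_index_def)
    qed
    from gens_independent[OF l this ev0] have qa: "q a = 0" using m by (simp add: a_def)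
    have "coeff (q a) (lyndon_part m) = lin_ext (\<lambda>n. if n = m then 1 else 0) p"
      unfolding q_def lookup_frag_extend
    proof (rule lin_ext_cong)
      fix n assume n: "n \<in> supp p"
      have "letter_part n = a \<and> lyndon_part n = lyndon_part m \<longleftrightarrow> n = m"
        using split_monomial(3)[OF vars[OF n]] split_monomial(3)[OF vars[OF m]] unfolding a_def by metis
      then show "coeff (if letter_part n = a then frag_of (lyndon_part n) else 0) (lyndon_part m) =
          (if n = m then 1 else 0)" by auto
    qed
    then have "coeff p m = 0" by (simp add: qa flip: lookup_eq_lin)
    then show False using m by (simp add: in_keys_iff)
  qed
  then show ?thesis by (intro poly_mapping_eqI) simp
qed

text \<open>
  The image of a polynomial in the generators, described by its values; that this is multiplicative
  is then inherited from evaluation.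
\<close>

definition realize :: "('x tensor_coset multiset \<Rightarrow>\<^sub>0 int) \<Rightarrow> 'x word_sum" where
  "realize p = (SOME g. g \<in> unit_free_frags X \<and> (\<forall>pt. val pt g = poly_eval pt p))"

lemma realize:
  assumes "p \<in> carrier (int_poly_ring vars)"
  shows "realize p \<in> unit_free_frags X" "realize p \<in> monomial_frags X"
    "val pt (realize p) = poly_eval pt p"
proof -
  have "\<exists>g. g \<in> unit_free_frags X \<and> (\<forall>pt. val pt g = poly_eval pt p)"
    using poly_realized[OF assms] by blast
  from someI_ex[OF this] show "realize p \<in> unit_free_frags X" "val pt (realize p) = poly_eval pt p"
    unfolding realize_def by blast+
  then show "realize p \<in> monomial_frags X" using unit_free_frags_subset by blast
qed

lemma frag_eqI:
  assumes "g \<in> monomial_frags X" "h \<in> monomial_frags X"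
    and "\<And>pt. val pt g = val pt h"
  shows "g = h"
proof -
  have "[] \<notin> supp (g - h)"
    using assms(1,2) keys_diff[of g h] by (auto simp: monomial_frags_def monomial_words_def)
  then have "g - h = 0"
    by (rule tensor_eval_injective[OF l_nonzero]) (simp only: lin_ext_diff assms(3) diff_self)
  then show ?thesis by simp
qed

text \<open>
  The words without a factor \<open>1\<close> behind the first place span the image of the polynomial ring, and the
  remaining words span the unit part.
\<close>

theorem poly_direct_sum_vars: "poly_direct_sum Sha vars (sha_unit_part l X)"
  unfolding poly_direct_sum_def
proof (intro bexI conjI)
  let ?P = "carrier (int_poly_ring vars)"
  let ?\<phi> = "\<lambda>p. cl (realize p)"
  show hom: "?\<phi> \<in> ring_hom (int_poly_ring vars) Sha"
  proof (rule ring_hom_memI)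
    fix p assume p: "p \<in> ?P"
    show "?\<phi> p \<in> carrier Sha" using realize(2)[OF p] by (simp add: carrier_sha[OF l_nonzero])
    fix q assume q: "q \<in> ?P"
    have pq: "p * q \<in> ?P" using p q Poly_Mapping.keys_mult[of p q] by fastforce
    have "poly_eval pt (p * q) = poly_eval pt p * poly_eval pt q" for pt
      unfolding poly_eval_def by (rule lin_ext_times) (rule mon_eval_add)
    then have "?\<phi> p \<otimes>\<^bsub>Sha\<^esub> ?\<phi> q = ?\<phi> (p * q)"
      by (intro mult_tensor_class[OF l_nonzero] realize(2) p q pq) 
        (simp only: realize(3)[OF p] realize(3)[OF q] realize(3)[OF pq])
    then show "?\<phi> (p \<otimes>\<^bsub>int_poly_ring vars\<^esub> q) = ?\<phi> p \<otimes>\<^bsub>Sha\<^esub> ?\<phi> q" by simp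
    have ppq: "p + q \<in> ?P" using p q Poly_Mapping.keys_add[of p q] by auto
    have "realize (p + q) = realize p + realize q"
      by (rule frag_eqI) (simp_all only: realize(2)[OF p] realize(2)[OF q] realize(2)[OF ppq] monomial_frags_add
          lin_ext_add realize(3)[OF p] realize(3)[OF q] realize(3)[OF ppq] poly_eval_def)
    then have "?\<phi> (p + q) = ?\<phi> p \<oplus>\<^bsub>Sha\<^esub> ?\<phi> q"
      by (simp add: add_tensor_class[OF realize(2)[OF p] realize(2)[OF q]])
    then show "?\<phi> (p \<oplus>\<^bsub>int_poly_ring vars\<^esub> q) = ?\<phi> p \<oplus>\<^bsub>Sha\<^esub> ?\<phi> q" by simp
  next
    have one: "1 \<in> ?P" by simp
    have "realize 1 = frag_of [{#}]"
    proof (rule frag_eqI)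
      show "frag_of [{#}] \<in> monomial_frags X" by (simp add: monomial_frags_def monomial_words_def)
      show "val pt (realize 1) = val pt (frag_of [{#}])" for pt
        by (simp add: realize(3)[OF one] poly_eval_def tensor_eval_def)
    qed (rule realize(2)[OF one])
    then show "?\<phi> \<one>\<^bsub>int_poly_ring vars\<^esub> = \<one>\<^bsub>Sha\<^esub>" by (simp add: one_tensor_class)
  qed
  show "inj_on ?\<phi> ?P"
  proof (rule inj_onI)
    fix p q assume p: "p \<in> ?P" and q: "q \<in> ?P" and eq: "?\<phi> p = ?\<phi> q"
    then have "realize p = realize q" using tensor_class_eq_iff[OF l_nonzero realize(2)[OF p] realize(2)[OF q]] by blast
    then have "poly_eval pt (p - q) = 0" for pt
      using realize(3)[OF p, of pt] realize(3)[OF q, of pt] by (simp add: poly_eval_def lin_ext_diff)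
    moreover have "p - q \<in> ?P" using p q keys_diff[of p q] by auto
    ultimately have "p - q = 0" using vars_independent by blast
    then show "p = q" by simp
  qed
  show "\<forall>y\<in>vars. ?\<phi> (frag_of {#y#}) = y"
  proof
    fix y assume y: "y \<in> vars"
    then obtain g where g: "g \<in> monomial_frags X" "y = cl g"
      unfolding vars_def letter_var_def lyndon_var_def
      using letter_frag_unit_free lyndon_frag_unit_free unit_free_frags_subset by blast
    have yP: "frag_of {#y#} \<in> ?P" using y by simp
    have rep: "frag_rep y = g" using g frag_rep by simp
    have "realize (frag_of {#y#}) = g"
      by (rule frag_eqI[OF realize(2)[OF yP] g(1)])
        (simp only: realize(3)[OF yP] poly_eval_def lin_ext_frag_of mon_eval_single var_eval_def rep)
    then show "?\<phi> (frag_of {#y#}) = y" using g(2) by simp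
  qed
  have image: "?\<phi> ` ?P = cl ` unit_free_frags X"
  proof (intro subset_antisym subsetI)
    fix c assume "c \<in> cl ` unit_free_frags X"
    then obtain g where g: "g \<in> unit_free_frags X" "c = cl g" by blast
    obtain p where p: "p \<in> ?P" "\<And>pt. poly_eval pt p = val pt g"
      using unit_free_realized[OF g(1)] by blast
    have "realize p = g"
      by (rule frag_eqI[OF realize(2)[OF p(1)] subsetD[OF unit_free_frags_subset g(1)]])
        (simp only: realize(3)[OF p(1)] p(2))
    then show "c \<in> ?\<phi> ` ?P" using p(1) g(2) by blast
  qed (use realize(1) in blast)
  have disj: "unit_free_words X \<inter> unit_words X = {}" "monomial_words X = unit_free_words X \<union> unit_words X"
    by (auto simp: unit_free_words_def unit_words_def)
  have unit_frags: "{g. supp g \<subseteq> unit_words X} \<subseteq> monomial_frags X"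
    by (auto simp: monomial_frags_def unit_words_def)
  show "?\<phi> ` ?P \<inter> sha_unit_part l X = {\<zero>\<^bsub>Sha\<^esub>}"
    unfolding image sha_unit_part_eq[OF l_nonzero] zero_tensor_class
  proof (intro subset_antisym subsetI)
    fix c assume "c \<in> cl ` unit_free_frags X \<inter> cl ` {g. supp g \<subseteq> unit_words X}"
    then obtain g h where gh: "g \<in> unit_free_frags X" "supp h \<subseteq> unit_words X"
      "c = cl g" "cl g = cl h" by blast
    then have "g = h"
      using tensor_class_eq_iff[OF l_nonzero, of g X h] unit_free_frags_subset unit_frags by blast
    then have "supp g \<subseteq> unit_free_words X \<inter> unit_words X"
      using gh(1,2) by (simp add: unit_free_frags_def)
    then have "supp g = {}" unfolding disj(1) by blast
    then show "c \<in> {cl 0}" using gh(3) by simp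
  next
    fix c assume "c \<in> {cl 0}"
    then show "c \<in> cl ` unit_free_frags X \<inter> cl ` {g. supp g \<subseteq> unit_words X}"
      by (auto simp: unit_free_frags_def)
  qed
  show "?\<phi> ` ?P <+>\<^bsub>Sha\<^esub> sha_unit_part l X = carrier Sha"
    unfolding image sha_unit_part_eq[OF l_nonzero] carrier_sha[OF l_nonzero] set_add_def'
  proof (intro subset_antisym subsetI)
    fix c assume "c \<in> (\<Union>h\<in>cl ` unit_free_frags X.
        \<Union>k\<in>cl ` {g. supp g \<subseteq> unit_words X}. {h \<oplus>\<^bsub>Sha\<^esub> k})"
    then obtain g h where gh: "g \<in> monomial_frags X" "h \<in> monomial_frags X"
      "c = cl g \<oplus>\<^bsub>Sha\<^esub> cl h"
      using unit_free_frags_subset unit_frags by blast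
    then show "c \<in> cl ` monomial_frags X"
      using add_tensor_class[OF gh(1,2)] monomial_frags_add by blast
  next
    fix c assume "c \<in> cl ` monomial_frags X"
    then obtain k where k: "supp k \<subseteq> unit_free_words X \<union> unit_words X" "c = cl k"
      unfolding monomial_frags_def disj(2) by blast
    from frag_split[OF k(1)] obtain g h where gh: "supp g \<subseteq> unit_free_words X"
      "supp h \<subseteq> unit_words X" "g + h = k" by blast
    then have g: "g \<in> unit_free_frags X" and h: "h \<in> {g. supp g \<subseteq> unit_words X}"
      by (simp_all add: unit_free_frags_def)
    have "c = cl g \<oplus>\<^bsub>Sha\<^esub> cl h"
      using add_tensor_class[OF subsetD[OF unit_free_frags_subset g] subsetD[OF unit_frags h]] k(2) gh(3)
      by simp
    then show "c \<in> (\<Union>h\<in>cl ` unit_free_frags X.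
        \<Union>k\<in>cl ` {g. supp g \<subseteq> unit_words X}. {h \<oplus>\<^bsub>Sha\<^esub> k})"
      using g h by blast
  qed
qed

lemma lyndon_var_homogeneous:
  assumes v: "v \<in> lyndon_index"
  shows "lyndon_var v \<in> sha_homogeneous l X (word_degree v)"
  unfolding lyndon_var_def
proof (rule tensor_class_homogeneous[OF l_nonzero])
  show "lyndon_frag v \<in> monomial_frags X" using lyndon_frag_unit_free[OF v] unit_free_frags_subset by blast
  have deg: "word_degree w = size (sum_list w)" for w :: "'x multiset list"
    by (induction w) (auto simp: word_degree_def)
  show "word_degree ws = word_degree v" if "ws \<in> supp (lyndon_frag v)" for ws
    by (rule keys_lyndon_frag[OF v that]) (simp add: deg words_of_def)
qed

end

theorem theorem5p6:
  fixes X :: "'x set" and r :: "('x \<times> 'x) set" and l :: int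
  assumes "countable X"
    and "l = 1 \<or> l = -1"
  shows "\<exists>\<Omega>. poly_direct_sum (sha_poly l X) \<Omega> (sha_unit_part l X) \<and>
    (finite X \<and> strict_linear_order_on X r \<longrightarrow>
      (\<exists>Y \<psi>. \<Omega> = sha_variable l X ` X \<union> Y \<and>
             inj_on (sha_variable l X) X \<and>
             sha_variable l X ` X \<inter> Y = {} \<and>
             bij_betw \<psi> (lyndon_words X r) Y \<and>
             (\<forall>w \<in> lyndon_words X r. \<psi> w \<in> sha_homogeneous l X (word_degree w))))"
proof -
  have l: "l * l = 1" using assms(2) by auto
  obtain r' where r': "strict_total r'"
    "strict_linear_order_on X r \<longrightarrow> (\<forall>a\<in>X. \<forall>b\<in>X. (a, b) \<in> r \<longleftrightarrow> (a, b) \<in> r')"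
    using strict_total_extension[of X r] by blast
  interpret monomial_order "monomial_less r'"
    by (rule strict_total.monomial_order_monomial_less[OF r'(1)])
  interpret sha_generators "monomial_less r'" l X
    by unfold_locales (rule l)
  have var: "sha_variable l X = letter_var"
    by (rule ext) (simp add: sha_variable_def monomial_tensor_eq letter_var_def letter_frag_def)
  have main: "\<exists>Y \<psi>. vars = letter_var ` X \<union> Y \<and> inj_on letter_var X \<and>
             letter_var ` X \<inter> Y = {} \<and> bij_betw \<psi> (lyndon_words X r) Y \<and>
             (\<forall>w \<in> lyndon_words X r. \<psi> w \<in> sha_homogeneous l X (word_degree w))"
    if "strict_linear_order_on X r"
  proof (intro exI[of _ "lyndon_var ` lyndon_index"] exI[of _ lyndon_var] conjI)
    have "\<forall>a\<in>X. \<forall>b\<in>X. (a, b) \<in> r \<longleftrightarrow> (a, b) \<in> r'" using r'(2) that by (rule mp)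
    then have "lyndon_words X r = lyndon_index"
      unfolding lyndon_index_def by (intro lyndon_words_eq[OF r'(1)]) blast
    note lw = this
    show "vars = letter_var ` X \<union> lyndon_var ` lyndon_index" by (rule vars_def)
    show "inj_on letter_var X" by (rule letter_var_inj)
    show "letter_var ` X \<inter> lyndon_var ` lyndon_index = {}" by (rule letter_lyndon_disjoint)
    show "bij_betw lyndon_var (lyndon_words X r) (lyndon_var ` lyndon_index)"
      unfolding lw by (rule inj_on_imp_bij_betw[OF lyndon_var_inj])
    show "\<forall>w \<in> lyndon_words X r. lyndon_var w \<in> sha_homogeneous l X (word_degree w)"
      unfolding lw using lyndon_var_homogeneous by blast
  qed
  show ?thesis
    unfolding var
  proof (rule exI[of _ vars], intro conjI impI)
    show "poly_direct_sum (sha_poly l X) vars (sha_unit_part l X)" by (rule poly_direct_sum_vars)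
    assume "finite X \<and> strict_linear_order_on X r"
    then show "\<exists>Y \<psi>. vars = letter_var ` X \<union> Y \<and> inj_on letter_var X \<and>
             letter_var ` X \<inter> Y = {} \<and> bij_betw \<psi> (lyndon_words X r) Y \<and>
             (\<forall>w \<in> lyndon_words X r. \<psi> w \<in> sha_homogeneous l X (word_degree w))"
      by (intro main) (rule conjunct2)
  qed
qed

end
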